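(* Consider the quantized Newton's method described in the context with $\alpha=\frac12$, started from a point $x^{(0)}\in\mathbb{R}^d$ such that $\max_i\{\|x^{(0)}-x^*\|,\|x^{(0)}-x_i^*\|\}\le\frac{\mu}{4\sigma}$. Then its iterates satisfy, for all $t\ge0$, $$\|x^{(t)}-x^*\|\le\frac{\mu}{4\sigma}\left(\frac34\right)^t,$$ and the communication cost until reaching accuracy $\epsilon$ in terms of function values (that is, until $f(x^{(t)})-f^*\le\epsilon$) is $$\mathcal{O}\left(nd^2\log\left(\sqrt d\,\kappa\right)\log\frac{\gamma\mu^2}{\sigma^2\epsilon}\right)$$ many bits in total.
   Context: Norms: $\|\cdot\|$ is the Euclidean norm of vectors and the $\ell_2$ operator norm of matrices. Setting. There are $n$ nodes, one of which, $i_0$, is the master; node $i$ owns $f_i:\mathbb{R}^d\to\mathbb{R}$, and $f=\frac1n\sum_{i=1}^nf_i$. All $f_i$ are $\gamma$-smooth and $\mu$-strongly convex with $\sigma$-Lipschitz Hessian, $\gamma,\mu,\sigma>0$. $\kappa=\gamma/\mu$. $x^*$ is the minimizer of $f$, $f^*=f(x^* )$, and $x_i^*$ is the minimizer of $f_i$. Vectorization. $\mathbb{S}(d)$ is the space of symmetric $d\times d$ matrices and $\phi:\mathbb{S}(d)\to\mathbb{R}^{d(d+1)/2}$ is the linear isomorphism listing the upper-triangular entries, $\phi(P)=(p_{11},\dots,p_{1d},p_{22},\dots,p_{2d},\dots,p_{dd})$. Quantization. For each dimension $N$ there is a fixed deterministic quantization function $Q:\mathbb{R}^N\times\mathbb{R}^N\times\mathbb{R}_{>0}\times\mathbb{R}_{>0}\to\mathbb{R}^N$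 such that, for all $y,\varepsilon>0$, there are an encoding $\mathrm{enc}_{\varepsilon,y}:\mathbb{R}^N\to\{0,1\}^b$ and a decoding $\mathrm{dec}_{\varepsilon,y}:\{0,1\}^b\times\mathbb{R}^N\to\mathbb{R}^N$ with: whenever $\|x-x'\|\le y$, $\mathrm{dec}_{\varepsilon,y}(\mathrm{enc}_{\varepsilon,y}(x),x')=Q(x,x',y,\varepsilon)$ and $\|Q(x,x',y,\varepsilon)-x\|\le\varepsilon$; moreover $b=\mathcal{O}(N\log_2(y/\varepsilon))$ when $y/\varepsilon\ge2$. When $\|x-x'\|\le y$, the value $Q(x,x',y,\varepsilon)$ does not depend on $x'$ (it is a closest point to $x$ in a fixed lattice). Each evaluation of $Q(x,x',y,\varepsilon)$ for a transmission between the master and one node costs the $b$ bits of the encoding of $x$; the receiver holds $x'$. Algorithm (quantized Newton's method with parameter $\alpha\in(0,1)$). Initialization: $x^{(0)}$ with $\max_i\{\|x^{(0)}-x^*\|,\|x^{(0)}-x_i^*\|\}\le\frac{\alpha\mu}{2\sigma}$. Parameters: $G^{(t)}=\frac\mu4\alpha\left(\frac{1+\alpha}2\right)^t$, $\theta=\frac{\alpha(1-\alpha)}4$, $K=\frac2\alpha$, $P^{(t)}=\frac{\mu}{2\sigma}K\alpha\left(\frac{1+\alpha}2\right)^t$. Initial Hessian: node $i$ sends to the master $H_0^i=\phi^{-1}\big(Q(\phi(\nabla^2f_i(x^{(0)})),\phi(\nabla^2f_{i_0}(x^{(0)})),2\sqrt d\gamma,\frac{G^{(0)}}{2\sqrt2\kappa})\big)$;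 $S_0=\frac1n\sum_iH_0^i$; the master sends $S_0$ to each node $i$, which decodes $H_0=\phi^{-1}\big(Q(\phi(S_0),\phi(\nabla^2f_i(x^{(0)})),\sqrt d(\frac{G^{(0)}}{2\kappa}+2\gamma),\frac{G^{(0)}}{2\sqrt2\kappa})\big)$. Initial direction: node $i$ sends to the master $v_i^{(0)}=Q(H_0^{-1}\nabla f_i(x^{(0)}),H_0^{-1}\nabla f_{i_0}(x^{(0)}),4\kappa P^{(0)},\frac{\theta P^{(0)}}2)$; $p^{(0)}=\frac1n\sum_iv_i^{(0)}$; the master sends $p^{(0)}$ to each node $i$, which decodes $v^{(0)}=Q(p^{(0)},H_0^{-1}\nabla f_i(x^{(0)}),(\frac\theta2+4\kappa)P^{(0)},\frac{\theta P^{(0)}}2)$. For $t\ge0$: $x^{(t+1)}=x^{(t)}-v^{(t)}$; node $i$ sends to the master $H_{t+1}^i=\phi^{-1}\big(Q(\phi(\nabla^2f_i(x^{(t+1)})),\phi(H_t^i),\frac{10\sqrt d}{1+\alpha}G^{(t+1)},\frac{G^{(t+1)}}{2\sqrt2\kappa})\big)$; $S_{t+1}=\frac1n\sum_iH_{t+1}^i$; the master sends it to the nodes, which decode $H_{t+1}=\phi^{-1}\big(Q(\phi(S_{t+1}),\phi(H_t),\sqrt d(\frac1{2\kappa}+\frac{10}{1+\alpha})G^{(t+1)},\frac{G^{(t+1)}}{2\sqrt2\kappa})\big)$; node $i$ sends to the master $v_i^{(t+1)}=Q(H_{t+1}^{-1}\nabla f_i(x^{(t+1)}),v_i^{(t)},11\kappa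 P^{(t+1)},\frac{\theta P^{(t+1)}}2)$; $p^{(t+1)}=\frac1n\sum_iv_i^{(t+1)}$; the master sends it to the nodes, which decode $v^{(t+1)}=Q(p^{(t+1)},v^{(t)},(\frac\theta2+11\kappa)P^{(t+1)},\frac{\theta P^{(t+1)}}2)$.
   Formalization: The O-bound is stated for √d·κ and γμ²/(σ²ε) both at least ρ, for any fixed ρ>1, with a constant depending on ρ and the quantizer; for d=1, κ=1 the stated bound is 0 while the cost is positive. *)

theory Defs
  imports
    "HOL-Analysis.L2_Norm"
    "Jordan_Normal_Form.Gauss_Jordan_Elimination"
begin

text \<open>The space of d-dimensional real vectors is \<open>carrier_vec d :: real vec set\<close>: the dimension is
  a natural number, so that the constant of an asymptotic bound can be quantified before it.\<close>

definition vnorm :: "real vec \<Rightarrow> real" where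
  "vnorm x = L2_set (\<lambda>i. x $ i) {..<dim_vec x}"

definition opnorm :: "real mat \<Rightarrow> real" where
  "opnorm A = (SUP v\<in>{v \<in> carrier_vec (dim_col A). vnorm v \<le> 1}. vnorm (A *\<^sub>v v))"

definition has_gradient :: "nat \<Rightarrow> (real vec \<Rightarrow> real) \<Rightarrow> real vec \<Rightarrow> real vec \<Rightarrow> bool" where
  "has_gradient d f g x \<longleftrightarrow> g \<in> carrier_vec d \<and>
     (\<forall>e>0. \<exists>\<delta>>0. \<forall>y\<in>carrier_vec d. vnorm (y - x) < \<delta> \<longrightarrow>
        \<bar>f y - f x - g \<bullet> (y - x)\<bar> \<le> e * vnorm (y - x))"

definition has_jacobian :: "nat \<Rightarrow> (real vec \<Rightarrow> real vec) \<Rightarrow> real mat \<Rightarrow> real vec \<Rightarrow> bool" where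
  "has_jacobian d F J x \<longleftrightarrow> J \<in> carrier_mat d d \<and>
     (\<forall>e>0. \<exists>\<delta>>0. \<forall>y\<in>carrier_vec d. vnorm (y - x) < \<delta> \<longrightarrow>
        vnorm (F y - F x - J *\<^sub>v (y - x)) \<le> e * vnorm (y - x))"

text \<open>In the next three definitions \<open>gr\<close> and \<open>hs\<close> stand for the gradient and the Hessian of \<open>f\<close>.\<close>

definition smooth_fun :: "nat \<Rightarrow> real \<Rightarrow> (real vec \<Rightarrow> real vec) \<Rightarrow> bool" where
  "smooth_fun d \<gamma> gr \<longleftrightarrow>
     (\<forall>x\<in>carrier_vec d. \<forall>y\<in>carrier_vec d. vnorm (gr x - gr y) \<le> \<gamma> * vnorm (x - y))"

definition strongly_convex ::
    "nat \<Rightarrow> real \<Rightarrow> (real vec \<Rightarrow> real) \<Rightarrow> (real vec \<Rightarrow> real vec) \<Rightarrow> bool" where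
  "strongly_convex d \<mu> f gr \<longleftrightarrow>
     (\<forall>x\<in>carrier_vec d. \<forall>y\<in>carrier_vec d.
        f x + gr x \<bullet> (y - x) + \<mu> / 2 * (vnorm (y - x))\<^sup>2 \<le> f y)"

definition lipschitz_hessian :: "nat \<Rightarrow> real \<Rightarrow> (real vec \<Rightarrow> real mat) \<Rightarrow> bool" where
  "lipschitz_hessian d \<sigma> hs \<longleftrightarrow>
     (\<forall>x\<in>carrier_vec d. \<forall>y\<in>carrier_vec d. opnorm (hs x - hs y) \<le> \<sigma> * vnorm (x - y))"

text \<open>Nodes are the numbers below \<open>n\<close>; the functions \<open>f i\<close>, with gradients \<open>gr i\<close> and Hessians
  \<open>hs i\<close>, are constrained on \<open>carrier_vec d\<close> only.\<close>

definition newton_setting ::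
    "nat \<Rightarrow> nat \<Rightarrow> nat \<Rightarrow> (nat \<Rightarrow> real vec \<Rightarrow> real) \<Rightarrow> (nat \<Rightarrow> real vec \<Rightarrow> real vec) \<Rightarrow>
     (nat \<Rightarrow> real vec \<Rightarrow> real mat) \<Rightarrow> real \<Rightarrow> real \<Rightarrow> real \<Rightarrow> bool" where
  "newton_setting d n i0 f gr hs \<gamma> \<mu> \<sigma> \<longleftrightarrow>
     0 < d \<and> i0 < n \<and> 0 < \<gamma> \<and> 0 < \<mu> \<and> 0 < \<sigma> \<and>
     (\<forall>i<n. (\<forall>x\<in>carrier_vec d. has_gradient d (f i) (gr i x) x \<and> has_jacobian d (gr i) (hs i x) x) \<and>
        smooth_fun d \<gamma> (gr i) \<and> strongly_convex d \<mu> (f i) (gr i) \<and> lipschitz_hessian d \<sigma> (hs i))"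

definition mean_fun :: "nat \<Rightarrow> (nat \<Rightarrow> real vec \<Rightarrow> real) \<Rightarrow> real vec \<Rightarrow> real" where
  "mean_fun n f x = (\<Sum>i<n. f i x) / real n"

definition mean_vec :: "nat \<Rightarrow> nat \<Rightarrow> (nat \<Rightarrow> real vec) \<Rightarrow> real vec" where
  "mean_vec d n w = vec d (\<lambda>k. (\<Sum>i<n. w i $ k) / real n)"

definition mean_mat :: "nat \<Rightarrow> nat \<Rightarrow> (nat \<Rightarrow> real mat) \<Rightarrow> real mat" where
  "mean_mat d n A = mat d d (\<lambda>kl. (\<Sum>i<n. A i $$ kl) / real n)"

definition sym_mats :: "nat \<Rightarrow> real mat set" where
  "sym_mats d = {P \<in> carrier_mat d d. transpose_mat P = P}"

definition sym_dim :: "nat \<Rightarrow> nat" where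
  "sym_dim d = d * (d + 1) div 2"

definition vectorize :: "nat \<Rightarrow> real mat \<Rightarrow> real vec" where
  "vectorize d P = vec_of_list [P $$ (i, j). i \<leftarrow> [0..<d], j \<leftarrow> [i..<d]]"

definition unvectorize :: "nat \<Rightarrow> real vec \<Rightarrow> real mat" where
  "unvectorize d = the_inv_into (sym_mats d) (vectorize d)"

text \<open>\<open>Q N x x' y \<epsilon>\<close> is the quantization in dimension \<open>N\<close>, and \<open>b N y \<epsilon>\<close> is the number of bits of an
  encoding. The constant \<open>c\<close> is the one of \<open>b = O(N log (y/\<epsilon>))\<close>, uniform in all arguments.\<close>

definition quantization ::
    "(nat \<Rightarrow> real vec \<Rightarrow> real vec \<Rightarrow> real \<Rightarrow> real \<Rightarrow> real vec) \<Rightarrow>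
     (nat \<Rightarrow> real \<Rightarrow> real \<Rightarrow> real vec \<Rightarrow> bool list) \<Rightarrow>
     (nat \<Rightarrow> real \<Rightarrow> real \<Rightarrow> bool list \<Rightarrow> real vec \<Rightarrow> real vec) \<Rightarrow>
     (nat \<Rightarrow> real \<Rightarrow> real \<Rightarrow> nat) \<Rightarrow> bool" where
  "quantization Q enc dec b \<longleftrightarrow>
     (\<forall>N>0. \<forall>y>0. \<forall>\<epsilon>>0.
        (\<forall>x\<in>carrier_vec N. length (enc N \<epsilon> y x) = b N y \<epsilon>) \<and>
        (\<forall>x\<in>carrier_vec N. \<forall>x'\<in>carrier_vec N. Q N x x' y \<epsilon> \<in> carrier_vec N) \<and>
        (\<forall>x\<in>carrier_vec N. \<forall>x'\<in>carrier_vec N. vnorm (x - x') \<le> y \<longrightarrow>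
           dec N \<epsilon> y (enc N \<epsilon> y x) x' = Q N x x' y \<epsilon> \<and>
           vnorm (Q N x x' y \<epsilon> - x) \<le> \<epsilon>) \<and>
        (\<forall>x\<in>carrier_vec N. \<forall>x'\<in>carrier_vec N. \<forall>x''\<in>carrier_vec N.
           vnorm (x - x') \<le> y \<longrightarrow> vnorm (x - x'') \<le> y \<longrightarrow> Q N x x' y \<epsilon> = Q N x x'' y \<epsilon>)) \<and>
     (\<exists>c. \<forall>N>0. \<forall>y>0. \<forall>\<epsilon>>0. 2 \<le> y / \<epsilon> \<longrightarrow>
        real (b N y \<epsilon>) \<le> c * (real N * log 2 (y / \<epsilon>)))"

definition qn_G :: "real \<Rightarrow> real \<Rightarrow> nat \<Rightarrow> real" where
  "qn_G \<mu> \<alpha> t = \<mu> / 4 * \<alpha> * ((1 + \<alpha>) / 2) ^ t"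

definition qn_theta :: "real \<Rightarrow> real" where
  "qn_theta \<alpha> = \<alpha> * (1 - \<alpha>) / 4"

definition qn_K :: "real \<Rightarrow> real" where
  "qn_K \<alpha> = 2 / \<alpha>"

definition qn_P :: "real \<Rightarrow> real \<Rightarrow> real \<Rightarrow> nat \<Rightarrow> real" where
  "qn_P \<mu> \<sigma> \<alpha> t = \<mu> / (2 * \<sigma>) * qn_K \<alpha> * \<alpha> * ((1 + \<alpha>) / 2) ^ t"

text \<open>The arguments \<open>y\<close> (\<open>rad\<close>) and \<open>\<epsilon>\<close> (\<open>res\<close>) of \<open>Q\<close> in round \<open>t\<close>, for the messages sent to the
  master (\<open>up\<close>) and by the master (\<open>down\<close>), about Hessians (\<open>hess\<close>) and directions (\<open>dir\<close>). Round
  0 is the initialization; round \<open>t + 1\<close> follows the update of the iterate to \<open>x (t + 1)\<close>.\<close>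

definition hess_res :: "real \<Rightarrow> real \<Rightarrow> real \<Rightarrow> nat \<Rightarrow> real" where
  "hess_res \<gamma> \<mu> \<alpha> t = qn_G \<mu> \<alpha> t / (2 * sqrt 2 * (\<gamma> / \<mu>))"

definition hess_up_rad :: "nat \<Rightarrow> real \<Rightarrow> real \<Rightarrow> real \<Rightarrow> nat \<Rightarrow> real" where
  "hess_up_rad d \<gamma> \<mu> \<alpha> t =
     (if t = 0 then 2 * sqrt d * \<gamma> else 10 * sqrt d / (1 + \<alpha>) * qn_G \<mu> \<alpha> t)"

definition hess_down_rad :: "nat \<Rightarrow> real \<Rightarrow> real \<Rightarrow> real \<Rightarrow> nat \<Rightarrow> real" where
  "hess_down_rad d \<gamma> \<mu> \<alpha> t =
     (if t = 0 then sqrt d * (qn_G \<mu> \<alpha> 0 / (2 * (\<gamma> / \<mu>)) + 2 * \<gamma>)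
      else sqrt d * (1 / (2 * (\<gamma> / \<mu>)) + 10 / (1 + \<alpha>)) * qn_G \<mu> \<alpha> t)"

definition dir_res :: "real \<Rightarrow> real \<Rightarrow> real \<Rightarrow> nat \<Rightarrow> real" where
  "dir_res \<mu> \<sigma> \<alpha> t = qn_theta \<alpha> * qn_P \<mu> \<sigma> \<alpha> t / 2"

definition dir_up_rad :: "real \<Rightarrow> real \<Rightarrow> real \<Rightarrow> real \<Rightarrow> nat \<Rightarrow> real" where
  "dir_up_rad \<gamma> \<mu> \<sigma> \<alpha> t = (if t = 0 then 4 else 11) * (\<gamma> / \<mu>) * qn_P \<mu> \<sigma> \<alpha> t"

definition dir_down_rad :: "real \<Rightarrow> real \<Rightarrow> real \<Rightarrow> real \<Rightarrow> nat \<Rightarrow> real" where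
  "dir_down_rad \<gamma> \<mu> \<sigma> \<alpha> t =
     (qn_theta \<alpha> / 2 + (if t = 0 then 4 else 11) * (\<gamma> / \<mu>)) * qn_P \<mu> \<sigma> \<alpha> t"

definition quantize_mat ::
    "(nat \<Rightarrow> real vec \<Rightarrow> real vec \<Rightarrow> real \<Rightarrow> real \<Rightarrow> real vec) \<Rightarrow> nat \<Rightarrow>
     real mat \<Rightarrow> real mat \<Rightarrow> real \<Rightarrow> real \<Rightarrow> real mat" where
  "quantize_mat Q d A R y \<epsilon> = unvectorize d (Q (sym_dim d) (vectorize d A) (vectorize d R) y \<epsilon>)"

definition newton_dir :: "real mat \<Rightarrow> real vec \<Rightarrow> real vec" where
  "newton_dir H g = the (mat_inverse H) *\<^sub>v g"

text \<open>The sequences \<open>x, Hi, H, vi, v\<close> are an execution of the algorithm from \<open>x0\<close>: \<open>Hi t i\<close> and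
  \<open>vi t i\<close> are the Hessian and the direction that node \<open>i\<close> sends in round \<open>t\<close>, and \<open>H t\<close>
  and \<open>v t\<close> those that all nodes decode.\<close>

definition quantized_newton ::
    "(nat \<Rightarrow> real vec \<Rightarrow> real vec \<Rightarrow> real \<Rightarrow> real \<Rightarrow> real vec) \<Rightarrow>
     nat \<Rightarrow> nat \<Rightarrow> nat \<Rightarrow> (nat \<Rightarrow> real vec \<Rightarrow> real vec) \<Rightarrow> (nat \<Rightarrow> real vec \<Rightarrow> real mat) \<Rightarrow>
     real \<Rightarrow> real \<Rightarrow> real \<Rightarrow> real \<Rightarrow> real vec \<Rightarrow>
     (nat \<Rightarrow> real vec) \<Rightarrow> (nat \<Rightarrow> nat \<Rightarrow> real mat) \<Rightarrow> (nat \<Rightarrow> real mat) \<Rightarrow>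
     (nat \<Rightarrow> nat \<Rightarrow> real vec) \<Rightarrow> (nat \<Rightarrow> real vec) \<Rightarrow> bool" where
  "quantized_newton Q d n i0 gr hs \<gamma> \<mu> \<sigma> \<alpha> x0 x Hi H vi v \<longleftrightarrow>
     x 0 = x0 \<and>
     (\<forall>i<n. Hi 0 i = quantize_mat Q d (hs i (x 0)) (hs i0 (x 0))
        (hess_up_rad d \<gamma> \<mu> \<alpha> 0) (hess_res \<gamma> \<mu> \<alpha> 0)) \<and>
     (\<forall>i<n. H 0 = quantize_mat Q d (mean_mat d n (Hi 0)) (hs i (x 0))
        (hess_down_rad d \<gamma> \<mu> \<alpha> 0) (hess_res \<gamma> \<mu> \<alpha> 0)) \<and>
     (\<forall>i<n. vi 0 i = Q d (newton_dir (H 0) (gr i (x 0))) (newton_dir (H 0) (gr i0 (x 0)))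
        (dir_up_rad \<gamma> \<mu> \<sigma> \<alpha> 0) (dir_res \<mu> \<sigma> \<alpha> 0)) \<and>
     (\<forall>i<n. v 0 = Q d (mean_vec d n (vi 0)) (newton_dir (H 0) (gr i (x 0)))
        (dir_down_rad \<gamma> \<mu> \<sigma> \<alpha> 0) (dir_res \<mu> \<sigma> \<alpha> 0)) \<and>
     (\<forall>t. x (Suc t) = x t - v t \<and>
       (\<forall>i<n. Hi (Suc t) i = quantize_mat Q d (hs i (x (Suc t))) (Hi t i)
          (hess_up_rad d \<gamma> \<mu> \<alpha> (Suc t)) (hess_res \<gamma> \<mu> \<alpha> (Suc t))) \<and>
       H (Suc t) = quantize_mat Q d (mean_mat d n (Hi (Suc t))) (H t)
          (hess_down_rad d \<gamma> \<mu> \<alpha> (Suc t)) (hess_res \<gamma> \<mu> \<alpha> (Suc t)) \<and>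
       (\<forall>i<n. vi (Suc t) i = Q d (newton_dir (H (Suc t)) (gr i (x (Suc t)))) (vi t i)
          (dir_up_rad \<gamma> \<mu> \<sigma> \<alpha> (Suc t)) (dir_res \<mu> \<sigma> \<alpha> (Suc t))) \<and>
       v (Suc t) = Q d (mean_vec d n (vi (Suc t))) (v t)
          (dir_down_rad \<gamma> \<mu> \<sigma> \<alpha> (Suc t)) (dir_res \<mu> \<sigma> \<alpha> (Suc t)))"

text \<open>In each round every node sends and receives one Hessian and one direction; the master is
  counted as one of these nodes, which can only increase the total. The cost of
  reaching \<open>x T\<close> includes the initialization and the complete rounds \<open>1, \<dots>, T\<close>.\<close>

definition round_bits ::
    "(nat \<Rightarrow> real \<Rightarrow> real \<Rightarrow> nat) \<Rightarrow> nat \<Rightarrow> nat \<Rightarrow> real \<Rightarrow> real \<Rightarrow> real \<Rightarrow> real \<Rightarrow> nat \<Rightarrow> nat" where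
  "round_bits b d n \<gamma> \<mu> \<sigma> \<alpha> t =
     (\<Sum>i<n. b (sym_dim d) (hess_up_rad d \<gamma> \<mu> \<alpha> t) (hess_res \<gamma> \<mu> \<alpha> t)
           + b (sym_dim d) (hess_down_rad d \<gamma> \<mu> \<alpha> t) (hess_res \<gamma> \<mu> \<alpha> t)
           + b d (dir_up_rad \<gamma> \<mu> \<sigma> \<alpha> t) (dir_res \<mu> \<sigma> \<alpha> t)
           + b d (dir_down_rad \<gamma> \<mu> \<sigma> \<alpha> t) (dir_res \<mu> \<sigma> \<alpha> t))"

definition total_bits ::
    "(nat \<Rightarrow> real \<Rightarrow> real \<Rightarrow> nat) \<Rightarrow> nat \<Rightarrow> nat \<Rightarrow> real \<Rightarrow> real \<Rightarrow> real \<Rightarrow> real \<Rightarrow> nat \<Rightarrow> nat" where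
  "total_bits b d n \<gamma> \<mu> \<sigma> \<alpha> T = (\<Sum>t\<le>T. round_bits b d n \<gamma> \<mu> \<sigma> \<alpha> t)"

end

theory Submission
  imports Defs "Jordan_Normal_Form.Determinant"
begin

text \<open>For \<open>\<alpha> = 1/2\<close> all radii, resolutions and error bounds shrink by the factor \<open>3/4\<close> per round (only the
radii of the initialization do not fit the pattern), so every estimate is a multiple of
\<open>q = (3/4) ^ t\<close>. The theorem is an induction on \<open>t\<close> with the hypothesis \<open>tracks\<close>: the iterate is
within \<open>\<mu> q / (4 \<sigma>)\<close> of the minimizer, the Hessians and directions that the nodes have sent are close to
the true ones, and the decoded mean Hessian \<open>H\<close> and mean direction \<open>v\<close> satisfy twice these error bounds.

Contraction (\<open>newton_step\<close>). Since \<open>H\<close> is within \<open>\<mu>/8\<close> of the mean Hessian, \<open>H \<ge> 7\<mu>/8\<close>. With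
\<open>e = x - x*\<close>, the exact Newton direction for \<open>H\<close> misses \<open>e\<close> by the inverse of \<open>H\<close> applied to
\<open>(\<nabla>f(x) - \<nabla>\<^sup>2f(x) e) + (\<nabla>\<^sup>2f(x) - H) e\<close>, whose norm is at most \<open>\<sigma> \<parallel>e\<parallel>\<^sup>2 + \<mu>/8 \<parallel>e\<parallel>\<close>. In units of
\<open>\<mu> q / \<sigma>\<close> this amounts to an error of \<open>3/28\<close>; quantization adds \<open>1/16\<close>, and \<open>3/28 + 1/16\<close> is below
the required \<open>3/16\<close>. The Taylor remainder with constant \<open>\<sigma>\<close> instead of \<open>\<sigma>/2\<close> is good enough here, so that
the mean value theorem on a line replaces integration (\<open>jacobian_approximation\<close>).

Decoding (\<open>tracks_step\<close>). A quantization is accurate only if the reference of the receiver lies within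
the radius. Consecutive iterates are at most \<open>7/16 \<mu> q / \<sigma>\<close> apart, so Hessians move by at most \<open>7/16 \<mu> q\<close>.
The gradient of a single node need not tend to \<open>0\<close>, but it stays below \<open>3 \<gamma> \<mu> / (4 \<sigma>)\<close>; as \<open>H\<close> and the
gradient both move by multiples of \<open>q\<close>, so do the local directions (\<open>newton_dir_change\<close>). Passing from
operator norm to the norm of the vectorization costs a factor \<open>\<surd>d\<close>, the way back a factor \<open>\<surd>2\<close>
(\<open>vnorm_vectorize_le\<close>, \<open>op_bounded_vectorize\<close>); the latter needs symmetric Hessians, which follow
from second differences (\<open>hs_self_adjoint\<close>).

Existence of a run (\<open>run_exists\<close>). From round 1 on, a run is an explicit recursion. In the initialization
the nodes decode with different references, and must still obtain the same value: the references all
lie within the radius, where the quantization does not depend on them.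

Cost (\<open>total_bits_le\<close>). Every quotient of radius and resolution lies between \<open>2\<close> and
\<open>353 (\<surd>d \<kappa>)\<^sup>2\<close>, so a round costs \<open>O(n d\<^sup>2 log (\<surd>d \<kappa>))\<close> bits once \<open>\<surd>d \<kappa>\<close> is bounded away from \<open>1\<close>. The gap
\<open>f(x) - f*\<close> is at most \<open>\<gamma> \<parallel>x - x*\<parallel>\<^sup>2\<close>, which decays like \<open>(9/16) ^ t\<close>, so logarithmically many rounds suffice.\<close>

section \<open>The Euclidean norm\<close>

lemma vnorm_nonneg [simp]: "0 \<le> vnorm x"
  by (simp add: vnorm_def L2_set_def sum_nonneg)

lemma vnorm_sq: "(vnorm x)\<^sup>2 = x \<bullet> x"
  by (simp add: vnorm_def L2_set_def sum_nonneg scalar_prod_def power2_eq_square lessThan_atLeast0)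

lemma cauchy_schwarz:
  assumes "x \<in> carrier_vec d" "y \<in> carrier_vec d"
  shows "\<bar>x \<bullet> y\<bar> \<le> vnorm x * vnorm y"
proof -
  have "\<bar>x \<bullet> y\<bar> \<le> (\<Sum>i<d. \<bar>x $ i\<bar> * \<bar>y $ i\<bar>)"
    using assms by (auto simp: scalar_prod_def lessThan_atLeast0 abs_mult[symmetric] intro: sum_abs)
  also have "\<dots> \<le> vnorm x * vnorm y"
    using assms by (auto simp: vnorm_def intro: L2_set_mult_ineq)
  finally show ?thesis .
qed

lemma vnorm_add:
  assumes "x \<in> carrier_vec d" "y \<in> carrier_vec d"
  shows "vnorm (x + y) \<le> vnorm x + vnorm y"
  using assms L2_set_triangle_ineq[of "\<lambda>i. x $ i" "\<lambda>i. y $ i" "{..<d}"]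
  by (auto simp: vnorm_def intro: order.trans[OF eq_refl[OF L2_set_cong]])

lemma vnorm_smult [simp]: "vnorm (c \<cdot>\<^sub>v x) = \<bar>c\<bar> * vnorm x"
proof -
  have "vnorm (c \<cdot>\<^sub>v x) = L2_set (\<lambda>i. c * x $ i) {..<dim_vec x}"
    unfolding vnorm_def by (rule L2_set_cong) auto
  also have "\<dots> = \<bar>c\<bar> * vnorm x"
    unfolding vnorm_def L2_set_def
    by (simp add: power_mult_distrib sum_distrib_left[symmetric] real_sqrt_mult)
  finally show ?thesis .
qed

lemma vnorm_minus_commute:
  assumes "x \<in> carrier_vec d" "y \<in> carrier_vec d"
  shows "vnorm (x - y) = vnorm (y - x)"
proof -
  have "x - y = (-1) \<cdot>\<^sub>v (y - x)"
    using assms by (intro eq_vecI) auto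
  then show ?thesis by simp
qed

lemma vnorm_triangle:
  assumes "x \<in> carrier_vec d" "y \<in> carrier_vec d" "z \<in> carrier_vec d"
  shows "vnorm (x - z) \<le> vnorm (x - y) + vnorm (y - z)"
proof -
  have "x - z = (x - y) + (y - z)"
    using assms by (intro eq_vecI) auto
  then show ?thesis
    using assms vnorm_add[of "x - y" d "y - z"] by auto
qed

lemma vnorm_le_add_diff:
  assumes "x \<in> carrier_vec d" "y \<in> carrier_vec d"
  shows "vnorm x \<le> vnorm y + vnorm (x - y)"
proof -
  have "x = y + (x - y)"
    using assms by (intro eq_vecI) auto
  then show ?thesis
    using assms vnorm_add[of "y" d "x - y"] by auto
qed

lemma vec_add_minus_cancel:
  fixes x y :: "real vec"
  shows "x \<in> carrier_vec d \<Longrightarrow> y \<in> carrier_vec d \<Longrightarrow> y + (x - y) = x"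
  by (intro eq_vecI) auto

lemma vec_minus_zero:
  fixes x :: "real vec"
  shows "x \<in> carrier_vec d \<Longrightarrow> x - 0\<^sub>v d = x"
  by (intro eq_vecI) auto

lemma vec_minus_right_commute:
  fixes x y z :: "real vec"
  shows "x \<in> carrier_vec d \<Longrightarrow> y \<in> carrier_vec d \<Longrightarrow> z \<in> carrier_vec d \<Longrightarrow> x - y - z = x - z - y"
  by (intro eq_vecI) auto

lemma vnorm_minus_le:
  assumes "x \<in> carrier_vec d" "y \<in> carrier_vec d"
  shows "vnorm (x - y) \<le> vnorm x + vnorm y"
proof -
  have "x - y = x + (-1) \<cdot>\<^sub>v y"
    using assms by (intro eq_vecI) auto
  then show ?thesis
    using assms vnorm_add[of x d "(-1) \<cdot>\<^sub>v y"] by simp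
qed

lemma vnorm_zero [simp]: "vnorm (0\<^sub>v d) = 0"
  by (simp add: vnorm_def L2_set_def)

lemma vnorm_eq_0: "x \<in> carrier_vec d \<Longrightarrow> vnorm x = 0 \<Longrightarrow> x = 0\<^sub>v d"
  by (intro eq_vecI) (auto simp: vnorm_def L2_set_eq_0_iff)

lemma abs_index_le_vnorm: "i < dim_vec x \<Longrightarrow> \<bar>x $ i\<bar> \<le> vnorm x"
  unfolding vnorm_def using member_le_L2_set[of "{..<dim_vec x}" i "\<lambda>i. \<bar>x $ i\<bar>"]
  by (simp add: L2_set_def)

section \<open>Operator and Frobenius bounds\<close>

text \<open>An upper bound of the operator norm, stated for vectors. It avoids suprema: \<open>opnorm\<close> enters only
  through the Lipschitz condition on the Hessians, by \<open>op_bounded_opnorm\<close> below.\<close>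

definition op_bounded :: "nat \<Rightarrow> real mat \<Rightarrow> real \<Rightarrow> bool" where
  "op_bounded d A c \<longleftrightarrow> (\<forall>v\<in>carrier_vec d. vnorm (A *\<^sub>v v) \<le> c * vnorm v)"

definition frobenius_sq :: "nat \<Rightarrow> real mat \<Rightarrow> real" where
  "frobenius_sq d A = (\<Sum>i<d. \<Sum>j<d. (A $$ (i, j))\<^sup>2)"

lemma index_mult_mat_vec_sum:
  "A \<in> carrier_mat d d \<Longrightarrow> v \<in> carrier_vec d \<Longrightarrow> i < d \<Longrightarrow>
    (A *\<^sub>v v) $ i = (\<Sum>j<d. A $$ (i, j) * v $ j)"
  by (auto simp: scalar_prod_def lessThan_atLeast0 intro!: sum.cong)

lemma vnorm_sq_sum: "x \<in> carrier_vec d \<Longrightarrow> (vnorm x)\<^sup>2 = (\<Sum>i<d. (x $ i)\<^sup>2)"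
  unfolding vnorm_sq scalar_prod_def by (auto simp: lessThan_atLeast0 power2_eq_square)

lemma op_bounded_frobenius:
  assumes A: "A \<in> carrier_mat d d"
  shows "op_bounded d A (sqrt (frobenius_sq d A))"
  unfolding op_bounded_def
proof
  fix v :: "real vec" assume v: "v \<in> carrier_vec d"
  have F: "0 \<le> frobenius_sq d A"
    by (simp add: frobenius_sq_def sum_nonneg)
  have "(vnorm (A *\<^sub>v v))\<^sup>2 = (\<Sum>i<d. (row A i \<bullet> v)\<^sup>2)"
    using A v by (subst vnorm_sq_sum[where d = d]) auto
  also have "\<dots> \<le> (\<Sum>i<d. (\<Sum>j<d. (A $$ (i, j))\<^sup>2) * (vnorm v)\<^sup>2)"
  proof (rule sum_mono)
    fix i assume i: "i \<in> {..<d}"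
    have row: "row A i \<in> carrier_vec d"
      using A by auto
    have "(row A i \<bullet> v)\<^sup>2 \<le> (vnorm (row A i) * vnorm v)\<^sup>2"
      using cauchy_schwarz[OF row v] by (rule power2_le_iff_abs_le[THEN iffD2, rotated]) simp
    also have "\<dots> = (\<Sum>j<d. (A $$ (i, j))\<^sup>2) * (vnorm v)\<^sup>2"
      using A i by (simp add: power_mult_distrib vnorm_sq_sum[OF row])
    finally show "(row A i \<bullet> v)\<^sup>2 \<le> (\<Sum>j<d. (A $$ (i, j))\<^sup>2) * (vnorm v)\<^sup>2" .
  qed
  also have "\<dots> = (sqrt (frobenius_sq d A) * vnorm v)\<^sup>2"
    using F by (simp add: frobenius_sq_def sum_distrib_right power_mult_distrib)
  finally show "vnorm (A *\<^sub>v v) \<le> sqrt (frobenius_sq d A) * vnorm v"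
    by (rule power2_le_imp_le) (use F in simp)
qed

text \<open>The squared Frobenius norm is the sum of the squared norms of the \<open>d\<close> columns, and each column is the
  image of a unit vector.\<close>

lemma frobenius_le_op:
  assumes A: "A \<in> carrier_mat d d" and c: "op_bounded d A c"
  shows "frobenius_sq d A \<le> real d * c\<^sup>2"
proof -
  have "frobenius_sq d A = (\<Sum>j<d. \<Sum>i<d. (A $$ (i, j))\<^sup>2)"
    unfolding frobenius_sq_def by (rule sum.swap)
  also have "\<dots> = (\<Sum>j<d. (vnorm (A *\<^sub>v unit_vec d j))\<^sup>2)"
  proof (rule sum.cong[OF refl])
    fix j assume "j \<in> {..<d}"
    then show "(\<Sum>i<d. (A $$ (i, j))\<^sup>2) = (vnorm (A *\<^sub>v unit_vec d j))\<^sup>2"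
      using A by (subst vnorm_sq_sum[where d = d]) auto
  qed
  also have "\<dots> \<le> (\<Sum>j<d. c\<^sup>2)"
  proof (rule sum_mono)
    fix j assume j: "j \<in> {..<d}"
    have "(vnorm (unit_vec d j))\<^sup>2 = 1"
      using j by (auto simp: vnorm_sq)
    then have "vnorm (unit_vec d j) = 1"
      by (metis abs_of_nonneg power2_eq_iff_nonneg power_one vnorm_nonneg zero_le_one)
    then have "vnorm (A *\<^sub>v unit_vec d j) \<le> c"
      using c unfolding op_bounded_def by (metis mult.right_neutral unit_vec_carrier)
    then show "(vnorm (A *\<^sub>v unit_vec d j))\<^sup>2 \<le> c\<^sup>2"
      by (simp add: power_mono)
  qed
  finally show ?thesis by simp
qed

text \<open>The supremum in \<open>opnorm\<close> ranges over a bounded set because the Frobenius norm bounds the matrix;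
  then homogeneity extends the bound from the unit ball to all vectors.\<close>

lemma op_bounded_opnorm:
  assumes A: "A \<in> carrier_mat d d"
  shows "op_bounded d A (opnorm A)"
  unfolding op_bounded_def
proof
  fix v :: "real vec" assume v: "v \<in> carrier_vec d"
  let ?F = "sqrt (frobenius_sq d A)"
  let ?B = "{v \<in> carrier_vec (dim_col A). vnorm v \<le> 1}"
  have F: "0 \<le> ?F" by (simp add: frobenius_sq_def sum_nonneg)
  have bdd: "bdd_above ((\<lambda>v. vnorm (A *\<^sub>v v)) ` ?B)"
  proof (rule bdd_aboveI2)
    fix u :: "real vec" assume u: "u \<in> ?B"
    then have "vnorm (A *\<^sub>v u) \<le> ?F * vnorm u"
      using op_bounded_frobenius[OF A] A by (auto simp: op_bounded_def)
    also have "\<dots> \<le> ?F * 1"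
      using u F by (intro mult_left_mono) auto
    finally show "vnorm (A *\<^sub>v u) \<le> ?F" by simp
  qed
  show "vnorm (A *\<^sub>v v) \<le> opnorm A * vnorm v"
  proof (cases "vnorm v = 0")
    case True
    then have "v = 0\<^sub>v d" using vnorm_eq_0 v by blast
    then show ?thesis
      using op_bounded_frobenius[OF A] v True
      by (metis mult_zero_right op_bounded_def)
  next
    case False
    let ?u = "(1 / vnorm v) \<cdot>\<^sub>v v"
    have "?u \<in> ?B" using False v A by auto
    then have "vnorm (A *\<^sub>v ?u) \<le> opnorm A"
      unfolding opnorm_def using bdd by (rule cSUP_upper)
    moreover have "A *\<^sub>v ?u = (1 / vnorm v) \<cdot>\<^sub>v (A *\<^sub>v v)"
      using A v by (rule mult_mat_vec)
    ultimately show ?thesis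
      using False vnorm_nonneg[of v] by (simp add: field_simps)
  qed
qed

lemma op_bounded_mono: "op_bounded d A c \<Longrightarrow> c \<le> c' \<Longrightarrow> op_bounded d A c'"
  unfolding op_bounded_def by (meson mult_right_mono order_trans vnorm_nonneg)

lemma op_bounded_triangle:
  assumes "A \<in> carrier_mat d d" "B \<in> carrier_mat d d" "C \<in> carrier_mat d d"
    and "op_bounded d (A - B) a" "op_bounded d (B - C) b"
  shows "op_bounded d (A - C) (a + b)"
  unfolding op_bounded_def
proof
  fix v :: "real vec" assume v: "v \<in> carrier_vec d"
  have "vnorm ((A - C) *\<^sub>v v) = vnorm (A *\<^sub>v v - C *\<^sub>v v)"
    using assms v by (simp add: minus_mult_distrib_mat_vec)
  also have "\<dots> \<le> vnorm (A *\<^sub>v v - B *\<^sub>v v) + vnorm (B *\<^sub>v v - C *\<^sub>v v)"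
    using assms v by (intro vnorm_triangle[where d = d]) auto
  also have "\<dots> = vnorm ((A - B) *\<^sub>v v) + vnorm ((B - C) *\<^sub>v v)"
    using assms v by (simp add: minus_mult_distrib_mat_vec)
  also have "\<dots> \<le> a * vnorm v + b * vnorm v"
    using assms(4,5) v by (auto simp: op_bounded_def intro: add_mono)
  finally show "vnorm ((A - C) *\<^sub>v v) \<le> (a + b) * vnorm v"
    by (simp add: algebra_simps)
qed

lemma op_bounded_commute:
  assumes "A \<in> carrier_mat d d" "B \<in> carrier_mat d d" "op_bounded d (A - B) a"
  shows "op_bounded d (B - A) a"
  unfolding op_bounded_def
proof
  fix v :: "real vec" assume v: "v \<in> carrier_vec d"
  have "vnorm ((B - A) *\<^sub>v v) = vnorm ((A - B) *\<^sub>v v)"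
    using assms v vnorm_minus_commute[of "B *\<^sub>v v" d "A *\<^sub>v v"]
    by (simp add: minus_mult_distrib_mat_vec)
  then show "vnorm ((B - A) *\<^sub>v v) \<le> a * vnorm v"
    using assms(3) v by (simp add: op_bounded_def)
qed

section \<open>Symmetric matrices as vectors\<close>

text \<open>The index pairs in the order in which \<open>vectorize\<close> lists the entries. With the list explicit,
  \<open>vectorize\<close> is a \<open>map\<close>, and its norm and its inverse reduce to facts about a distinct list.\<close>

definition upper_pairs :: "nat \<Rightarrow> (nat \<times> nat) list" where
  "upper_pairs d = concat (map (\<lambda>i. map (Pair i) [i..<d]) [0..<d])"

lemma vectorize_eq: "vectorize d P = vec_of_list (map (\<lambda>p. P $$ p) (upper_pairs d))"
proof -
  have "concat (map (\<lambda>i. map (\<lambda>j. P $$ (i, j)) [i..<d]) [0..<d]) = map (\<lambda>p. P $$ p) (upper_pairs d)"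
    by (simp add: upper_pairs_def map_concat comp_def)
  then show ?thesis unfolding vectorize_def by metis
qed

lemma set_upper_pairs: "set (upper_pairs d) = {(i, j). i \<le> j \<and> j < d}"
  by (force simp: upper_pairs_def)

lemma distinct_upper_pairs: "distinct (upper_pairs d)"
  unfolding upper_pairs_def
proof (rule distinct_concat)
  have "inj_on (\<lambda>i. map (Pair i) [i..<d]) (set [0..<d])"
  proof (rule inj_onI)
    fix i j assume *: "i \<in> set [0..<d]" "map (Pair i) [i..<d] = map (Pair j) [j..<d]"
    from *(1) have "(i, i) \<in> set (map (Pair i) [i..<d])"
      by auto
    then show "i = j" unfolding *(2) by auto
  qed
  then show "distinct (map (\<lambda>i. map (Pair i) [i..<d]) [0..<d])"
    by (simp add: distinct_map)
qed (auto simp: distinct_map inj_on_def)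

lemma length_upper_pairs: "length (upper_pairs d) = sym_dim d"
proof -
  have "length (upper_pairs d) = (\<Sum>i<d. d - i)"
    by (simp only: upper_pairs_def length_concat map_map comp_def length_map length_upt
      interv_sum_list_conv_sum_set_nat lessThan_atLeast0 set_upt)
  also have "\<dots> = (\<Sum>i<d. Suc (d - Suc i))"
    by (rule sum.cong) auto
  also have "\<dots> = (\<Sum>i<d. Suc i)"
    by (rule sum.nat_diff_reindex)
  also have "\<dots> = sym_dim d"
  proof -
    have "2 * (\<Sum>i<d. Suc i) = d * (d + 1)" by (induction d) auto
    then show ?thesis unfolding sym_dim_def by linarith
  qed
  finally show ?thesis .
qed

lemma vectorize_carrier [simp]: "vectorize d P \<in> carrier_vec (sym_dim d)"
  by (rule carrier_vecI) (simp only: vectorize_eq dim_vec_of_list length_map length_upper_pairs)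

lemma index_vectorize: "k < sym_dim d \<Longrightarrow> vectorize d P $ k = P $$ (upper_pairs d ! k)"
  unfolding vectorize_eq by (subst index_vec_of_list) (simp_all only: length_map length_upper_pairs nth_map)

lemma vectorize_minus:
  assumes "A \<in> carrier_mat d d" "B \<in> carrier_mat d d"
  shows "vectorize d (A - B) = vectorize d A - vectorize d B"
proof (rule eq_vecI)
  fix k assume "k < dim_vec (vectorize d A - vectorize d B)"
  then have k: "k < sym_dim d"
    using vectorize_carrier[of d B] by (auto simp del: vectorize_carrier)
  then have "upper_pairs d ! k \<in> set (upper_pairs d)"
    by (simp add: length_upper_pairs)
  then show "vectorize d (A - B) $ k = (vectorize d A - vectorize d B) $ k"
    using k assms vectorize_carrier[of d B]
    by (auto simp: index_vectorize set_upper_pairs simp del: vectorize_carrier)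
qed (simp add: carrier_vecD[OF vectorize_carrier])

lemma vnorm_vectorize_sq:
  "(vnorm (vectorize d P))\<^sup>2 = (\<Sum>p\<in>{(i, j). i \<le> j \<and> j < d}. (P $$ p)\<^sup>2)"
proof -
  have "(vnorm (vectorize d P))\<^sup>2 = (\<Sum>k<sym_dim d. (P $$ (upper_pairs d ! k))\<^sup>2)"
    by (simp add: vnorm_sq_sum[OF vectorize_carrier] index_vectorize)
  also have "\<dots> = (\<Sum>p\<in>set (upper_pairs d). (P $$ p)\<^sup>2)"
    by (rule sum.reindex_bij_betw, rule bij_betw_nth)
      (simp_all add: distinct_upper_pairs length_upper_pairs)
  finally show ?thesis by (simp add: set_upper_pairs)
qed

lemma frobenius_sq_pairs: "frobenius_sq d A = (\<Sum>p\<in>{..<d} \<times> {..<d}. (A $$ p)\<^sup>2)"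
  unfolding frobenius_sq_def by (simp add: sum.cartesian_product)

lemma sym_mats_carrier: "A \<in> sym_mats d \<Longrightarrow> A \<in> carrier_mat d d"
  by (simp add: sym_mats_def)

lemma sym_mats_iff:
  "A \<in> sym_mats d \<longleftrightarrow> A \<in> carrier_mat d d \<and> (\<forall>i<d. \<forall>j<d. A $$ (i, j) = A $$ (j, i))"
proof
  assume A: "A \<in> sym_mats d"
  then have "A $$ (i, j) = A $$ (j, i)" if "i < d" "j < d" for i j
    using that index_transpose_mat(1)[of i A j] by (auto simp: sym_mats_def)
  then show "A \<in> carrier_mat d d \<and> (\<forall>i<d. \<forall>j<d. A $$ (i, j) = A $$ (j, i))"
    using A by (simp add: sym_mats_def)
next
  assume "A \<in> carrier_mat d d \<and> (\<forall>i<d. \<forall>j<d. A $$ (i, j) = A $$ (j, i))"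
  then show "A \<in> sym_mats d"
    unfolding sym_mats_def by (auto intro!: eq_matI)
qed

lemma sym_mats_minus: "A \<in> sym_mats d \<Longrightarrow> B \<in> sym_mats d \<Longrightarrow> A - B \<in> sym_mats d"
  by (auto simp: sym_mats_iff)

text \<open>The upper triangle is a part of the Frobenius norm, which is at most \<open>\<surd>d\<close> times the operator
  norm. This is the origin of the \<open>\<surd>d\<close> in the radii of the algorithm.\<close>

lemma vnorm_vectorize_le:
  assumes A: "A \<in> carrier_mat d d" and c: "0 \<le> c" "op_bounded d A c"
  shows "vnorm (vectorize d A) \<le> sqrt (real d) * c"
proof -
  have "(vnorm (vectorize d A))\<^sup>2 \<le> frobenius_sq d A"
    unfolding vnorm_vectorize_sq frobenius_sq_pairs by (rule sum_mono2) auto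
  also have "\<dots> \<le> (sqrt (real d) * c)\<^sup>2"
    using frobenius_le_op[OF A c(2)] by (simp add: power_mult_distrib)
  finally show ?thesis
    by (rule power2_le_imp_le) (use c(1) in simp)
qed

text \<open>The index square is the union of the upper triangle and its mirror image, on which a symmetric
  matrix has the same entries.\<close>

lemma frobenius_le_vectorize:
  assumes A: "A \<in> sym_mats d"
  shows "frobenius_sq d A \<le> 2 * (vnorm (vectorize d A))\<^sup>2"
proof -
  let ?U = "{(i, j). i \<le> j \<and> j < d}"
  let ?g = "\<lambda>p. (A $$ p)\<^sup>2"
  have fin: "finite ?U"
    by (rule finite_subset[of _ "{..<d} \<times> {..<d}"]) auto
  have "(\<Sum>p\<in>{..<d} \<times> {..<d}. ?g p) \<le> sum ?g (?U \<union> prod.swap ` ?U)"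
    using fin by (intro sum_mono2) (auto simp: image_iff)
  \<comment> \<open>the overlap of the two triangles, the diagonal, is counted twice on the right\<close>
  also have "\<dots> \<le> sum ?g (?U \<union> prod.swap ` ?U) + sum ?g (?U \<inter> prod.swap ` ?U)"
    by (simp add: sum_nonneg)
  also have "\<dots> = sum ?g ?U + sum ?g (prod.swap ` ?U)"
    by (rule sum.union_inter) (use fin in blast)+
  also have "sum ?g (prod.swap ` ?U) = sum ?g ?U"
  proof -
    have "sum ?g (prod.swap ` ?U) = sum (?g \<circ> prod.swap) ?U"
      by (rule sum.reindex) (auto simp: inj_on_def)
    also have "\<dots> = sum ?g ?U"
    proof (rule sum.cong[OF refl])
      fix p assume "p \<in> ?U"
      then obtain i j where "p = (i, j)" "i < d" "j < d" by auto
      then show "(?g \<circ> prod.swap) p = ?g p"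
        using A unfolding sym_mats_iff by (metis comp_apply swap_simp)
    qed
    finally show ?thesis .
  qed
  finally show ?thesis
    by (simp add: frobenius_sq_pairs vnorm_vectorize_sq)
qed

text \<open>This is the origin of the \<open>\<surd>2\<close> in the resolutions of the algorithm.\<close>

lemma op_bounded_vectorize:
  assumes A: "A \<in> sym_mats d" and c: "vnorm (vectorize d A) \<le> c"
  shows "op_bounded d A (sqrt 2 * c)"
proof (rule op_bounded_mono[OF op_bounded_frobenius])
  have "frobenius_sq d A \<le> 2 * (vnorm (vectorize d A))\<^sup>2"
    using A by (rule frobenius_le_vectorize)
  also have "\<dots> \<le> 2 * c\<^sup>2"
    using c by (simp add: power_mono)
  finally have "sqrt (frobenius_sq d A) \<le> sqrt (2 * c\<^sup>2)" by simp
  also have "\<dots> = sqrt 2 * c"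
    using order_trans[OF vnorm_nonneg c] by (simp add: real_sqrt_mult)
  finally show "sqrt (frobenius_sq d A) \<le> sqrt 2 * c" .
qed (use A in \<open>simp add: sym_mats_carrier\<close>)

text \<open>Surjectivity is by an explicit preimage: entry \<open>(i, j)\<close> is looked up at the sorted pair
  \<open>(min i j, max i j)\<close>, which makes the matrix symmetric.\<close>

lemma bij_betw_vectorize: "bij_betw (vectorize d) (sym_mats d) (carrier_vec (sym_dim d))"
proof (rule bij_betw_imageI)
  show "inj_on (vectorize d) (sym_mats d)"
  proof (rule inj_onI)
    fix A B assume A: "A \<in> sym_mats d" and B: "B \<in> sym_mats d"
      and eq: "vectorize d A = vectorize d B"
    have "A $$ p = B $$ p" if p: "p \<in> set (upper_pairs d)" for p
    proof -
      obtain k where "k < sym_dim d" "p = upper_pairs d ! k"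
        using p unfolding in_set_conv_nth length_upper_pairs by blast
      then show ?thesis using index_vectorize[of k d A] index_vectorize[of k d B] eq by simp
    qed
    then have le: "A $$ (i, j) = B $$ (i, j)" if "i \<le> j" "j < d" for i j
      using that by (simp add: set_upper_pairs)
    have "A $$ (i, j) = B $$ (i, j)" if "i < d" "j < d" for i j
      using le[of i j] le[of j i] that A B by (cases "i \<le> j") (auto simp: sym_mats_iff)
    then show "A = B"
      using A B by (intro eq_matI) (auto simp: sym_mats_def)
  qed
  show "vectorize d ` sym_mats d = carrier_vec (sym_dim d)"
  proof
    show "carrier_vec (sym_dim d) \<subseteq> vectorize d ` sym_mats d"
    proof
      fix u :: "real vec" assume u: "u \<in> carrier_vec (sym_dim d)"
      define m where "m = map_of (zip (upper_pairs d) (list_of_vec u))"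
      define A where "A = mat d d (\<lambda>(i, j). the (m (min i j, max i j)))"
      have "A \<in> sym_mats d"
        by (simp add: sym_mats_iff A_def min.commute max.commute)
      moreover have "vectorize d A = u"
      proof (rule eq_vecI)
        fix k assume "k < dim_vec u"
        then have k: "k < sym_dim d" using u by simp
        obtain i j where ij: "upper_pairs d ! k = (i, j)" by fastforce
        have "(i, j) \<in> set (upper_pairs d)"
          using nth_mem[of k "upper_pairs d"] k by (simp add: ij length_upper_pairs)
        then have "i \<le> j" "j < d" by (auto simp: set_upper_pairs)
        moreover have "m (i, j) = Some (list_of_vec u ! k)"
          unfolding m_def ij[symmetric] using k u
          by (intro map_of_zip_nth) (auto simp: length_upper_pairs distinct_upper_pairs)
        ultimately show "vectorize d A $ k = u $ k"
          using k u by (simp add: index_vectorize ij A_def min_def max_def list_of_vec_index)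
      qed (simp add: carrier_vecD[OF u] carrier_vecD[OF vectorize_carrier])
      ultimately show "u \<in> vectorize d ` sym_mats d" by blast
    qed
  qed (auto simp del: carrier_vec_dim_vec)
qed

lemma unvectorize:
  assumes "u \<in> carrier_vec (sym_dim d)"
  shows "unvectorize d u \<in> sym_mats d" "vectorize d (unvectorize d u) = u"
  unfolding unvectorize_def using bij_betw_vectorize[of d] assms
  by (auto simp: bij_betw_def the_inv_into_into f_the_inv_into_f)

section \<open>Coercive matrices and Newton directions\<close>

text \<open>The matrix inequality \<open>H \<ge> m\<close> for the symmetric part of \<open>H\<close>.\<close>

definition coercive :: "nat \<Rightarrow> real mat \<Rightarrow> real \<Rightarrow> bool" where
  "coercive d H m \<longleftrightarrow> (\<forall>v\<in>carrier_vec d. m * (vnorm v)\<^sup>2 \<le> v \<bullet> (H *\<^sub>v v))"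

lemma coercive_perturb:
  assumes "A \<in> carrier_mat d d" "B \<in> carrier_mat d d" "coercive d A m" "op_bounded d (B - A) \<delta>"
  shows "coercive d B (m - \<delta>)"
  unfolding coercive_def
proof
  fix v :: "real vec" assume v: "v \<in> carrier_vec d"
  have "v \<bullet> (B *\<^sub>v v) = v \<bullet> (A *\<^sub>v v) + v \<bullet> ((B - A) *\<^sub>v v)"
    using assms(1,2) v by (simp add: minus_mult_distrib_mat_vec scalar_prod_minus_distrib[where n = d])
  moreover have "\<bar>v \<bullet> ((B - A) *\<^sub>v v)\<bar> \<le> vnorm v * vnorm ((B - A) *\<^sub>v v)"
    using assms(1,2) v by (intro cauchy_schwarz[where d = d] mult_mat_vec_carrier[where n = d]) auto
  moreover have "vnorm v * vnorm ((B - A) *\<^sub>v v) \<le> vnorm v * (\<delta> * vnorm v)"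
    using assms(4) v by (intro mult_left_mono) (auto simp: op_bounded_def)
  moreover have "m * (vnorm v)\<^sup>2 \<le> v \<bullet> (A *\<^sub>v v)"
    using assms(3) v by (simp add: coercive_def)
  ultimately show "(m - \<delta>) * (vnorm v)\<^sup>2 \<le> v \<bullet> (B *\<^sub>v v)"
    by (simp add: power2_eq_square algebra_simps)
qed

text \<open>Cauchy-Schwarz turns the lower bound of the quadratic form into one of the norm. All estimates of
  Newton directions follow from it, without bounding an inverse matrix.\<close>

lemma coercive_lower_bound:
  assumes H: "H \<in> carrier_mat d d" and m: "coercive d H m" and v: "v \<in> carrier_vec d"
  shows "m * vnorm v \<le> vnorm (H *\<^sub>v v)"
proof (cases "vnorm v = 0")
  case False
  then have pos: "0 < vnorm v" using vnorm_nonneg[of v] by linarith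
  have "m * (vnorm v)\<^sup>2 \<le> v \<bullet> (H *\<^sub>v v)"
    using m v by (simp add: coercive_def)
  also have "\<dots> \<le> vnorm v * vnorm (H *\<^sub>v v)"
    using cauchy_schwarz[OF v mult_mat_vec_carrier[OF H v]] by linarith
  finally have "vnorm v * (m * vnorm v) \<le> vnorm v * vnorm (H *\<^sub>v v)"
    by (simp add: power2_eq_square algebra_simps)
  then show ?thesis using pos by (rule mult_left_le_imp_le)
qed simp

text \<open>A coercive matrix has trivial kernel, hence nonzero determinant, hence an inverse; so the default value of
  \<open>the (mat_inverse H)\<close> is never met.\<close>

lemma newton_dir_solves:
  assumes H: "H \<in> carrier_mat d d" and m: "coercive d H m" "0 < m" and g: "g \<in> carrier_vec d"
  shows "newton_dir H g \<in> carrier_vec d" "H *\<^sub>v newton_dir H g = g"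
proof -
  have "det H \<noteq> 0"
  proof
    assume "det H = 0"
    then obtain v where v: "v \<in> carrier_vec d" "v \<noteq> 0\<^sub>v d" "H *\<^sub>v v = 0\<^sub>v d"
      using det_0_iff_vec_prod_zero_field[OF H] by blast
    have "m * vnorm v \<le> 0"
      using coercive_lower_bound[OF H m(1) v(1)] v(3) by simp
    then have "vnorm v = 0"
      using m(2) vnorm_nonneg[of v] by (simp add: mult_le_0_iff)
    then show False using vnorm_eq_0 v by blast
  qed
  then have "H \<in> Units (ring_mat TYPE(real) d ())"
    by (rule det_non_zero_imp_unit[OF H])
  then obtain B where B: "mat_inverse H = Some B"
    using mat_inverse(1)[OF H, where b = "()"] by (cases "mat_inverse H") auto
  from mat_inverse(2)[OF H B] have "H * B = 1\<^sub>m d" "B \<in> carrier_mat d d" by auto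
  then show "newton_dir H g \<in> carrier_vec d" "H *\<^sub>v newton_dir H g = g"
    using H g by (auto simp: newton_dir_def B assoc_mult_mat_vec[symmetric])
qed

lemma newton_dir_norm:
  assumes H: "H \<in> carrier_mat d d" and m: "coercive d H m" "0 < m" and g: "g \<in> carrier_vec d"
  shows "m * vnorm (newton_dir H g) \<le> vnorm g"
  using coercive_lower_bound[OF H m(1) newton_dir_solves(1)[OF H m g]] newton_dir_solves(2)[OF H m g]
  by simp

text \<open>The distance to the solution is controlled by the residual. Contraction and stability of the Newton
  directions are both instances.\<close>

lemma newton_dir_approx:
  assumes H: "H \<in> carrier_mat d d" and m: "coercive d H m" "0 < m"
    and g: "g \<in> carrier_vec d" and u: "u \<in> carrier_vec d"
  shows "m * vnorm (newton_dir H g - u) \<le> vnorm (g - H *\<^sub>v u)"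
proof -
  note s = newton_dir_solves[OF H m g]
  have "H *\<^sub>v (newton_dir H g - u) = g - H *\<^sub>v u"
    using H u s by (simp add: mult_minus_distrib_mat_vec)
  then show ?thesis
    using coercive_lower_bound[OF H m(1), of "newton_dir H g - u"] s(1) u by simp
qed

lemma newton_dir_unique:
  assumes H: "H \<in> carrier_mat d d" and m: "coercive d H m" "0 < m"
    and u: "u \<in> carrier_vec d"
  shows "newton_dir H (H *\<^sub>v u) = u"
proof -
  have g: "H *\<^sub>v u \<in> carrier_vec d" using H u by simp
  note s = newton_dir_solves(1)[OF H m g]
  have "m * vnorm (newton_dir H (H *\<^sub>v u) - u) \<le> vnorm (H *\<^sub>v u - H *\<^sub>v u)"
    by (rule newton_dir_approx[OF H m g u])
  also have "H *\<^sub>v u - H *\<^sub>v u = 0\<^sub>v d" using g by auto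
  finally have "vnorm (newton_dir H (H *\<^sub>v u) - u) = 0"
    using m(2) vnorm_nonneg[of "newton_dir H (H *\<^sub>v u) - u"] by (simp add: mult_le_0_iff)
  then have z: "newton_dir H (H *\<^sub>v u) - u = 0\<^sub>v d"
    using s u by (intro vnorm_eq_0) auto
  show ?thesis
  proof (rule eq_vecI)
    fix i assume i: "i < dim_vec u"
    have "(newton_dir H (H *\<^sub>v u) - u) $ i = 0" using z i u by simp
    then show "newton_dir H (H *\<^sub>v u) $ i = u $ i" using i by simp
  qed (use s u in simp)
qed

text \<open>The residual of the old direction in the new system is
  \<open>(g' - g) + (H - H') (newton_dir H g)\<close>. Hence directions stay close when matrix and gradient
  do, even if the gradient itself is not small.\<close>

lemma newton_dir_change:
  assumes H: "H \<in> carrier_mat d d" "coercive d H m" and H': "H' \<in> carrier_mat d d" "coercive d H' m"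
    and m: "0 < m" and g: "g \<in> carrier_vec d" and g': "g' \<in> carrier_vec d"
    and \<delta>: "op_bounded d (H - H') \<delta>" "0 \<le> \<delta>"
  shows "m * vnorm (newton_dir H' g' - newton_dir H g) \<le> vnorm (g' - g) + \<delta> * (vnorm g / m)"
proof -
  let ?u = "newton_dir H g"
  note u = newton_dir_solves[OF H m g]
  have Hu: "H' *\<^sub>v ?u \<in> carrier_vec d" using H' u by simp
  have "m * vnorm (newton_dir H' g' - ?u) \<le> vnorm (g' - H' *\<^sub>v ?u)"
    by (rule newton_dir_approx[OF H' m g' u(1)])
  also have "\<dots> \<le> vnorm (g' - g) + vnorm (g - H' *\<^sub>v ?u)"
    by (rule vnorm_triangle[OF g' g Hu])
  also have "g - H' *\<^sub>v ?u = (H - H') *\<^sub>v ?u"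
    using u minus_mult_distrib_mat_vec[OF H(1) H'(1) u(1)] by simp
  also have "vnorm \<dots> \<le> \<delta> * vnorm ?u"
    using \<delta> u by (simp add: op_bounded_def)
  also have "\<dots> \<le> \<delta> * (vnorm g / m)"
    using newton_dir_norm[OF H m g] m \<delta>(2) by (intro mult_left_mono) (auto simp: field_simps)
  finally show ?thesis by simp
qed

section \<open>Averages over the nodes\<close>

lemma mean_vec_carrier [simp]: "mean_vec d n w \<in> carrier_vec d"
  by (simp add: mean_vec_def)

lemma mean_mat_carrier [simp]: "mean_mat d n A \<in> carrier_mat d d"
  by (simp add: mean_mat_def)

lemma mean_vec_cong: "(\<And>i. i < n \<Longrightarrow> w i = w' i) \<Longrightarrow> mean_vec d n w = mean_vec d n w'"
  unfolding mean_vec_def by (intro arg_cong[where f = "vec d"] ext arg_cong2[where f = "(/)"] sum.cong) auto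

lemma mean_vec_minus:
  assumes "\<And>i. i < n \<Longrightarrow> w' i \<in> carrier_vec d"
  shows "mean_vec d n (\<lambda>i. w i - w' i) = mean_vec d n w - mean_vec d n w'"
proof (rule eq_vecI)
  fix k assume "k < dim_vec (mean_vec d n w - mean_vec d n w')"
  then have k: "k < d" by (simp add: mean_vec_def)
  have "(\<Sum>i<n. (w i - w' i) $ k) = (\<Sum>i<n. w i $ k - w' i $ k)"
  proof (rule sum.cong[OF refl])
    fix i assume "i \<in> {..<n}"
    then show "(w i - w' i) $ k = w i $ k - w' i $ k"
      using assms[of i] k by simp
  qed
  then show "mean_vec d n (\<lambda>i. w i - w' i) $ k = (mean_vec d n w - mean_vec d n w') $ k"
    using k by (simp add: mean_vec_def sum_subtractf diff_divide_distrib)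
qed (simp add: mean_vec_def)

text \<open>Averages commute with inner products; with \<open>u\<close> the average itself this also yields convexity of the
  norm, \<open>vnorm_mean_vec\<close>.\<close>

lemma mean_vec_scalar_prod:
  assumes "u \<in> carrier_vec d"
  shows "mean_vec d n w \<bullet> u = (\<Sum>i<n. w i \<bullet> u) / real n"
proof -
  have "mean_vec d n w \<bullet> u = (\<Sum>k<d. (\<Sum>i<n. w i $ k * u $ k) / real n)"
    using assms by (simp add: scalar_prod_def mean_vec_def lessThan_atLeast0 sum_distrib_right)
  also have "\<dots> = (\<Sum>i<n. \<Sum>k<d. w i $ k * u $ k) / real n"
    by (subst sum.swap) (simp add: sum_divide_distrib)
  also have "\<dots> = (\<Sum>i<n. w i \<bullet> u) / real n"
    using assms by (simp add: scalar_prod_def lessThan_atLeast0)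
  finally show ?thesis .
qed

lemma vnorm_mean_vec:
  assumes n: "0 < n" and w: "\<And>i. i < n \<Longrightarrow> w i \<in> carrier_vec d" "\<And>i. i < n \<Longrightarrow> vnorm (w i) \<le> c"
  shows "vnorm (mean_vec d n w) \<le> c"
proof -
  let ?m = "mean_vec d n w"
  have "(vnorm ?m)\<^sup>2 = (\<Sum>i<n. w i \<bullet> ?m) / real n"
    by (simp add: vnorm_sq mean_vec_scalar_prod)
  also have "\<dots> \<le> (\<Sum>i<n. c * vnorm ?m) / real n"
  proof (intro divide_right_mono sum_mono)
    fix i assume i: "i \<in> {..<n}"
    have "w i \<bullet> ?m \<le> vnorm (w i) * vnorm ?m"
      using cauchy_schwarz[OF w(1) mean_vec_carrier, of i n w] i by auto
    also have "\<dots> \<le> c * vnorm ?m"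
      using w(2) i by (intro mult_right_mono) auto
    finally show "w i \<bullet> ?m \<le> c * vnorm ?m" .
  qed simp
  also have "\<dots> = c * vnorm ?m" using n by simp
  finally have *: "vnorm ?m * vnorm ?m \<le> c * vnorm ?m"
    by (simp add: power2_eq_square)
  show ?thesis
  proof (cases "vnorm ?m = 0")
    case True
    then show ?thesis using order_trans[OF vnorm_nonneg w(2)[OF n]] by simp
  next
    case False
    then show ?thesis using * vnorm_nonneg[of ?m] mult_right_le_imp_le[OF *] by linarith
  qed
qed

lemma mult_mean_vec:
  assumes A: "A \<in> carrier_mat d d" and w: "\<And>i. i < n \<Longrightarrow> w i \<in> carrier_vec d"
  shows "A *\<^sub>v mean_vec d n w = mean_vec d n (\<lambda>i. A *\<^sub>v w i)"
proof (rule eq_vecI)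
  fix k assume "k < dim_vec (mean_vec d n (\<lambda>i. A *\<^sub>v w i))"
  then have k: "k < d" by (simp add: mean_vec_def)
  have r: "row A k \<in> carrier_vec d" using A by auto
  have "(A *\<^sub>v mean_vec d n w) $ k = mean_vec d n w \<bullet> row A k"
    using A k r comm_scalar_prod[OF r mean_vec_carrier] by simp
  also have "\<dots> = (\<Sum>i<n. w i \<bullet> row A k) / real n"
    using r by (rule mean_vec_scalar_prod)
  also have "(\<Sum>i<n. w i \<bullet> row A k) = (\<Sum>i<n. (A *\<^sub>v w i) $ k)"
    using A k r w by (intro sum.cong refl) (auto intro: comm_scalar_prod[where n = d])
  finally show "(A *\<^sub>v mean_vec d n w) $ k = mean_vec d n (\<lambda>i. A *\<^sub>v w i) $ k"
    using k by (simp add: mean_vec_def)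
qed (use A in \<open>simp add: mean_vec_def\<close>)

lemma mean_mat_mult_vec:
  assumes A: "\<And>i. i < n \<Longrightarrow> A i \<in> carrier_mat d d" and v: "v \<in> carrier_vec d"
  shows "mean_mat d n A *\<^sub>v v = mean_vec d n (\<lambda>i. A i *\<^sub>v v)"
proof (rule eq_vecI)
  fix k assume "k < dim_vec (mean_vec d n (\<lambda>i. A i *\<^sub>v v))"
  then have k: "k < d" by (simp add: mean_vec_def)
  have "(mean_mat d n A *\<^sub>v v) $ k = (\<Sum>j<d. (\<Sum>i<n. A i $$ (k, j) * v $ j) / real n)"
    by (subst index_mult_mat_vec_sum[OF mean_mat_carrier v k])
      (use k in \<open>simp add: mean_mat_def sum_distrib_right\<close>)
  also have "\<dots> = (\<Sum>i<n. \<Sum>j<d. A i $$ (k, j) * v $ j) / real n"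
    by (subst sum.swap) (simp add: sum_divide_distrib)
  also have "(\<Sum>i<n. \<Sum>j<d. A i $$ (k, j) * v $ j) = (\<Sum>i<n. (A i *\<^sub>v v) $ k)"
    using A k v by (intro sum.cong refl index_mult_mat_vec_sum[symmetric]) auto
  finally show "(mean_mat d n A *\<^sub>v v) $ k = mean_vec d n (\<lambda>i. A i *\<^sub>v v) $ k"
    using k by (simp add: mean_vec_def)
qed (simp add: mean_vec_def mean_mat_def)

lemma op_bounded_mean_mat:
  assumes n: "0 < n" and A: "\<And>i. i < n \<Longrightarrow> A i \<in> carrier_mat d d"
    and B: "\<And>i. i < n \<Longrightarrow> B i \<in> carrier_mat d d"
    and c: "\<And>i. i < n \<Longrightarrow> op_bounded d (A i - B i) c"
  shows "op_bounded d (mean_mat d n A - mean_mat d n B) c"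
  unfolding op_bounded_def
proof
  fix v :: "real vec" assume v: "v \<in> carrier_vec d"
  have "(mean_mat d n A - mean_mat d n B) *\<^sub>v v = mean_mat d n A *\<^sub>v v - mean_mat d n B *\<^sub>v v"
    using v by (simp add: minus_mult_distrib_mat_vec[where nr = d and nc = d])
  also have "\<dots> = mean_vec d n (\<lambda>i. A i *\<^sub>v v - B i *\<^sub>v v)"
    using mean_mat_mult_vec[OF A v] mean_mat_mult_vec[OF B v] mult_mat_vec_carrier[OF B v]
    by (simp add: mean_vec_minus)
  also have "vnorm \<dots> \<le> c * vnorm v"
  proof (rule vnorm_mean_vec[OF n])
    fix i assume i: "i < n"
    show "A i *\<^sub>v v - B i *\<^sub>v v \<in> carrier_vec d" using A[OF i] B[OF i] v by simp
    have "A i *\<^sub>v v - B i *\<^sub>v v = (A i - B i) *\<^sub>v v"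
      using A[OF i] B[OF i] v by (simp add: minus_mult_distrib_mat_vec)
    then show "vnorm (A i *\<^sub>v v - B i *\<^sub>v v) \<le> c * vnorm v"
      using c[OF i] v by (simp add: op_bounded_def)
  qed
  finally show "vnorm ((mean_mat d n A - mean_mat d n B) *\<^sub>v v) \<le> c * vnorm v" .
qed

lemma mean_mat_sym:
  assumes "\<And>i. i < n \<Longrightarrow> A i \<in> sym_mats d"
  shows "mean_mat d n A \<in> sym_mats d"
proof -
  have "(\<Sum>k<n. A k $$ (i, j)) = (\<Sum>k<n. A k $$ (j, i))" if "i < d" "j < d" for i j
    using assms that by (intro sum.cong) (simp_all add: sym_mats_iff)
  then show ?thesis by (simp add: sym_mats_iff mean_mat_def)
qed

lemma mean_mat_const:
  assumes "0 < n" "A \<in> carrier_mat d d"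
  shows "mean_mat d n (\<lambda>i. A) = A"
  using assms by (intro eq_matI) (auto simp: mean_mat_def)

section \<open>Quantization errors of vectors and matrices\<close>

lemma quantization_error:
  assumes "quantization Q enc dec b" "0 < N" "0 < y" "0 < \<epsilon>"
    and "x \<in> carrier_vec N" "x' \<in> carrier_vec N" "vnorm (x - x') \<le> y"
  shows "Q N x x' y \<epsilon> \<in> carrier_vec N" "vnorm (Q N x x' y \<epsilon> - x) \<le> \<epsilon>"
proof -
  note q = assms(1)[unfolded quantization_def, THEN conjunct1, rule_format, OF assms(2-4)]
  show "Q N x x' y \<epsilon> \<in> carrier_vec N" "vnorm (Q N x x' y \<epsilon> - x) \<le> \<epsilon>"
    using q[THEN conjunct2, THEN conjunct1, THEN bspec, OF assms(5), THEN bspec, OF assms(6)]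
      q[THEN conjunct2, THEN conjunct2, THEN conjunct1, THEN bspec, OF assms(5), THEN bspec,
        OF assms(6), THEN mp, OF assms(7)]
    by blast+
qed

text \<open>Nodes with different references decode the same value. Only the initialization uses this, where the
  references are local Hessians and gradients.\<close>

lemma quantization_reference_irrelevant:
  assumes "quantization Q enc dec b" "0 < N" "0 < y" "0 < \<epsilon>"
    and "x \<in> carrier_vec N" "x' \<in> carrier_vec N" "vnorm (x - x') \<le> y"
    and "x'' \<in> carrier_vec N" "vnorm (x - x'') \<le> y"
  shows "Q N x x' y \<epsilon> = Q N x x'' y \<epsilon>"
proof -
  note q = assms(1)[unfolded quantization_def, THEN conjunct1, rule_format, OF assms(2-4)]
  show ?thesis
    by (rule q[THEN conjunct2, THEN conjunct2, THEN conjunct2, THEN bspec, OF assms(5),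
          THEN bspec, OF assms(6), THEN bspec, OF assms(8), THEN mp, OF assms(7), THEN mp, OF assms(9)])
qed

lemma sym_dim_pos: "0 < d \<Longrightarrow> 0 < sym_dim d"
  by (cases d) (auto simp: sym_dim_def div_greater_zero_iff)

lemma vectorize_diff_le:
  assumes "A \<in> carrier_mat d d" "R \<in> carrier_mat d d" "0 \<le> r" "op_bounded d (A - R) r"
    "sqrt (real d) * r \<le> y"
  shows "vnorm (vectorize d A - vectorize d R) \<le> y"
  using vnorm_vectorize_le[OF minus_carrier_mat[OF assms(2)] assms(3,4)] assms
  by (simp add: vectorize_minus)

lemma quantize_mat_error:
  assumes Q: "quantization Q enc dec b" and d: "0 < d" and pos: "0 < y" "0 < \<epsilon>" "0 \<le> r"
    and A: "A \<in> sym_mats d" and R: "R \<in> sym_mats d"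
    and r: "op_bounded d (A - R) r" "sqrt (real d) * r \<le> y"
  shows "quantize_mat Q d A R y \<epsilon> \<in> sym_mats d"
    and "op_bounded d (quantize_mat Q d A R y \<epsilon> - A) (sqrt 2 * \<epsilon>)"
proof -
  let ?u = "Q (sym_dim d) (vectorize d A) (vectorize d R) y \<epsilon>"
  have le: "vnorm (vectorize d A - vectorize d R) \<le> y"
    using A R pos r by (intro vectorize_diff_le) (auto dest: sym_mats_carrier)
  note u = quantization_error[OF Q sym_dim_pos[OF d] pos(1,2) vectorize_carrier vectorize_carrier le]
  note S = unvectorize[OF u(1)]
  show sym: "quantize_mat Q d A R y \<epsilon> \<in> sym_mats d"
    unfolding quantize_mat_def by (rule S(1))
  have "vectorize d (quantize_mat Q d A R y \<epsilon> - A) = ?u - vectorize d A"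
    using sym A by (simp add: vectorize_minus sym_mats_carrier) (simp add: quantize_mat_def S(2))
  then show "op_bounded d (quantize_mat Q d A R y \<epsilon> - A) (sqrt 2 * \<epsilon>)"
    using u(2) sym A by (intro op_bounded_vectorize) (auto simp: sym_mats_minus)
qed

lemma quantize_mat_reference_irrelevant:
  assumes Q: "quantization Q enc dec b" and d: "0 < d" and pos: "0 < y" "0 < \<epsilon>" "0 \<le> r"
    and A: "A \<in> sym_mats d" and R: "R \<in> sym_mats d" and R': "R' \<in> sym_mats d"
    and r: "op_bounded d (A - R) r" "op_bounded d (A - R') r" "sqrt (real d) * r \<le> y"
  shows "quantize_mat Q d A R y \<epsilon> = quantize_mat Q d A R' y \<epsilon>"
  unfolding quantize_mat_def
proof (rule arg_cong[OF quantization_reference_irrelevant[OF Q sym_dim_pos[OF d] pos(1,2)]])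
  note c = A[THEN sym_mats_carrier] R[THEN sym_mats_carrier] R'[THEN sym_mats_carrier]
  show "vnorm (vectorize d A - vectorize d R) \<le> y" "vnorm (vectorize d A - vectorize d R') \<le> y"
    using c pos(3) r by (auto intro: vectorize_diff_le)
qed simp_all

section \<open>Mean value theorems on lines\<close>

text \<open>A fixed linear functional of a differentiable vector field is a differentiable function, with the
  transposed Jacobian giving its gradient. So one-dimensional calculus is needed for functions only.\<close>

lemma has_jacobian_component:
  assumes J: "has_jacobian d F J x" and F: "\<And>y. y \<in> carrier_vec d \<Longrightarrow> F y \<in> carrier_vec d"
    and x: "x \<in> carrier_vec d" and w: "w \<in> carrier_vec d"
  shows "has_gradient d (\<lambda>y. w \<bullet> F y) (transpose_mat J *\<^sub>v w) x"
  unfolding has_gradient_def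
proof (intro conjI allI impI)
  have Jc: "J \<in> carrier_mat d d" using J by (simp add: has_jacobian_def)
  then show "transpose_mat J *\<^sub>v w \<in> carrier_vec d" using w by simp
  fix e :: real assume e: "0 < e"
  let ?e = "e / (vnorm w + 1)"
  have pos: "0 < vnorm w + 1" using vnorm_nonneg[of w] by linarith
  then have "0 < ?e" using e by simp
  then obtain \<delta> where \<delta>: "\<delta> > 0" "\<And>y. y \<in> carrier_vec d \<Longrightarrow> vnorm (y - x) < \<delta> \<Longrightarrow>
      vnorm (F y - F x - J *\<^sub>v (y - x)) \<le> ?e * vnorm (y - x)"
    using J unfolding has_jacobian_def by meson
  \<comment> \<open>adding 1 to the norm of w keeps the tolerance positive for w = 0\<close>
  show "\<exists>\<delta>>0. \<forall>y\<in>carrier_vec d. vnorm (y - x) < \<delta> \<longrightarrow>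
      \<bar>w \<bullet> F y - w \<bullet> F x - (transpose_mat J *\<^sub>v w) \<bullet> (y - x)\<bar> \<le> e * vnorm (y - x)"
  proof (intro exI[of _ \<delta>] conjI ballI impI \<delta>(1))
    fix y assume y: "y \<in> carrier_vec d" "vnorm (y - x) < \<delta>"
    have yx: "y - x \<in> carrier_vec d" using x y by simp
    have "(transpose_mat J *\<^sub>v w) \<bullet> (y - x) = w \<bullet> (J *\<^sub>v (y - x))"
      using Jc w yx by (intro transpose_vec_mult_scalar) auto
    then have "w \<bullet> F y - w \<bullet> F x - (transpose_mat J *\<^sub>v w) \<bullet> (y - x) =
        w \<bullet> (F y - F x - J *\<^sub>v (y - x))"
      using w F x y yx Jc by (simp add: scalar_prod_minus_distrib[where n = d])
    then have "\<bar>w \<bullet> F y - w \<bullet> F x - (transpose_mat J *\<^sub>v w) \<bullet> (y - x)\<bar> \<le>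
        vnorm w * vnorm (F y - F x - J *\<^sub>v (y - x))"
      using w F x y yx Jc cauchy_schwarz[of w d "F y - F x - J *\<^sub>v (y - x)"] by simp
    also have "\<dots> \<le> (vnorm w + 1) * (?e * vnorm (y - x))"
      using \<delta>(2)[OF y] by (intro mult_mono) auto
    also have "\<dots> = e * vnorm (y - x)" using pos by simp
    finally show "\<bar>w \<bullet> F y - w \<bullet> F x - (transpose_mat J *\<^sub>v w) \<bullet> (y - x)\<bar> \<le> e * vnorm (y - x)" .
  qed
qed

lemma line_derivative:
  assumes g: "has_gradient d f g (x + s \<cdot>\<^sub>v h)" and x: "x \<in> carrier_vec d" and h: "h \<in> carrier_vec d"
  shows "((\<lambda>s. f (x + s \<cdot>\<^sub>v h)) has_real_derivative g \<bullet> h) (at s)"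
  unfolding DERIV_def LIM_eq
proof (intro allI impI)
  fix r :: real assume r: "0 < r"
  let ?n = "vnorm h + 1"
  have pos: "0 < ?n" using vnorm_nonneg[of h] by linarith
  \<comment> \<open>the limit asks for a strict inequality, the gradient provides a non-strict one\<close>
  define e where "e = r / 2"
  have e: "0 < e" "e < r" using r by (auto simp: e_def)
  then have "0 < e / ?n" using pos by simp
  then obtain \<delta> where \<delta>: "\<delta> > 0" "\<And>y. y \<in> carrier_vec d \<Longrightarrow> vnorm (y - (x + s \<cdot>\<^sub>v h)) < \<delta> \<Longrightarrow>
      \<bar>f y - f (x + s \<cdot>\<^sub>v h) - g \<bullet> (y - (x + s \<cdot>\<^sub>v h))\<bar> \<le> e / ?n * vnorm (y - (x + s \<cdot>\<^sub>v h))"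
    using g unfolding has_gradient_def by meson
  have gc: "g \<in> carrier_vec d" using g by (simp add: has_gradient_def)
  show "\<exists>\<delta>>0. \<forall>k. k \<noteq> 0 \<and> norm (k - 0) < \<delta> \<longrightarrow>
      norm ((f (x + (s + k) \<cdot>\<^sub>v h) - f (x + s \<cdot>\<^sub>v h)) / k - g \<bullet> h) < r"
  proof (intro exI[of _ "\<delta> / ?n"] conjI allI impI)
    show "0 < \<delta> / ?n" using \<delta>(1) pos by simp
    fix k :: real assume k: "k \<noteq> 0 \<and> norm (k - 0) < \<delta> / ?n"
    have diff: "x + (s + k) \<cdot>\<^sub>v h - (x + s \<cdot>\<^sub>v h) = k \<cdot>\<^sub>v h"
      using x h by (intro eq_vecI) (auto simp: algebra_simps)
    have "vnorm (k \<cdot>\<^sub>v h) \<le> \<bar>k\<bar> * ?n"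
      by (simp add: mult_left_mono)
    also have le: "\<dots> < \<delta>" using k pos by (simp add: pos_less_divide_eq)
    finally have "\<bar>f (x + (s + k) \<cdot>\<^sub>v h) - f (x + s \<cdot>\<^sub>v h) - g \<bullet> (k \<cdot>\<^sub>v h)\<bar> \<le>
        e / ?n * vnorm (k \<cdot>\<^sub>v h)"
      using \<delta>(2)[of "x + (s + k) \<cdot>\<^sub>v h"] x h by (simp only: diff) simp
    also have "\<dots> \<le> e / ?n * (\<bar>k\<bar> * ?n)"
      using e pos by (intro mult_left_mono) (auto intro: mult_left_mono)
    also have "\<dots> = e * \<bar>k\<bar>" using pos by simp
    also have "\<dots> < r * \<bar>k\<bar>" using e k by simp
    finally have *: "\<bar>f (x + (s + k) \<cdot>\<^sub>v h) - f (x + s \<cdot>\<^sub>v h) - k * (g \<bullet> h)\<bar> < r * \<bar>k\<bar>"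
      using gc h by simp
    have "(f (x + (s + k) \<cdot>\<^sub>v h) - f (x + s \<cdot>\<^sub>v h)) / k - g \<bullet> h =
        (f (x + (s + k) \<cdot>\<^sub>v h) - f (x + s \<cdot>\<^sub>v h) - k * (g \<bullet> h)) / k"
      using k by (simp add: field_simps)
    then show "norm ((f (x + (s + k) \<cdot>\<^sub>v h) - f (x + s \<cdot>\<^sub>v h)) / k - g \<bullet> h) < r"
      using * k by (simp add: abs_divide pos_divide_less_eq)
  qed
qed

lemma gradient_mean_value:
  assumes g: "\<And>z. z \<in> carrier_vec d \<Longrightarrow> has_gradient d f (gr z) z"
    and x: "x \<in> carrier_vec d" and h: "h \<in> carrier_vec d"
  obtains s where "0 < s" "s < 1" "f (x + h) - f x = gr (x + s \<cdot>\<^sub>v h) \<bullet> h"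
proof -
  have D: "((\<lambda>s. f (x + s \<cdot>\<^sub>v h)) has_real_derivative gr (x + s \<cdot>\<^sub>v h) \<bullet> h) (at s)" for s
    by (rule line_derivative[OF g]) (use x h in simp_all)
  have "\<exists>s>0. s < 1 \<and> f (x + 1 \<cdot>\<^sub>v h) - f (x + 0 \<cdot>\<^sub>v h) = (1 - 0) * (gr (x + s \<cdot>\<^sub>v h) \<bullet> h)"
    by (rule MVT2[of 0 1 "\<lambda>s. f (x + s \<cdot>\<^sub>v h)" "\<lambda>s. gr (x + s \<cdot>\<^sub>v h) \<bullet> h"])
      (use D in auto)
  moreover have "x + 0 \<cdot>\<^sub>v h = x" using x h by (intro eq_vecI) auto
  ultimately show thesis using that by auto
qed

lemma jacobian_mean_value:
  assumes J: "\<And>z. z \<in> carrier_vec d \<Longrightarrow> has_jacobian d F (J z) z"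
    and F: "\<And>y. y \<in> carrier_vec d \<Longrightarrow> F y \<in> carrier_vec d"
    and x: "x \<in> carrier_vec d" and h: "h \<in> carrier_vec d" and w: "w \<in> carrier_vec d"
  obtains s where "0 < s" "s < 1" "w \<bullet> F (x + h) - w \<bullet> F x = w \<bullet> (J (x + s \<cdot>\<^sub>v h) *\<^sub>v h)"
proof -
  obtain s where s: "0 < s" "s < 1"
      "w \<bullet> F (x + h) - w \<bullet> F x = (transpose_mat (J (x + s \<cdot>\<^sub>v h)) *\<^sub>v w) \<bullet> h"
    using gradient_mean_value[where f = "\<lambda>y. w \<bullet> F y" and gr = "\<lambda>z. transpose_mat (J z) *\<^sub>v w",
        OF has_jacobian_component[OF J F _ w] x h] by blast
  moreover have "J (x + s \<cdot>\<^sub>v h) \<in> carrier_mat d d"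
    using J[of "x + s \<cdot>\<^sub>v h"] x h by (simp add: has_jacobian_def)
  then have "(transpose_mat (J (x + s \<cdot>\<^sub>v h)) *\<^sub>v w) \<bullet> h = w \<bullet> (J (x + s \<cdot>\<^sub>v h) *\<^sub>v h)"
    using h w by (intro transpose_vec_mult_scalar) auto
  ultimately show thesis using that by auto
qed

text \<open>The linear approximation with the Jacobian at a point \<open>z\<close> near the segment. There is no mean value theorem
  for vector-valued functions; it is applied to the component along the error \<open>w\<close> itself, which
  bounds \<open>\<parallel>w\<parallel>\<^sup>2\<close>, and the Lipschitz condition bounds the change of the Jacobian by \<open>\<sigma> r\<close>.\<close>

lemma jacobian_approximation:
  assumes J: "\<And>z. z \<in> carrier_vec d \<Longrightarrow> has_jacobian d F (J z) z"
    and F: "\<And>y. y \<in> carrier_vec d \<Longrightarrow> F y \<in> carrier_vec d"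
    and lip: "lipschitz_hessian d \<sigma> J" and \<sigma>: "0 \<le> \<sigma>"
    and x: "x \<in> carrier_vec d" and h: "h \<in> carrier_vec d" and z: "z \<in> carrier_vec d"
    and r: "\<And>s. 0 < s \<Longrightarrow> s < 1 \<Longrightarrow> vnorm (x + s \<cdot>\<^sub>v h - z) \<le> r"
  shows "vnorm (F (x + h) - F x - J z *\<^sub>v h) \<le> \<sigma> * r * vnorm h"
proof -
  \<comment> \<open>the error serves as its own test vector\<close>
  let ?w = "F (x + h) - F x - J z *\<^sub>v h"
  have Jc: "J y \<in> carrier_mat d d" if "y \<in> carrier_vec d" for y
    using J[OF that] by (simp add: has_jacobian_def)
  have Fc: "F (x + h) \<in> carrier_vec d" "F x \<in> carrier_vec d" "J z *\<^sub>v h \<in> carrier_vec d"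
    using F[of "x + h"] F[OF x] Jc[OF z] x h by auto
  then have w: "?w \<in> carrier_vec d" by simp
  obtain s where s: "0 < s" "s < 1" "?w \<bullet> F (x + h) - ?w \<bullet> F x = ?w \<bullet> (J (x + s \<cdot>\<^sub>v h) *\<^sub>v h)"
    using jacobian_mean_value[OF J F x h w] by blast
  let ?y = "x + s \<cdot>\<^sub>v h"
  have y: "?y \<in> carrier_vec d" using x h by simp
  have Jd: "J ?y - J z \<in> carrier_mat d d" using Jc[OF z] by (rule minus_carrier_mat)
  then have D: "(J ?y - J z) *\<^sub>v h \<in> carrier_vec d" using h by (rule mult_mat_vec_carrier)
  have "(vnorm ?w)\<^sup>2 = ?w \<bullet> (F (x + h)) - ?w \<bullet> F x - ?w \<bullet> (J z *\<^sub>v h)"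
    unfolding vnorm_sq scalar_prod_minus_distrib[OF w minus_carrier_vec[OF Fc(1,2)] Fc(3)]
      scalar_prod_minus_distrib[OF w Fc(1,2)] ..
  also have "\<dots> = ?w \<bullet> ((J ?y - J z) *\<^sub>v h)"
    using w Jc[OF y] Jc[OF z] h unfolding s(3)
    by (simp add: minus_mult_distrib_mat_vec scalar_prod_minus_distrib[where n = d])
  also have "\<dots> \<le> vnorm ?w * vnorm ((J ?y - J z) *\<^sub>v h)"
    using cauchy_schwarz[OF w D] by linarith
  also have "\<dots> \<le> vnorm ?w * (\<sigma> * r * vnorm h)"
  proof (rule mult_left_mono)
    have "vnorm ((J ?y - J z) *\<^sub>v h) \<le> opnorm (J ?y - J z) * vnorm h"
      using op_bounded_opnorm[OF Jd] h by (simp add: op_bounded_def)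
    also have "\<dots> \<le> \<sigma> * vnorm (?y - z) * vnorm h"
      using lip y z by (intro mult_right_mono) (auto simp: lipschitz_hessian_def)
    also have "\<dots> \<le> \<sigma> * r * vnorm h"
      using r[OF s(1,2)] \<sigma> by (intro mult_right_mono mult_left_mono) auto
    finally show "vnorm ((J ?y - J z) *\<^sub>v h) \<le> \<sigma> * r * vnorm h" .
  qed simp
  finally have *: "vnorm ?w * vnorm ?w \<le> vnorm ?w * (\<sigma> * r * vnorm h)"
    by (simp add: power2_eq_square)
  have "0 \<le> r" using order_trans[OF vnorm_nonneg r[of "1/2"]] by simp
  then have "0 \<le> \<sigma> * r * vnorm h" using \<sigma> by simp
  then show ?thesis
    using * vnorm_nonneg[of ?w] mult_left_le_imp_le[OF *] by linarith
qed

section \<open>Smooth strongly convex functions with Lipschitz Hessian\<close>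

text \<open>For comparing the leading terms of expansions along a direction scaled by \<open>s\<close>.\<close>

lemma le_of_le_add_small:
  fixes a b c :: real
  assumes "\<And>s. 0 < s \<Longrightarrow> a \<le> b + s * c"
  shows "a \<le> b"
proof (rule field_le_epsilon)
  fix e :: real assume e: "0 < e"
  have "a \<le> b + e / (\<bar>c\<bar> + 1) * c"
    using e by (intro assms divide_pos_pos) auto
  also have "e / (\<bar>c\<bar> + 1) * c \<le> e / (\<bar>c\<bar> + 1) * (\<bar>c\<bar> + 1)"
    using e by (intro mult_left_mono) auto
  also have "\<dots> = e" by simp
  finally show "a \<le> b + e" by simp
qed

text \<open>First-order optimality from the quadratic upper bound alone, by a gradient step of length
  \<open>1 / (2 L)\<close>. In this form it applies to the mean objective without differentiating it.\<close>

lemma gradient_zero_of_minimizer: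
  assumes g: "g \<in> carrier_vec d" and L: "0 < L"
    and le: "\<And>h. h \<in> carrier_vec d \<Longrightarrow> 0 \<le> g \<bullet> h + L * (vnorm h)\<^sup>2"
  shows "g = 0\<^sub>v d"
proof -
  \<comment> \<open>the step that minimizes the quadratic upper bound\<close>
  have "0 \<le> g \<bullet> ((- (1 / (2 * L))) \<cdot>\<^sub>v g) + L * (vnorm ((- (1 / (2 * L))) \<cdot>\<^sub>v g))\<^sup>2"
    using g by (intro le) simp
  also have "\<dots> = - (vnorm g)\<^sup>2 / (4 * L)"
    using g L by (simp add: vnorm_sq[symmetric] power_mult_distrib power2_eq_square field_simps)
  finally have "(vnorm g)\<^sup>2 \<le> 0"
    using L by (simp add: field_simps)
  then show ?thesis using g by (intro vnorm_eq_0) auto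
qed

text \<open>The standing assumptions on the function of one node, with gradient \<open>gr\<close> and Hessian \<open>hs\<close>.\<close>

locale regular_function =
  fixes d :: nat and f :: "real vec \<Rightarrow> real" and gr :: "real vec \<Rightarrow> real vec"
    and hs :: "real vec \<Rightarrow> real mat" and \<gamma> \<mu> \<sigma> :: real
  assumes d_pos: "0 < d" and pos: "0 < \<gamma>" "0 < \<mu>" "0 < \<sigma>"
    and grad: "\<And>z. z \<in> carrier_vec d \<Longrightarrow> has_gradient d f (gr z) z"
    and hess: "\<And>z. z \<in> carrier_vec d \<Longrightarrow> has_jacobian d gr (hs z) z"
    and smooth: "smooth_fun d \<gamma> gr"
    and convex: "strongly_convex d \<mu> f gr"
    and lip: "lipschitz_hessian d \<sigma> hs"
begin

lemma gr_carrier [simp]: "z \<in> carrier_vec d \<Longrightarrow> gr z \<in> carrier_vec d"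
  using grad by (simp add: has_gradient_def)

lemma hs_carrier [simp]: "z \<in> carrier_vec d \<Longrightarrow> hs z \<in> carrier_mat d d"
  using hess by (simp add: has_jacobian_def)

lemma hs_mult_carrier [simp]: "z \<in> carrier_vec d \<Longrightarrow> v \<in> carrier_vec d \<Longrightarrow> hs z *\<^sub>v v \<in> carrier_vec d"
  by (rule mult_mat_vec_carrier[OF hs_carrier])

lemma hs_mult_smult:
  "x \<in> carrier_vec d \<Longrightarrow> v \<in> carrier_vec d \<Longrightarrow> hs x *\<^sub>v (s \<cdot>\<^sub>v v) = s \<cdot>\<^sub>v (hs x *\<^sub>v v)"
  by (rule mult_mat_vec[OF hs_carrier])

lemma gr_lipschitz:
  "x \<in> carrier_vec d \<Longrightarrow> y \<in> carrier_vec d \<Longrightarrow> vnorm (gr x - gr y) \<le> \<gamma> * vnorm (x - y)"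
  using smooth by (simp add: smooth_fun_def)

lemma hs_lipschitz:
  assumes "x \<in> carrier_vec d" "y \<in> carrier_vec d"
  shows "op_bounded d (hs x - hs y) (\<sigma> * vnorm (x - y))"
  using op_bounded_opnorm[OF minus_carrier_mat[OF hs_carrier]] lip assms
  by (meson lipschitz_hessian_def op_bounded_mono)

lemma add_diff_vec:
  "x \<in> carrier_vec d \<Longrightarrow> h \<in> carrier_vec d \<Longrightarrow> x + h - x = (h :: real vec)"
  by (intro eq_vecI) auto

lemma gradient_expansion:
  assumes x: "x \<in> carrier_vec d" and h: "h \<in> carrier_vec d"
  shows "vnorm (gr (x + h) - gr x - hs x *\<^sub>v h) \<le> \<sigma> * (vnorm h)\<^sup>2"
proof -
  have "vnorm (gr (x + h) - gr x - hs x *\<^sub>v h) \<le> \<sigma> * vnorm h * vnorm h"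
  proof (rule jacobian_approximation[OF hess gr_carrier lip _ x h x])
    fix s :: real assume s: "0 < s" "s < 1"
    have "x + s \<cdot>\<^sub>v h - x = s \<cdot>\<^sub>v h" using x h by (intro add_diff_vec) auto
    then show "vnorm (x + s \<cdot>\<^sub>v h - x) \<le> vnorm h"
      using s by (simp add: mult_left_le_one_le)
  qed (use pos in auto)
  then show ?thesis by (simp add: power2_eq_square mult.assoc)
qed

text \<open>The expansion with the Hessian at the current point \<open>y\<close>, as it occurs in Newton's method; \<open>x\<close> will be
  the minimizer.\<close>

lemma gradient_difference:
  assumes x: "x \<in> carrier_vec d" and y: "y \<in> carrier_vec d"
  shows "vnorm (gr y - gr x - hs y *\<^sub>v (y - x)) \<le> \<sigma> * (vnorm (y - x))\<^sup>2"
proof -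
  have eq: "y + (x - y) = x" using x y by (intro eq_vecI) auto
  have "y - x = (-1) \<cdot>\<^sub>v (x - y)" using x y by (intro eq_vecI) auto
  then have H: "hs y *\<^sub>v (y - x) = (-1) \<cdot>\<^sub>v (hs y *\<^sub>v (x - y))"
    using x y by (simp add: hs_mult_smult)
  have neg: "p - q - (-1) \<cdot>\<^sub>v r = (-1) \<cdot>\<^sub>v (q - p - r)"
    if "p \<in> carrier_vec d" "q \<in> carrier_vec d" "r \<in> carrier_vec d" for p q r :: "real vec"
    using that by (intro eq_vecI) auto
  have "gr y - gr x - hs y *\<^sub>v (y - x) = (-1) \<cdot>\<^sub>v (gr x - gr y - hs y *\<^sub>v (x - y))"
    unfolding H using x y by (intro neg) auto
  then show ?thesis
    using gradient_expansion[of y "x - y"] x y vnorm_minus_commute[OF x y] by (simp add: eq)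
qed

text \<open>The usual constant is \<open>\<gamma> / 2\<close>; the mean value theorem gives \<open>\<gamma>\<close>, which changes only the constant of the
  communication bound.\<close>

lemma descent:
  assumes x: "x \<in> carrier_vec d" and h: "h \<in> carrier_vec d"
  shows "f (x + h) \<le> f x + gr x \<bullet> h + \<gamma> * (vnorm h)\<^sup>2"
proof -
  obtain s where s: "0 < s" "s < 1" "f (x + h) - f x = gr (x + s \<cdot>\<^sub>v h) \<bullet> h"
    using gradient_mean_value[OF grad x h] by blast
  let ?y = "x + s \<cdot>\<^sub>v h"
  have y: "?y \<in> carrier_vec d" using x h by simp
  have "gr ?y \<bullet> h - gr x \<bullet> h = (gr ?y - gr x) \<bullet> h"
    using x y h by (simp add: minus_scalar_prod_distrib[where n = d])
  also have "\<dots> \<le> vnorm (gr ?y - gr x) * vnorm h"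
    using cauchy_schwarz[of "gr ?y - gr x" d h] x y h by simp
  also have "\<dots> \<le> \<gamma> * vnorm (?y - x) * vnorm h"
    using gr_lipschitz[OF y x] by (intro mult_right_mono) auto
  also have "?y - x = s \<cdot>\<^sub>v h" using x h by (intro add_diff_vec) auto
  also have "\<gamma> * vnorm (s \<cdot>\<^sub>v h) * vnorm h \<le> \<gamma> * (1 * vnorm h) * vnorm h"
    using s pos unfolding vnorm_smult by (intro mult_right_mono mult_left_mono) auto
  finally show ?thesis using s(3) by (simp add: power2_eq_square mult.assoc)
qed

lemma gradient_strongly_monotone:
  assumes x: "x \<in> carrier_vec d" and h: "h \<in> carrier_vec d"
  shows "\<mu> * (vnorm h)\<^sup>2 \<le> (gr (x + h) - gr x) \<bullet> h"
proof -
  have y: "x + h \<in> carrier_vec d" using x h by simp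
  have d1: "x + h - x = h" using x h by (rule add_diff_vec)
  have d2: "x - (x + h) = (-1) \<cdot>\<^sub>v h" using x h by (intro eq_vecI) auto
  have "f x + gr x \<bullet> h + \<mu> / 2 * (vnorm h)\<^sup>2 \<le> f (x + h)"
    using convex[unfolded strongly_convex_def, rule_format, OF x y] unfolding d1 .
  moreover have "f (x + h) + gr (x + h) \<bullet> ((-1) \<cdot>\<^sub>v h) + \<mu> / 2 * (vnorm ((-1) \<cdot>\<^sub>v h))\<^sup>2 \<le> f x"
    using convex[unfolded strongly_convex_def, rule_format, OF y x] unfolding d2 .
  ultimately show ?thesis
    using x y h by (simp add: minus_scalar_prod_distrib[where n = d])
qed

text \<open>Compare the Lipschitz bound of the gradient with its expansion at step \<open>s v\<close>, divide by \<open>s\<close> and let \<open>s\<close>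
  tend to \<open>0\<close>.\<close>

lemma hs_bounded:
  assumes x: "x \<in> carrier_vec d"
  shows "op_bounded d (hs x) \<gamma>"
  unfolding op_bounded_def
proof
  fix v :: "real vec" assume v: "v \<in> carrier_vec d"
  show "vnorm (hs x *\<^sub>v v) \<le> \<gamma> * vnorm v"
  proof (rule le_of_le_add_small)
    fix s :: real assume s: "0 < s"
    have sv: "s \<cdot>\<^sub>v v \<in> carrier_vec d" using v by simp
    have "vnorm (hs x *\<^sub>v (s \<cdot>\<^sub>v v)) \<le>
        vnorm (gr (x + s \<cdot>\<^sub>v v) - gr x) + vnorm (hs x *\<^sub>v (s \<cdot>\<^sub>v v) - (gr (x + s \<cdot>\<^sub>v v) - gr x))"
      using x sv by (intro vnorm_le_add_diff[where d = d] hs_mult_carrier minus_carrier_vec gr_carrier) auto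
    also have "vnorm (hs x *\<^sub>v (s \<cdot>\<^sub>v v) - (gr (x + s \<cdot>\<^sub>v v) - gr x)) =
        vnorm (gr (x + s \<cdot>\<^sub>v v) - gr x - hs x *\<^sub>v (s \<cdot>\<^sub>v v))"
      using x sv by (intro vnorm_minus_commute[where d = d] hs_mult_carrier minus_carrier_vec gr_carrier) auto
    also have "vnorm (gr (x + s \<cdot>\<^sub>v v) - gr x) \<le> \<gamma> * vnorm (x + s \<cdot>\<^sub>v v - x)"
      using x sv by (intro gr_lipschitz) auto
    also have "x + s \<cdot>\<^sub>v v - x = s \<cdot>\<^sub>v v" using x sv by (rule add_diff_vec)
    finally have "vnorm (hs x *\<^sub>v (s \<cdot>\<^sub>v v)) \<le> \<gamma> * vnorm (s \<cdot>\<^sub>v v) + \<sigma> * (vnorm (s \<cdot>\<^sub>v v))\<^sup>2"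
      using gradient_expansion[OF x sv] by linarith
    then have "s * vnorm (hs x *\<^sub>v v) \<le> s * (\<gamma> * vnorm v + s * (\<sigma> * (vnorm v)\<^sup>2))"
      using s x v by (simp add: hs_mult_smult power2_eq_square algebra_simps)
    then show "vnorm (hs x *\<^sub>v v) \<le> \<gamma> * vnorm v + s * (\<sigma> * (vnorm v)\<^sup>2)"
      using s by (rule mult_left_le_imp_le)
  qed
qed

text \<open>As for the upper bound, but starting from strong monotonicity of the gradient and dividing by \<open>s\<^sup>2\<close>.\<close>

lemma hs_coercive:
  assumes x: "x \<in> carrier_vec d"
  shows "coercive d (hs x) \<mu>"
  unfolding coercive_def
proof
  fix v :: "real vec" assume v: "v \<in> carrier_vec d"
  show "\<mu> * (vnorm v)\<^sup>2 \<le> v \<bullet> (hs x *\<^sub>v v)"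
  proof (rule le_of_le_add_small)
    fix s :: real assume s: "0 < s"
    define h where "h = s \<cdot>\<^sub>v v"
    have h: "h \<in> carrier_vec d" using v by (simp add: h_def)
    define r where "r = gr (x + h) - gr x - hs x *\<^sub>v h"
    have G: "gr (x + h) - gr x \<in> carrier_vec d" using x h by simp
    have Hh: "hs x *\<^sub>v h \<in> carrier_vec d" using x h by simp
    have r: "r \<in> carrier_vec d" using G Hh by (simp add: r_def)
    have "(gr (x + h) - gr x) \<bullet> h - (hs x *\<^sub>v h) \<bullet> h = r \<bullet> h"
      unfolding r_def by (rule minus_scalar_prod_distrib[OF G Hh h, symmetric])
    also have "\<dots> \<le> vnorm r * vnorm h" using cauchy_schwarz[OF r h] by linarith
    also have "\<dots> \<le> \<sigma> * (vnorm h)\<^sup>2 * vnorm h"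
      using gradient_expansion[OF x h] unfolding r_def by (intro mult_right_mono) auto
    finally have "\<mu> * (vnorm h)\<^sup>2 \<le> h \<bullet> (hs x *\<^sub>v h) + \<sigma> * (vnorm h)\<^sup>2 * vnorm h"
      using gradient_strongly_monotone[OF x h] comm_scalar_prod[OF Hh h] by linarith
    also have "h \<bullet> (hs x *\<^sub>v h) = s\<^sup>2 * (v \<bullet> (hs x *\<^sub>v v))"
      using x v by (simp add: h_def hs_mult_smult power2_eq_square scalar_prod_smult_distrib[where n = d])
    finally have "s\<^sup>2 * (\<mu> * (vnorm v)\<^sup>2) \<le> s\<^sup>2 * (v \<bullet> (hs x *\<^sub>v v) + s * (\<sigma> * (vnorm v) ^ 3))"
      using s by (simp add: h_def power2_eq_square power3_eq_cube algebra_simps)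
    then show "\<mu> * (vnorm v)\<^sup>2 \<le> v \<bullet> (hs x *\<^sub>v v) + s * (\<sigma> * (vnorm v) ^ 3)"
      using s by (simp add: mult_le_cancel_left_pos)
  qed
qed

text \<open>The second difference is the first difference in direction \<open>b\<close> of \<open>y \<mapsto> f (y + a) - f y\<close>. By the
  mean value theorem it is an inner product of \<open>b\<close> with a gradient difference over the
  displacement \<open>a\<close>, which is nearly \<open>hs x *\<^sub>v a\<close>.\<close>

lemma second_difference:
  assumes x: "x \<in> carrier_vec d" and a: "a \<in> carrier_vec d" and b: "b \<in> carrier_vec d"
  shows "\<bar>f (x + a + b) - f (x + b) - f (x + a) + f x - b \<bullet> (hs x *\<^sub>v a)\<bar>
    \<le> \<sigma> * (vnorm a + vnorm b) * vnorm a * vnorm b"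
proof -
  have D: "((\<lambda>s. f (y + s \<cdot>\<^sub>v b)) has_real_derivative gr (y + s \<cdot>\<^sub>v b) \<bullet> b) (at s)"
    if "y \<in> carrier_vec d" for y s
    by (rule line_derivative[OF grad]) (use that b in simp_all)
  have xa: "x + a \<in> carrier_vec d" using x a by simp
  have "\<exists>s>0. s < 1 \<and> (f (x + a + 1 \<cdot>\<^sub>v b) - f (x + 1 \<cdot>\<^sub>v b)) - (f (x + a + 0 \<cdot>\<^sub>v b) - f (x + 0 \<cdot>\<^sub>v b)) =
      (1 - 0) * (gr (x + a + s \<cdot>\<^sub>v b) \<bullet> b - gr (x + s \<cdot>\<^sub>v b) \<bullet> b)"
    by (rule MVT2[of 0 1 "\<lambda>s. f (x + a + s \<cdot>\<^sub>v b) - f (x + s \<cdot>\<^sub>v b)"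
          "\<lambda>s. gr (x + a + s \<cdot>\<^sub>v b) \<bullet> b - gr (x + s \<cdot>\<^sub>v b) \<bullet> b"])
      (auto intro!: DERIV_diff D[OF x] D[OF xa])
  moreover have "x + a + 0 \<cdot>\<^sub>v b = x + a" "x + 0 \<cdot>\<^sub>v b = x"
    using x a b by (auto intro!: eq_vecI)
  ultimately obtain s where s: "0 < s" "s < 1" "f (x + a + b) - f (x + b) - f (x + a) + f x =
      gr (x + a + s \<cdot>\<^sub>v b) \<bullet> b - gr (x + s \<cdot>\<^sub>v b) \<bullet> b" by auto
  define y where "y = x + s \<cdot>\<^sub>v b"
  have y: "y \<in> carrier_vec d" using x b by (simp add: y_def)
  have ya: "x + a + s \<cdot>\<^sub>v b = y + a" using x a b unfolding y_def by (intro eq_vecI) auto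
  define r where "r = gr (y + a) - gr y - hs x *\<^sub>v a"
  have G: "gr (y + a) \<in> carrier_vec d" "gr y \<in> carrier_vec d" "hs x *\<^sub>v a \<in> carrier_vec d"
    using x y a by auto
  have r: "r \<in> carrier_vec d" using G by (simp add: r_def)
  have "vnorm r \<le> \<sigma> * (vnorm a + vnorm b) * vnorm a"
    unfolding r_def
  proof (rule jacobian_approximation[OF hess gr_carrier lip _ y a x])
    fix u :: real assume u: "0 < u" "u < 1"
    have "y + u \<cdot>\<^sub>v a - x = u \<cdot>\<^sub>v a + s \<cdot>\<^sub>v b"
      using x a b unfolding y_def by (intro eq_vecI) auto
    also have "vnorm \<dots> \<le> u * vnorm a + s * vnorm b"
      using vnorm_add[of "u \<cdot>\<^sub>v a" d "s \<cdot>\<^sub>v b"] a b u s by simp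
    also have "\<dots> \<le> 1 * vnorm a + 1 * vnorm b"
      using u s by (intro add_mono mult_right_mono) auto
    finally show "vnorm (y + u \<cdot>\<^sub>v a - x) \<le> vnorm a + vnorm b" by simp
  qed (use pos in auto)
  then have "vnorm r * vnorm b \<le> \<sigma> * (vnorm a + vnorm b) * vnorm a * vnorm b"
    by (rule mult_right_mono) simp
  moreover have "\<bar>r \<bullet> b\<bar> \<le> vnorm r * vnorm b" using r b by (rule cauchy_schwarz)
  moreover have "r \<bullet> b = gr (y + a) \<bullet> b - gr y \<bullet> b - b \<bullet> (hs x *\<^sub>v a)"
    unfolding r_def minus_scalar_prod_distrib[OF minus_carrier_vec[OF G(1,2)] G(3) b]
      minus_scalar_prod_distrib[OF G(1,2) b] comm_scalar_prod[OF G(3) b] ..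
  ultimately show ?thesis
    unfolding s(3) ya y_def[symmetric] by linarith
qed

text \<open>The second difference is symmetric in \<open>a\<close> and \<open>b\<close>. After scaling both by \<open>s\<close>, it determines either side up to
  \<open>O(s\<^sup>3)\<close>, while the sides scale like \<open>s\<^sup>2\<close>.\<close>

lemma hs_self_adjoint:
  assumes x: "x \<in> carrier_vec d" and a: "a \<in> carrier_vec d" and b: "b \<in> carrier_vec d"
  shows "b \<bullet> (hs x *\<^sub>v a) = a \<bullet> (hs x *\<^sub>v b)"
proof -
  let ?D = "b \<bullet> (hs x *\<^sub>v a) - a \<bullet> (hs x *\<^sub>v b)"
  let ?c = "\<sigma> * (vnorm a + vnorm b) * vnorm a * vnorm b"
  have "\<bar>?D\<bar> \<le> 0"
  proof (rule le_of_le_add_small)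
    fix s :: real assume s: "0 < s"
    let ?a = "s \<cdot>\<^sub>v a" and ?b = "s \<cdot>\<^sub>v b"
    have ab: "?a \<in> carrier_vec d" "?b \<in> carrier_vec d" using a b by auto
    have comm: "x + ?b + ?a = x + ?a + ?b" using x a b by (intro eq_vecI) auto
    have e1: "?b \<bullet> (hs x *\<^sub>v ?a) = s\<^sup>2 * (b \<bullet> (hs x *\<^sub>v a))"
      using x a b by (simp add: hs_mult_smult power2_eq_square scalar_prod_smult_distrib[where n = d])
    have e2: "?a \<bullet> (hs x *\<^sub>v ?b) = s\<^sup>2 * (a \<bullet> (hs x *\<^sub>v b))"
      using x a b by (simp add: hs_mult_smult power2_eq_square scalar_prod_smult_distrib[where n = d])
    have e3: "\<sigma> * (vnorm ?a + vnorm ?b) * vnorm ?a * vnorm ?b = s\<^sup>2 * (s * ?c)"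
      "\<sigma> * (vnorm ?b + vnorm ?a) * vnorm ?b * vnorm ?a = s\<^sup>2 * (s * ?c)"
      using s by (auto simp: power2_eq_square algebra_simps)
    have "\<bar>s\<^sup>2 * (b \<bullet> (hs x *\<^sub>v a)) - s\<^sup>2 * (a \<bullet> (hs x *\<^sub>v b))\<bar> \<le> s\<^sup>2 * (s * ?c) + s\<^sup>2 * (s * ?c)"
      using second_difference[OF x ab] second_difference[OF x ab(2,1)]
      unfolding comm e1 e2 e3 by linarith
    moreover have "\<bar>s\<^sup>2 * (b \<bullet> (hs x *\<^sub>v a)) - s\<^sup>2 * (a \<bullet> (hs x *\<^sub>v b))\<bar> = s\<^sup>2 * \<bar>?D\<bar>"
      by (simp add: right_diff_distrib[symmetric] abs_mult)
    moreover have "s\<^sup>2 * (s * ?c) + s\<^sup>2 * (s * ?c) = s\<^sup>2 * (0 + s * (2 * ?c))"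
      by (simp add: algebra_simps)
    ultimately have "s\<^sup>2 * \<bar>?D\<bar> \<le> s\<^sup>2 * (0 + s * (2 * ?c))"
      by linarith
    then show "\<bar>?D\<bar> \<le> 0 + s * (2 * ?c)"
      using s by (simp add: mult_le_cancel_left_pos)
  qed
  then show ?thesis by simp
qed

lemma hs_sym:
  assumes x: "x \<in> carrier_vec d"
  shows "hs x \<in> sym_mats d"
proof -
  have "hs x $$ (i, j) = unit_vec d i \<bullet> (hs x *\<^sub>v unit_vec d j)" if "i < d" "j < d" for i j
    using that hs_carrier[OF x] by (simp add: scalar_prod_left_unit[where n = d])
  then show ?thesis
    using hs_self_adjoint[OF x unit_vec_carrier unit_vec_carrier] hs_carrier[OF x]
    by (metis sym_mats_iff)
qed

text \<open>That is, \<open>\<kappa> \<ge> 1\<close>. The proof needs a nonzero vector and hence \<open>d > 0\<close>.\<close>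

lemma strong_convexity_le_smoothness: "\<mu> \<le> \<gamma>"
proof -
  let ?e = "unit_vec d 0" and ?z = "0\<^sub>v d"
  have e: "?e \<in> carrier_vec d" and z: "?z \<in> carrier_vec d" by auto
  have n: "0 < vnorm ?e"
    using d_pos abs_index_le_vnorm[of 0 ?e] by auto
  have "\<mu> * vnorm ?e \<le> vnorm (hs ?z *\<^sub>v ?e)"
    by (rule coercive_lower_bound[OF hs_carrier[OF z] hs_coercive[OF z] e])
  also have "\<dots> \<le> \<gamma> * vnorm ?e"
    using hs_bounded[OF z] e by (simp add: op_bounded_def)
  finally show ?thesis using n by simp
qed

end

section \<open>The parameters for \<open>\<alpha> = 1/2\<close>\<close>

text \<open>The error of a decoded Hessian is \<open>sqrt 2\<close> times the resolution (\<open>quantize_mat_error\<close>); the product is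
  the bound \<open>G / (2 \<kappa>)\<close> of the analysis.\<close>

lemma hess_res_half:
  assumes "0 < \<gamma>" "0 < \<mu>"
  shows "0 < hess_res \<gamma> \<mu> (1/2) t" "sqrt 2 * hess_res \<gamma> \<mu> (1/2) t = \<mu>\<^sup>2 / (16 * \<gamma>) * (3/4) ^ t"
  using assms by (auto simp: hess_res_def qn_G_def power2_eq_square)

lemma hess_rad_half:
  assumes "0 < \<gamma>" "0 < \<mu>"
  shows "hess_up_rad d \<gamma> \<mu> (1/2) 0 = sqrt (real d) * (2 * \<gamma>)"
    and "hess_up_rad d \<gamma> \<mu> (1/2) (Suc t) = sqrt (real d) * (5 / 8 * \<mu> * (3/4) ^ t)"
    and "hess_down_rad d \<gamma> \<mu> (1/2) 0 = sqrt (real d) * (\<mu>\<^sup>2 / (16 * \<gamma>) + 2 * \<gamma>)"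
    and "hess_down_rad d \<gamma> \<mu> (1/2) (Suc t) =
      sqrt (real d) * (\<mu>\<^sup>2 / (16 * \<gamma>) * (3/4) ^ Suc t + 5 / 8 * \<mu> * (3/4) ^ t)"
  using assms by (auto simp: hess_up_rad_def hess_down_rad_def qn_G_def power2_eq_square field_simps)

lemma dir_half:
  assumes "0 < \<gamma>" "0 < \<mu>" "0 < \<sigma>"
  shows "dir_res \<mu> \<sigma> (1/2) t = \<mu> / (32 * \<sigma>) * (3/4) ^ t"
    and "dir_up_rad \<gamma> \<mu> \<sigma> (1/2) 0 = 4 * \<gamma> / \<sigma>"
    and "dir_up_rad \<gamma> \<mu> \<sigma> (1/2) (Suc t) = 11 * \<gamma> / \<sigma> * (3/4) ^ Suc t"
    and "dir_down_rad \<gamma> \<mu> \<sigma> (1/2) 0 = \<mu> / (32 * \<sigma>) + 4 * \<gamma> / \<sigma>"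
    and "dir_down_rad \<gamma> \<mu> \<sigma> (1/2) (Suc t) =
      \<mu> / (32 * \<sigma>) * (3/4) ^ Suc t + 11 * \<gamma> / \<sigma> * (3/4) ^ Suc t"
  using assms
  by (auto simp: dir_res_def dir_up_rad_def dir_down_rad_def qn_P_def qn_K_def qn_theta_def field_simps)

section \<open>The distributed problem and its mean objective\<close>

text \<open>The hypotheses of the theorem, with the quantization. Inside, \<open>mgr\<close> and \<open>mhs\<close> are the gradient and
  the Hessian of the mean objective. They are only used through averaged estimates of the nodes, so that
  derivatives of the mean objective never have to be taken.\<close>

locale newton_problem =
  fixes Q :: "nat \<Rightarrow> real vec \<Rightarrow> real vec \<Rightarrow> real \<Rightarrow> real \<Rightarrow> real vec"
    and enc :: "nat \<Rightarrow> real \<Rightarrow> real \<Rightarrow> real vec \<Rightarrow> bool list"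
    and dec :: "nat \<Rightarrow> real \<Rightarrow> real \<Rightarrow> bool list \<Rightarrow> real vec \<Rightarrow> real vec"
    and b :: "nat \<Rightarrow> real \<Rightarrow> real \<Rightarrow> nat"
    and d n i0 :: nat and f :: "nat \<Rightarrow> real vec \<Rightarrow> real" and gr :: "nat \<Rightarrow> real vec \<Rightarrow> real vec"
    and hs :: "nat \<Rightarrow> real vec \<Rightarrow> real mat" and \<gamma> \<mu> \<sigma> :: real
    and xstar :: "real vec" and xistar :: "nat \<Rightarrow> real vec" and x0 :: "real vec"
  assumes quant: "quantization Q enc dec b"
    and setting: "newton_setting d n i0 f gr hs \<gamma> \<mu> \<sigma>"
    and min_mean: "is_arg_min (mean_fun n f) (\<lambda>y. y \<in> carrier_vec d) xstar"
    and min_node: "\<And>i. i < n \<Longrightarrow> is_arg_min (f i) (\<lambda>y. y \<in> carrier_vec d) (xistar i)"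
    and x0 [simp]: "x0 \<in> carrier_vec d"
    and close_mean: "\<And>i. i < n \<Longrightarrow> vnorm (x0 - xstar) \<le> \<mu> / (4 * \<sigma>)"
    and close_node: "\<And>i. i < n \<Longrightarrow> vnorm (x0 - xistar i) \<le> \<mu> / (4 * \<sigma>)"
begin

abbreviation mgr :: "real vec \<Rightarrow> real vec" where
  "mgr x \<equiv> mean_vec d n (\<lambda>i. gr i x)"

abbreviation mhs :: "real vec \<Rightarrow> real mat" where
  "mhs x \<equiv> mean_mat d n (\<lambda>i. hs i x)"

lemma pos: "0 < d" "0 < n" "i0 < n" "0 < \<gamma>" "0 < \<mu>" "0 < \<sigma>"
  using setting by (auto simp: newton_setting_def)

lemma node: "i < n \<Longrightarrow> regular_function d (f i) (gr i) (hs i) \<gamma> \<mu> \<sigma>"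
  using setting by (auto simp: newton_setting_def regular_function_def)

lemma mu_le_gamma: "\<mu> \<le> \<gamma>"
  by (rule regular_function.strong_convexity_le_smoothness[OF node[OF pos(3)]])

lemma sq_div_le: "\<mu>\<^sup>2 / \<gamma> \<le> \<mu>"
  using mu_le_gamma pos by (simp add: power2_eq_square pos_divide_le_eq)

lemma gr_carrier [simp]: "i < n \<Longrightarrow> z \<in> carrier_vec d \<Longrightarrow> gr i z \<in> carrier_vec d"
  by (rule regular_function.gr_carrier[OF node])

lemma hs_carrier [simp]: "i < n \<Longrightarrow> z \<in> carrier_vec d \<Longrightarrow> hs i z \<in> carrier_mat d d"
  by (rule regular_function.hs_carrier[OF node])

lemma hs_sym [simp]: "i < n \<Longrightarrow> z \<in> carrier_vec d \<Longrightarrow> hs i z \<in> sym_mats d"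
  by (rule regular_function.hs_sym[OF node])

lemma xstar [simp]: "xstar \<in> carrier_vec d"
  by (rule min_mean[unfolded is_arg_min_def, THEN conjunct1])

lemma xistar [simp]: "i < n \<Longrightarrow> xistar i \<in> carrier_vec d"
  by (rule min_node[unfolded is_arg_min_def, THEN conjunct1])

lemma mean_fun_descent:
  assumes x: "x \<in> carrier_vec d" and h: "h \<in> carrier_vec d"
  shows "mean_fun n f (x + h) \<le> mean_fun n f x + mgr x \<bullet> h + \<gamma> * (vnorm h)\<^sup>2"
proof -
  have "mean_fun n f (x + h) \<le> (\<Sum>i<n. f i x + gr i x \<bullet> h + \<gamma> * (vnorm h)\<^sup>2) / real n"
    unfolding mean_fun_def
    by (intro divide_right_mono sum_mono regular_function.descent[OF node]) (use x h in auto)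
  also have "\<dots> = mean_fun n f x + mgr x \<bullet> h + \<gamma> * (vnorm h)\<^sup>2"
    using pos(2) by (simp add: mean_fun_def mean_vec_scalar_prod[OF h] sum.distrib add_divide_distrib)
  finally show ?thesis .
qed

lemma mgr_xstar: "mgr xstar = 0\<^sub>v d"
proof (rule gradient_zero_of_minimizer[OF mean_vec_carrier pos(4)])
  fix h :: "real vec" assume h: "h \<in> carrier_vec d"
  have "xstar + h \<in> carrier_vec d" using h by simp
  then have "mean_fun n f xstar \<le> mean_fun n f (xstar + h)"
    using min_mean[unfolded is_arg_min_linorder, THEN conjunct2] by blast
  then show "0 \<le> mgr xstar \<bullet> h + \<gamma> * (vnorm h)\<^sup>2"
    using mean_fun_descent[OF xstar h] by linarith
qed

lemma gr_xistar:
  assumes i: "i < n"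
  shows "gr i (xistar i) = 0\<^sub>v d"
proof (rule gradient_zero_of_minimizer[OF gr_carrier[OF i xistar[OF i]] pos(4)])
  fix h :: "real vec" assume h: "h \<in> carrier_vec d"
  have "xistar i + h \<in> carrier_vec d" using h i by simp
  then have "f i (xistar i) \<le> f i (xistar i + h)"
    using min_node[OF i, unfolded is_arg_min_linorder, THEN conjunct2] by blast
  then show "0 \<le> gr i (xistar i) \<bullet> h + \<gamma> * (vnorm h)\<^sup>2"
    using regular_function.descent[OF node[OF i] xistar[OF i] h] by linarith
qed

lemma function_gap:
  assumes x: "x \<in> carrier_vec d"
  shows "mean_fun n f x - mean_fun n f xstar \<le> \<gamma> * (vnorm (x - xstar))\<^sup>2"
proof -
  have h: "x - xstar \<in> carrier_vec d" using x by simp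
  have "xstar + (x - xstar) = x"
    by (rule vec_add_minus_cancel[OF x xstar])
  then show ?thesis
    using mean_fun_descent[OF xstar h] h by (simp add: mgr_xstar)
qed

text \<open>The gradient of a node vanishes at its own minimizer, which is close to \<open>x0\<close>.\<close>

lemma gr_le:
  assumes i: "i < n" and x: "x \<in> carrier_vec d" and r: "vnorm (x - x0) \<le> r"
  shows "vnorm (gr i x) \<le> \<gamma> * (r + \<mu> / (4 * \<sigma>))"
proof -
  have "gr i x = gr i x - gr i (xistar i)"
    by (simp add: gr_xistar[OF i] vec_minus_zero[OF gr_carrier[OF i x]])
  also have "vnorm \<dots> \<le> \<gamma> * vnorm (x - xistar i)"
    using i x by (intro regular_function.gr_lipschitz[OF node]) auto
  also have "\<dots> \<le> \<gamma> * (r + \<mu> / (4 * \<sigma>))"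
    using vnorm_triangle[OF x x0 xistar[OF i]] r close_node[OF i] pos by (intro mult_left_mono) auto
  finally show ?thesis .
qed

lemma mgr_le:
  assumes x: "x \<in> carrier_vec d" and r: "vnorm (x - x0) \<le> r"
  shows "vnorm (mgr x) \<le> \<gamma> * (r + \<mu> / (4 * \<sigma>))"
  using gr_le[OF _ x r] x by (intro vnorm_mean_vec[OF pos(2)]) auto

lemma mgr_lipschitz:
  assumes x: "x \<in> carrier_vec d" and y: "y \<in> carrier_vec d"
  shows "vnorm (mgr x - mgr y) \<le> \<gamma> * vnorm (x - y)"
proof -
  have "mgr x - mgr y = mean_vec d n (\<lambda>i. gr i x - gr i y)"
    using y by (intro mean_vec_minus[symmetric]) simp
  also have "vnorm \<dots> \<le> \<gamma> * vnorm (x - y)"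
    using x y regular_function.gr_lipschitz[OF node x y]
    by (intro vnorm_mean_vec[OF pos(2)]) auto
  finally show ?thesis .
qed

lemma hs_lipschitz:
  "i < n \<Longrightarrow> x \<in> carrier_vec d \<Longrightarrow> y \<in> carrier_vec d \<Longrightarrow>
    op_bounded d (hs i x - hs i y) (\<sigma> * vnorm (x - y))"
  by (rule regular_function.hs_lipschitz[OF node])

lemma mhs_lipschitz:
  "x \<in> carrier_vec d \<Longrightarrow> y \<in> carrier_vec d \<Longrightarrow> op_bounded d (mhs x - mhs y) (\<sigma> * vnorm (x - y))"
  by (intro op_bounded_mean_mat[OF pos(2)] hs_lipschitz) auto

text \<open>The first Hessian messages are decoded with the Hessian of another node, and \<open>2 \<gamma>\<close> is all that is known
  about the distance; this explains the radius of the initialization.\<close>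

lemma hs_node_diff:
  assumes i: "i < n" and j: "j < n" and x: "x \<in> carrier_vec d"
  shows "op_bounded d (hs i x - hs j x) (2 * \<gamma>)"
  unfolding op_bounded_def
proof
  fix v :: "real vec" assume v: "v \<in> carrier_vec d"
  have c: "hs i x *\<^sub>v v \<in> carrier_vec d" "hs j x *\<^sub>v v \<in> carrier_vec d"
    by (rule mult_mat_vec_carrier[OF hs_carrier[OF _ x] v], fact)+
  have "vnorm ((hs i x - hs j x) *\<^sub>v v) = vnorm (hs i x *\<^sub>v v - hs j x *\<^sub>v v)"
    by (simp add: minus_mult_distrib_mat_vec[OF hs_carrier[OF i x] hs_carrier[OF j x] v])
  also have "\<dots> \<le> vnorm (hs i x *\<^sub>v v) + vnorm (hs j x *\<^sub>v v)"
    by (rule vnorm_minus_le[OF c])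
  also have "\<dots> \<le> \<gamma> * vnorm v + \<gamma> * vnorm v"
    using regular_function.hs_bounded[OF node[OF i] x] regular_function.hs_bounded[OF node[OF j] x] v
    by (intro add_mono) (auto simp: op_bounded_def)
  finally show "vnorm ((hs i x - hs j x) *\<^sub>v v) \<le> 2 * \<gamma> * vnorm v" by simp
qed

lemma mhs_node_diff:
  assumes j: "j < n" and x: "x \<in> carrier_vec d"
  shows "op_bounded d (mhs x - hs j x) (2 * \<gamma>)"
proof -
  have "op_bounded d (mhs x - mean_mat d n (\<lambda>i. hs j x)) (2 * \<gamma>)"
    using j x hs_node_diff by (intro op_bounded_mean_mat[OF pos(2)]) auto
  then show ?thesis by (simp add: mean_mat_const[OF pos(2) hs_carrier[OF j x]])
qed

lemma mhs_coercive:
  assumes x: "x \<in> carrier_vec d"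
  shows "coercive d (mhs x) \<mu>"
  unfolding coercive_def
proof
  fix v :: "real vec" assume v: "v \<in> carrier_vec d"
  have c: "hs i x *\<^sub>v v \<in> carrier_vec d" if "i < n" for i
    by (rule mult_mat_vec_carrier[OF hs_carrier[OF that x] v])
  have "\<mu> * (vnorm v)\<^sup>2 = (\<Sum>i<n. \<mu> * (vnorm v)\<^sup>2) / real n"
    using pos(2) by simp
  also have "\<dots> \<le> (\<Sum>i<n. (hs i x *\<^sub>v v) \<bullet> v) / real n"
  proof (intro divide_right_mono sum_mono)
    fix i assume "i \<in> {..<n}"
    then have i: "i < n" by simp
    show "\<mu> * (vnorm v)\<^sup>2 \<le> (hs i x *\<^sub>v v) \<bullet> v"
      using regular_function.hs_coercive[OF node[OF i] x] v comm_scalar_prod[OF c[OF i] v]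
      by (simp add: coercive_def)
  qed simp
  also have "\<dots> = mean_vec d n (\<lambda>i. hs i x *\<^sub>v v) \<bullet> v"
    by (rule mean_vec_scalar_prod[OF v, symmetric])
  also have "\<dots> = v \<bullet> (mhs x *\<^sub>v v)"
    using mean_mat_mult_vec[OF hs_carrier[OF _ x] v, of n] comm_scalar_prod[OF mean_vec_carrier v] by simp
  finally show "\<mu> * (vnorm v)\<^sup>2 \<le> v \<bullet> (mhs x *\<^sub>v v)" .
qed

lemma mean_gradient_difference:
  assumes x: "x \<in> carrier_vec d"
  shows "vnorm (mgr x - mhs x *\<^sub>v (x - xstar)) \<le> \<sigma> * (vnorm (x - xstar))\<^sup>2"
proof -
  let ?e = "x - xstar"
  have e: "?e \<in> carrier_vec d" using x by simp
  have c: "hs i x *\<^sub>v ?e \<in> carrier_vec d" if "i < n" for i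
    by (rule mult_mat_vec_carrier[OF hs_carrier[OF that x] e])
  have "mgr x - mhs x *\<^sub>v ?e = mgr x - mgr xstar - mhs x *\<^sub>v ?e"
    by (simp add: mgr_xstar vec_minus_zero[OF mean_vec_carrier])
  also have "\<dots> = mean_vec d n (\<lambda>i. gr i x - gr i xstar) - mean_vec d n (\<lambda>i. hs i x *\<^sub>v ?e)"
    using mean_mat_mult_vec[OF hs_carrier[OF _ x] e, of n] by (simp add: mean_vec_minus)
  also have "\<dots> = mean_vec d n (\<lambda>i. gr i x - gr i xstar - hs i x *\<^sub>v ?e)"
    using c by (intro mean_vec_minus[symmetric]) simp
  also have "vnorm \<dots> \<le> \<sigma> * (vnorm ?e)\<^sup>2"
    using x c regular_function.gradient_difference[OF node xstar x]
    by (intro vnorm_mean_vec[OF pos(2)]) auto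
  finally show ?thesis .
qed

section \<open>Accuracy of one exchange of messages\<close>

text \<open>The messages of the nodes to the master. Averaging does not enlarge the error.\<close>

lemma quantized_hessians:
  assumes x: "x \<in> carrier_vec d" and \<epsilon>: "0 < \<epsilon>" and y: "0 < y" and r: "0 \<le> r" "sqrt (real d) * r \<le> y"
    and R: "\<And>i. i < n \<Longrightarrow> R i \<in> sym_mats d" "\<And>i. i < n \<Longrightarrow> op_bounded d (hs i x - R i) r"
    and Hi: "\<And>i. i < n \<Longrightarrow> Hi i = quantize_mat Q d (hs i x) (R i) y \<epsilon>"
  shows "i < n \<Longrightarrow> Hi i \<in> sym_mats d" "i < n \<Longrightarrow> op_bounded d (Hi i - hs i x) (sqrt 2 * \<epsilon>)"
    and "mean_mat d n Hi \<in> sym_mats d" "op_bounded d (mean_mat d n Hi - mhs x) (sqrt 2 * \<epsilon>)"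
proof -
  have *: "Hi i \<in> sym_mats d \<and> op_bounded d (Hi i - hs i x) (sqrt 2 * \<epsilon>)" if "i < n" for i
    using quantize_mat_error[OF quant pos(1) y \<epsilon> r(1) hs_sym[OF that x] R(1)[OF that] R(2)[OF that] r(2)]
    by (simp add: Hi[OF that])
  then show "i < n \<Longrightarrow> Hi i \<in> sym_mats d" "i < n \<Longrightarrow> op_bounded d (Hi i - hs i x) (sqrt 2 * \<epsilon>)"
    by auto
  show "mean_mat d n Hi \<in> sym_mats d" using * by (intro mean_mat_sym) simp
  show "op_bounded d (mean_mat d n Hi - mhs x) (sqrt 2 * \<epsilon>)"
    using * x by (intro op_bounded_mean_mat[OF pos(2)]) (auto dest: sym_mats_carrier)
qed

text \<open>The answer of the master. The quantized average \<open>S\<close> is off by \<open>\<surd>2 \<epsilon>\<close> already, which enters both the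
  radius and the final error.\<close>

lemma quantized_mean_hessian:
  assumes x: "x \<in> carrier_vec d" and \<epsilon>: "0 < \<epsilon>" and y: "0 < y"
    and r: "0 \<le> r" "sqrt (real d) * (sqrt 2 * \<epsilon> + r) \<le> y"
    and S: "S \<in> sym_mats d" "op_bounded d (S - mhs x) (sqrt 2 * \<epsilon>)"
    and R: "R \<in> sym_mats d" "op_bounded d (mhs x - R) r"
    and H: "H = quantize_mat Q d S R y \<epsilon>"
  shows "H \<in> sym_mats d" "op_bounded d (H - mhs x) (2 * (sqrt 2 * \<epsilon>))"
proof -
  have SR: "op_bounded d (S - R) (sqrt 2 * \<epsilon> + r)"
    using S R x by (intro op_bounded_triangle[OF _ _ _ S(2) R(2)]) (auto dest: sym_mats_carrier)
  have nn: "0 \<le> sqrt 2 * \<epsilon> + r" using \<epsilon> r by simp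
  note q = quantize_mat_error[OF quant pos(1) y \<epsilon> nn S(1) R(1) SR r(2), folded H]
  show "H \<in> sym_mats d" by (rule q(1))
  show "op_bounded d (H - mhs x) (2 * (sqrt 2 * \<epsilon>))"
    using op_bounded_triangle[OF sym_mats_carrier[OF q(1)] sym_mats_carrier[OF S(1)]
        mean_mat_carrier q(2) S(2)]
    by (simp only: mult_2)
qed

text \<open>The averaged local directions solve the averaged system, and solutions are unique. Therefore the master
  may average directions instead of gradients.\<close>

lemma newton_dir_mean:
  assumes H: "H \<in> carrier_mat d d" "coercive d H m" "0 < m" and x: "x \<in> carrier_vec d"
  shows "newton_dir H (mgr x) = mean_vec d n (\<lambda>i. newton_dir H (gr i x))"
proof -
  have s: "newton_dir H (gr i x) \<in> carrier_vec d" "H *\<^sub>v newton_dir H (gr i x) = gr i x" if "i < n" for i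
    using newton_dir_solves[OF H] that x by auto
  have "H *\<^sub>v mean_vec d n (\<lambda>i. newton_dir H (gr i x)) = mgr x"
    using mult_mean_vec[OF H(1) s(1), where n = n] s(2) by (simp cong: mean_vec_cong)
  then show ?thesis using newton_dir_unique[OF H mean_vec_carrier] by metis
qed

lemma quantized_directions:
  assumes H: "H \<in> carrier_mat d d" "coercive d H m" "0 < m" and x: "x \<in> carrier_vec d"
    and \<epsilon>: "0 < \<epsilon>" and y: "0 < y"
    and R: "\<And>i. i < n \<Longrightarrow> R i \<in> carrier_vec d" "\<And>i. i < n \<Longrightarrow> vnorm (newton_dir H (gr i x) - R i) \<le> y"
    and vi: "\<And>i. i < n \<Longrightarrow> vi i = Q d (newton_dir H (gr i x)) (R i) y \<epsilon>"
  shows "i < n \<Longrightarrow> vi i \<in> carrier_vec d" "i < n \<Longrightarrow> vnorm (vi i - newton_dir H (gr i x)) \<le> \<epsilon>"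
    and "vnorm (mean_vec d n vi - newton_dir H (mgr x)) \<le> \<epsilon>"
proof -
  have c: "newton_dir H (gr i x) \<in> carrier_vec d" if "i < n" for i
    using newton_dir_solves(1)[OF H gr_carrier[OF that x]] .
  have *: "vi i \<in> carrier_vec d \<and> vnorm (vi i - newton_dir H (gr i x)) \<le> \<epsilon>" if "i < n" for i
    using quantization_error[OF quant pos(1) y \<epsilon> c[OF that] R(1)[OF that] R(2)[OF that]]
    by (simp add: vi[OF that])
  then show "i < n \<Longrightarrow> vi i \<in> carrier_vec d" "i < n \<Longrightarrow> vnorm (vi i - newton_dir H (gr i x)) \<le> \<epsilon>"
    by auto
  have "mean_vec d n vi - newton_dir H (mgr x) = mean_vec d n (\<lambda>i. vi i - newton_dir H (gr i x))"
    unfolding newton_dir_mean[OF H x] using c by (intro mean_vec_minus[symmetric])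
  also have "vnorm \<dots> \<le> \<epsilon>"
    using * c by (intro vnorm_mean_vec[OF pos(2)]) auto
  finally show "vnorm (mean_vec d n vi - newton_dir H (mgr x)) \<le> \<epsilon>" .
qed

lemma quantized_mean_direction:
  assumes H: "H \<in> carrier_mat d d" "coercive d H m" "0 < m" and x: "x \<in> carrier_vec d"
    and \<epsilon>: "0 < \<epsilon>" and y: "0 < y" and r: "\<epsilon> + r \<le> y"
    and p: "p \<in> carrier_vec d" "vnorm (p - newton_dir H (mgr x)) \<le> \<epsilon>"
    and R: "R \<in> carrier_vec d" "vnorm (newton_dir H (mgr x) - R) \<le> r"
    and v: "v = Q d p R y \<epsilon>"
  shows "v \<in> carrier_vec d" "vnorm (v - newton_dir H (mgr x)) \<le> 2 * \<epsilon>"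
proof -
  have c: "newton_dir H (mgr x) \<in> carrier_vec d"
    by (rule newton_dir_solves(1)[OF H mean_vec_carrier])
  have "vnorm (p - R) \<le> y"
    using vnorm_triangle[OF p(1) c R(1)] p(2) R(2) r by linarith
  note q = quantization_error[OF quant pos(1) y \<epsilon> p(1) R(1) this, folded v]
  show "v \<in> carrier_vec d" by (rule q(1))
  show "vnorm (v - newton_dir H (mgr x)) \<le> 2 * \<epsilon>"
    using vnorm_triangle[OF q(1) p(1) c] p(2) q(2) by linarith
qed

section \<open>Contraction of the quantized Newton step\<close>

text \<open>The error of \<open>H\<close> is at most \<open>\<mu> / 8\<close>, because \<open>\<mu> \<le> \<gamma>\<close> and \<open>q \<le> 1\<close>.\<close>

lemma estimate_coercive:
  assumes x: "x \<in> carrier_vec d" and H: "H \<in> sym_mats d" "op_bounded d (H - mhs x) (\<mu>\<^sup>2 / (8 * \<gamma>) * q)"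
    and q: "0 \<le> q" "q \<le> 1"
  shows "coercive d H (7 * \<mu> / 8)"
proof -
  have "\<mu>\<^sup>2 / (8 * \<gamma>) * q \<le> \<mu> / 8 * 1"
    using sq_div_le pos q by (intro mult_mono) auto
  then have "op_bounded d (H - mhs x) (\<mu> / 8)"
    using H(2) by (auto elim: op_bounded_mono)
  from coercive_perturb[OF mean_mat_carrier sym_mats_carrier[OF H(1)] mhs_coercive[OF x] this]
  show ?thesis by (simp add: field_simps)
qed

text \<open>One step gains the factor \<open>3/4\<close>. With \<open>s = \<mu> q / \<sigma>\<close>, the remainder of the gradient expansion and the error
  of \<open>H\<close> contribute \<open>3/28 s\<close> and the quantized direction contributes \<open>s/16\<close>, against the target
  \<open>3/16 s\<close>.\<close>

lemma newton_step:
  assumes x: "x \<in> carrier_vec d" "vnorm (x - xstar) \<le> \<mu> / (4 * \<sigma>) * q"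
    and H: "H \<in> sym_mats d" "op_bounded d (H - mhs x) (\<mu>\<^sup>2 / (8 * \<gamma>) * q)"
    and v: "v \<in> carrier_vec d" "vnorm (v - newton_dir H (mgr x)) \<le> \<mu> / (16 * \<sigma>) * q"
    and q: "0 \<le> q" "q \<le> 1"
  shows "vnorm (x - v - xstar) \<le> \<mu> / (4 * \<sigma>) * (3/4 * q)"
proof -
  let ?e = "x - xstar" and ?u = "newton_dir H (mgr x)"
  define s where "s = \<mu> / \<sigma> * q"
  have e: "?e \<in> carrier_vec d" using x by simp
  note Hc = sym_mats_carrier[OF H(1)]
  note co = estimate_coercive[OF x(1) H q]
  have m: "0 < 7 * \<mu> / 8" using pos by simp
  have u: "?u \<in> carrier_vec d" by (rule newton_dir_solves(1)[OF Hc co m mean_vec_carrier])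
  have He: "H *\<^sub>v ?e \<in> carrier_vec d" "mhs x *\<^sub>v ?e \<in> carrier_vec d"
    using mult_mat_vec_carrier[OF Hc e] mult_mat_vec_carrier[OF mean_mat_carrier e] by auto
  have s: "0 \<le> s" using pos q by (simp add: s_def)
  have es: "vnorm ?e \<le> s / 4" using x(2) by (simp add: s_def)
  have \<sigma>s: "\<sigma> * s \<le> \<mu>" using pos q by (simp add: s_def mult_left_le)
  have acc: "\<mu>\<^sup>2 / (8 * \<gamma>) * q \<le> \<mu> / 8"
    using sq_div_le pos q mult_mono[of "\<mu>\<^sup>2 / (8 * \<gamma>)" "\<mu> / 8" q 1] by simp
  have "7 * \<mu> / 8 * vnorm (?u - ?e) \<le> vnorm (mgr x - H *\<^sub>v ?e)"
    by (rule newton_dir_approx[OF Hc co m mean_vec_carrier e])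
  also have "\<dots> \<le> vnorm (mgr x - mhs x *\<^sub>v ?e) + vnorm (mhs x *\<^sub>v ?e - H *\<^sub>v ?e)"
    by (rule vnorm_triangle[OF mean_vec_carrier He(2,1)])
  also have "mhs x *\<^sub>v ?e - H *\<^sub>v ?e = (mhs x - H) *\<^sub>v ?e"
    by (rule minus_mult_distrib_mat_vec[OF mean_mat_carrier Hc e, symmetric])
  also have "vnorm ((mhs x - H) *\<^sub>v ?e) \<le> \<mu> / 8 * vnorm ?e"
    using op_bounded_mono[OF op_bounded_commute[OF Hc mean_mat_carrier H(2)] acc] e
    by (simp add: op_bounded_def)
  also have "\<mu> / 8 * vnorm ?e \<le> \<mu> / 8 * (s / 4)"
    using es pos by (intro mult_left_mono) auto
  also have "vnorm (mgr x - mhs x *\<^sub>v ?e) \<le> \<sigma> * (vnorm ?e)\<^sup>2"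
    by (rule mean_gradient_difference[OF x(1)])
  also have "\<sigma> * (vnorm ?e)\<^sup>2 \<le> \<sigma> * (s / 4)\<^sup>2"
    using es pos by (intro mult_left_mono power_mono) auto
  also have "\<sigma> * (s / 4)\<^sup>2 = (\<sigma> * s) * (s / 16)" by (simp add: power2_eq_square)
  also have "\<dots> \<le> \<mu> * (s / 16)" using \<sigma>s s by (intro mult_right_mono) auto
  finally have "\<mu> * (7 * vnorm (?u - ?e)) \<le> \<mu> * (3 / 4 * s)" by (simp add: algebra_simps)
  then have "7 * vnorm (?u - ?e) \<le> 3 / 4 * s" using pos by (simp only: mult_le_cancel_left_pos)
  moreover have "vnorm (v - ?e) \<le> vnorm (v - ?u) + vnorm (?u - ?e)"
    by (rule vnorm_triangle[OF v(1) u e])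
  moreover have "vnorm (v - ?u) \<le> s / 16" using v(2) by (simp add: s_def)
  moreover have "vnorm (x - v - xstar) = vnorm (v - ?e)"
  proof -
    have "x - v - xstar = ?e - v"
      by (rule vec_minus_right_commute[OF x(1) v(1) xstar])
    then show ?thesis using vnorm_minus_commute[OF e v(1)] by simp
  qed
  ultimately have "vnorm (x - v - xstar) \<le> 3 / 16 * s" using s by linarith
  then show ?thesis by (simp add: s_def)
qed

section \<open>The invariant and the existence of runs\<close>

text \<open>The state after a round with \<open>q = (3/4) ^ t\<close>. In the notation of the algorithm the bounds are
  \<open>G / (2 \<kappa>)\<close> and \<open>G / \<kappa>\<close> for Hessians, and \<open>\<theta> P / 2\<close> and \<open>\<theta> P\<close> for directions.\<close>

definition tracks ::
    "real vec \<Rightarrow> (nat \<Rightarrow> real mat) \<Rightarrow> real mat \<Rightarrow> (nat \<Rightarrow> real vec) \<Rightarrow> real vec \<Rightarrow> real \<Rightarrow> bool" where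
  "tracks x Hi H vi v q \<longleftrightarrow>
     x \<in> carrier_vec d \<and> vnorm (x - xstar) \<le> \<mu> / (4 * \<sigma>) * q \<and>
     (\<forall>i<n. Hi i \<in> sym_mats d \<and> op_bounded d (Hi i - hs i x) (\<mu>\<^sup>2 / (16 * \<gamma>) * q)) \<and>
     H \<in> sym_mats d \<and> op_bounded d (H - mhs x) (\<mu>\<^sup>2 / (8 * \<gamma>) * q) \<and>
     (\<forall>i<n. vi i \<in> carrier_vec d \<and> vnorm (vi i - newton_dir H (gr i x)) \<le> \<mu> / (32 * \<sigma>) * q) \<and>
     v \<in> carrier_vec d \<and> vnorm (v - newton_dir H (mgr x)) \<le> \<mu> / (16 * \<sigma>) * q"

lemma initial_hessians:
  assumes Hi: "\<And>i. i < n \<Longrightarrow> Hi i = quantize_mat Q d (hs i x0) (hs i0 x0)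
      (hess_up_rad d \<gamma> \<mu> (1/2) 0) (hess_res \<gamma> \<mu> (1/2) 0)"
  shows "i < n \<Longrightarrow> Hi i \<in> sym_mats d" "i < n \<Longrightarrow> op_bounded d (Hi i - hs i x0) (\<mu>\<^sup>2 / (16 * \<gamma>))"
    and "mean_mat d n Hi \<in> sym_mats d" "op_bounded d (mean_mat d n Hi - mhs x0) (\<mu>\<^sup>2 / (16 * \<gamma>))"
proof -
  note res = hess_res_half[OF pos(4,5), where t = 0]
  have y: "0 < hess_up_rad d \<gamma> \<mu> (1/2) 0" using pos by (simp add: hess_rad_half)
  have r: "0 \<le> 2 * \<gamma>" "sqrt (real d) * (2 * \<gamma>) \<le> hess_up_rad d \<gamma> \<mu> (1/2) 0"
    using pos by (simp_all add: hess_rad_half)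
  note up = quantized_hessians[OF x0 res(1) y r hs_sym[OF pos(3) x0] hs_node_diff[OF _ pos(3) x0] Hi]
  show "i < n \<Longrightarrow> Hi i \<in> sym_mats d" "i < n \<Longrightarrow> op_bounded d (Hi i - hs i x0) (\<mu>\<^sup>2 / (16 * \<gamma>))"
    "mean_mat d n Hi \<in> sym_mats d" "op_bounded d (mean_mat d n Hi - mhs x0) (\<mu>\<^sup>2 / (16 * \<gamma>))"
    using up res(2) by auto
qed

text \<open>The last claim is the agreement of the nodes: the quantized average is within the radius of every local
  Hessian, so the decoded value does not depend on the node.\<close>

lemma initial_mean_hessian:
  assumes Hi: "\<And>i. i < n \<Longrightarrow> Hi i = quantize_mat Q d (hs i x0) (hs i0 x0)
      (hess_up_rad d \<gamma> \<mu> (1/2) 0) (hess_res \<gamma> \<mu> (1/2) 0)"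
    and j: "j < n"
    and H: "H = quantize_mat Q d (mean_mat d n Hi) (hs j x0)
      (hess_down_rad d \<gamma> \<mu> (1/2) 0) (hess_res \<gamma> \<mu> (1/2) 0)"
  shows "H \<in> sym_mats d" "op_bounded d (H - mhs x0) (\<mu>\<^sup>2 / (8 * \<gamma>))"
    and "k < n \<Longrightarrow> H = quantize_mat Q d (mean_mat d n Hi) (hs k x0)
      (hess_down_rad d \<gamma> \<mu> (1/2) 0) (hess_res \<gamma> \<mu> (1/2) 0)"
proof -
  note res = hess_res_half[OF pos(4,5), where t = 0]
  note I = initial_hessians[OF Hi, simplified]
  have acc: "0 < \<mu>\<^sup>2 / (16 * \<gamma>)" using pos by simp
  have y: "0 < hess_down_rad d \<gamma> \<mu> (1/2) 0"
    using pos acc by (simp add: hess_rad_half add_pos_pos)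
  have r: "0 \<le> 2 * \<gamma>"
    "sqrt (real d) * (sqrt 2 * hess_res \<gamma> \<mu> (1/2) 0 + 2 * \<gamma>) \<le> hess_down_rad d \<gamma> \<mu> (1/2) 0"
    using pos res(2) by (simp_all add: hess_rad_half)
  have S: "op_bounded d (mean_mat d n Hi - mhs x0) (sqrt 2 * hess_res \<gamma> \<mu> (1/2) 0)"
    using I(4) res(2) by simp
  note down = quantized_mean_hessian[OF x0 res(1) y r I(3) S hs_sym[OF j x0] mhs_node_diff[OF j x0] H]
  show "H \<in> sym_mats d" by (rule down(1))
  show "op_bounded d (H - mhs x0) (\<mu>\<^sup>2 / (8 * \<gamma>))" using down(2) res(2) by simp
  show "H = quantize_mat Q d (mean_mat d n Hi) (hs k x0)
      (hess_down_rad d \<gamma> \<mu> (1/2) 0) (hess_res \<gamma> \<mu> (1/2) 0)" if k: "k < n"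
    unfolding H
  proof (rule quantize_mat_reference_irrelevant[OF quant pos(1) y res(1) _ I(3)])
    have "op_bounded d (mean_mat d n Hi - hs i x0) (sqrt 2 * hess_res \<gamma> \<mu> (1/2) 0 + 2 * \<gamma>)"
      if "i < n" for i
      by (rule op_bounded_triangle[OF mean_mat_carrier mean_mat_carrier hs_carrier[OF that x0]
            S mhs_node_diff[OF that x0]])
    then show "op_bounded d (mean_mat d n Hi - hs j x0) (sqrt 2 * hess_res \<gamma> \<mu> (1/2) 0 + 2 * \<gamma>)"
      "op_bounded d (mean_mat d n Hi - hs k x0) (sqrt 2 * hess_res \<gamma> \<mu> (1/2) 0 + 2 * \<gamma>)"
      using j k by auto
    show "0 \<le> sqrt 2 * hess_res \<gamma> \<mu> (1/2) 0 + 2 * \<gamma>" using res(1) r(1) by simp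
  qed (use j k r(2) in auto)
qed

text \<open>Stability of Newton directions with the same matrix on both sides. The two gradients are only known to be
  small, both being evaluated at \<open>x0\<close>, close to all minimizers.\<close>

lemma initial_direction_spread:
  assumes H: "H \<in> carrier_mat d d" "coercive d H (7 * \<mu> / 8)"
    and g: "g \<in> carrier_vec d" "vnorm g \<le> \<gamma> * (\<mu> / (4 * \<sigma>))"
    and g': "g' \<in> carrier_vec d" "vnorm g' \<le> \<gamma> * (\<mu> / (4 * \<sigma>))"
  shows "vnorm (newton_dir H g - newton_dir H g') \<le> 4 * \<gamma> / \<sigma>"
proof -
  have m: "0 < 7 * \<mu> / 8" using pos by simp
  \<comment> \<open>the zero matrix, so only the gradients contribute to the change\<close>
  have "op_bounded d (H - H) 0"
    unfolding op_bounded_def using H(1) minus_mult_distrib_mat_vec[OF H(1) H(1)]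
    by (auto simp: mult_mat_vec_carrier[OF H(1), THEN minus_cancel_vec])
  from newton_dir_change[OF H H m g'(1) g(1) this]
  have "7 * \<mu> / 8 * vnorm (newton_dir H g - newton_dir H g') \<le> vnorm (g - g')" by simp
  also have "\<dots> \<le> 2 * (\<gamma> * (\<mu> / (4 * \<sigma>)))"
    using vnorm_minus_le[OF g(1) g'(1)] g(2) g'(2) by simp
  also have "\<dots> \<le> 7 * \<mu> / 8 * (4 * \<gamma> / \<sigma>)"
    using pos by (simp add: field_simps)
  finally show ?thesis using m by (simp only: mult_le_cancel_left_pos)
qed

lemma initial_gradient_le:
  shows "i < n \<Longrightarrow> vnorm (gr i x0) \<le> \<gamma> * (\<mu> / (4 * \<sigma>))" "vnorm (mgr x0) \<le> \<gamma> * (\<mu> / (4 * \<sigma>))"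
  using gr_le[OF _ x0, where r = 0] mgr_le[OF x0, where r = 0] by (auto simp: minus_cancel_vec[OF x0])

text \<open>As for the Hessians, the last claim is the agreement of the nodes.\<close>

lemma initial_directions:
  assumes H: "H \<in> sym_mats d" "coercive d H (7 * \<mu> / 8)"
    and vi: "\<And>i. i < n \<Longrightarrow> vi i = Q d (newton_dir H (gr i x0)) (newton_dir H (gr i0 x0))
      (dir_up_rad \<gamma> \<mu> \<sigma> (1/2) 0) (dir_res \<mu> \<sigma> (1/2) 0)"
    and j: "j < n"
    and v: "v = Q d (mean_vec d n vi) (newton_dir H (gr j x0))
      (dir_down_rad \<gamma> \<mu> \<sigma> (1/2) 0) (dir_res \<mu> \<sigma> (1/2) 0)"
  shows "i < n \<Longrightarrow> vi i \<in> carrier_vec d"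
    and "i < n \<Longrightarrow> vnorm (vi i - newton_dir H (gr i x0)) \<le> \<mu> / (32 * \<sigma>)"
    and "v \<in> carrier_vec d" "vnorm (v - newton_dir H (mgr x0)) \<le> \<mu> / (16 * \<sigma>)"
    and "k < n \<Longrightarrow> v = Q d (mean_vec d n vi) (newton_dir H (gr k x0))
      (dir_down_rad \<gamma> \<mu> \<sigma> (1/2) 0) (dir_res \<mu> \<sigma> (1/2) 0)"
proof -
  note Hc = sym_mats_carrier[OF H(1)]
  have m: "0 < 7 * \<mu> / 8" using pos by simp
  note half = dir_half[OF pos(4-6)]
  have res: "0 < dir_res \<mu> \<sigma> (1/2) 0" and yu: "0 < dir_up_rad \<gamma> \<mu> \<sigma> (1/2) 0"
    and yd: "0 < dir_down_rad \<gamma> \<mu> \<sigma> (1/2) 0"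
    using pos by (auto simp: half intro: add_pos_pos)
  have c: "newton_dir H (gr i x0) \<in> carrier_vec d" if "i < n" for i
    by (rule newton_dir_solves(1)[OF Hc H(2) m gr_carrier[OF that x0]])
  have cm: "newton_dir H (mgr x0) \<in> carrier_vec d"
    by (rule newton_dir_solves(1)[OF Hc H(2) m mean_vec_carrier])
  have up: "vnorm (newton_dir H (gr i x0) - newton_dir H (gr i0 x0)) \<le> dir_up_rad \<gamma> \<mu> \<sigma> (1/2) 0"
    if "i < n" for i
    unfolding half using that pos(3) initial_gradient_le(1)
    by (intro initial_direction_spread[OF Hc H(2)]) auto
  have U: "vi i \<in> carrier_vec d" "vnorm (vi i - newton_dir H (gr i x0)) \<le> dir_res \<mu> \<sigma> (1/2) 0"
    if "i < n" for i
    by (rule quantized_directions(1,2)[OF Hc H(2) m x0 res yu c[OF pos(3)] up vi that]; assumption)+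
  have U3: "vnorm (mean_vec d n vi - newton_dir H (mgr x0)) \<le> dir_res \<mu> \<sigma> (1/2) 0"
    by (rule quantized_directions(3)[OF Hc H(2) m x0 res yu c[OF pos(3)] up vi])
  have spread: "vnorm (newton_dir H (mgr x0) - newton_dir H (gr i x0)) \<le> 4 * \<gamma> / \<sigma>" if "i < n" for i
    using that initial_gradient_le by (intro initial_direction_spread[OF Hc H(2)]) auto
  have r: "dir_res \<mu> \<sigma> (1/2) 0 + 4 * \<gamma> / \<sigma> \<le> dir_down_rad \<gamma> \<mu> \<sigma> (1/2) 0"
    by (simp add: half)
  note D = quantized_mean_direction[OF Hc H(2) m x0 res yd r mean_vec_carrier U3 c[OF j] spread[OF j] v]
  show "i < n \<Longrightarrow> vi i \<in> carrier_vec d"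
    "i < n \<Longrightarrow> vnorm (vi i - newton_dir H (gr i x0)) \<le> \<mu> / (32 * \<sigma>)"
    "v \<in> carrier_vec d" "vnorm (v - newton_dir H (mgr x0)) \<le> \<mu> / (16 * \<sigma>)"
    using U D by (auto simp: half)
  have near: "vnorm (mean_vec d n vi - newton_dir H (gr i x0)) \<le> dir_down_rad \<gamma> \<mu> \<sigma> (1/2) 0"
    if "i < n" for i
    using vnorm_triangle[OF mean_vec_carrier[of d n vi] cm c[OF that]] U3 spread[OF that] r by linarith
  show "v = Q d (mean_vec d n vi) (newton_dir H (gr k x0))
      (dir_down_rad \<gamma> \<mu> \<sigma> (1/2) 0) (dir_res \<mu> \<sigma> (1/2) 0)" if "k < n"
    unfolding v
    by (rule quantization_reference_irrelevant[OF quant pos(1) yd res mean_vec_carrier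
          c[OF j] near[OF j] c[OF that] near[OF that]])
qed

lemma tracks_initial:
  assumes Hi: "\<And>i. i < n \<Longrightarrow> Hi i = quantize_mat Q d (hs i x0) (hs i0 x0)
      (hess_up_rad d \<gamma> \<mu> (1/2) 0) (hess_res \<gamma> \<mu> (1/2) 0)"
    and H: "H = quantize_mat Q d (mean_mat d n Hi) (hs i0 x0)
      (hess_down_rad d \<gamma> \<mu> (1/2) 0) (hess_res \<gamma> \<mu> (1/2) 0)"
    and vi: "\<And>i. i < n \<Longrightarrow> vi i = Q d (newton_dir H (gr i x0)) (newton_dir H (gr i0 x0))
      (dir_up_rad \<gamma> \<mu> \<sigma> (1/2) 0) (dir_res \<mu> \<sigma> (1/2) 0)"
    and v: "v = Q d (mean_vec d n vi) (newton_dir H (gr i0 x0))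
      (dir_down_rad \<gamma> \<mu> \<sigma> (1/2) 0) (dir_res \<mu> \<sigma> (1/2) 0)"
  shows "tracks x0 Hi H vi v 1" "coercive d H (7 * \<mu> / 8)"
proof -
  note I = initial_hessians[OF Hi, simplified]
  note M = initial_mean_hessian[OF Hi pos(3) H, simplified]
  show co: "coercive d H (7 * \<mu> / 8)"
    using M(2) by (intro estimate_coercive[OF x0 M(1), where q = 1]) auto
  note D = initial_directions[OF M(1) co vi pos(3) v, simplified]
  show "tracks x0 Hi H vi v 1"
    unfolding tracks_def using I M D close_mean[OF pos(3)] by simp
qed

text \<open>The errors of the new messages are given by the resolutions; what has to be shown is that every
  reference lies within its radius. Each such distance is split into the change of the target since the last
  round and the error of the last message.\<close>

lemma tracks_step:
  assumes T: "tracks x Hi H vi v q" and q: "q = (3/4) ^ t" and x': "x' = x - v"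
    and Hi': "\<And>i. i < n \<Longrightarrow> Hi' i = quantize_mat Q d (hs i x') (Hi i)
      (hess_up_rad d \<gamma> \<mu> (1/2) (Suc t)) (hess_res \<gamma> \<mu> (1/2) (Suc t))"
    and H': "H' = quantize_mat Q d (mean_mat d n Hi') H
      (hess_down_rad d \<gamma> \<mu> (1/2) (Suc t)) (hess_res \<gamma> \<mu> (1/2) (Suc t))"
    and vi': "\<And>i. i < n \<Longrightarrow> vi' i = Q d (newton_dir H' (gr i x')) (vi i)
      (dir_up_rad \<gamma> \<mu> \<sigma> (1/2) (Suc t)) (dir_res \<mu> \<sigma> (1/2) (Suc t))"
    and v': "v' = Q d (mean_vec d n vi') v
      (dir_down_rad \<gamma> \<mu> \<sigma> (1/2) (Suc t)) (dir_res \<mu> \<sigma> (1/2) (Suc t))"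
  shows "tracks x' Hi' H' vi' v' ((3/4) ^ Suc t)"
proof -
  have q01: "0 < q" "0 \<le> q" "q \<le> 1" by (auto simp: q power_le_one)
  have qS: "(3/4) ^ Suc t = 3/4 * q" by (simp add: q)
  have qS1: "0 \<le> 3/4 * q" "3/4 * q \<le> 1" using q01 by auto
  have hp: "hess_up_rad d \<gamma> \<mu> (1/2) (Suc t) = sqrt (real d) * (5/8 * \<mu> * q)"
    "hess_down_rad d \<gamma> \<mu> (1/2) (Suc t) =
      sqrt (real d) * (\<mu>\<^sup>2 / (16 * \<gamma>) * (3/4 * q) + 5/8 * \<mu> * q)"
    using hess_rad_half(2,4)[OF pos(4,5), where t = t and d = d] unfolding qS q[symmetric] by auto
  note hr = hess_res_half[OF pos(4,5), where t = "Suc t", unfolded qS]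
  have dh: "dir_up_rad \<gamma> \<mu> \<sigma> (1/2) (Suc t) = 11 * \<gamma> / \<sigma> * (3/4 * q)"
    "dir_down_rad \<gamma> \<mu> \<sigma> (1/2) (Suc t) = \<mu> / (32 * \<sigma>) * (3/4 * q) + 11 * \<gamma> / \<sigma> * (3/4 * q)"
    using dir_half(3,5)[OF pos(4-6), where t = t] unfolding qS by auto
  have dr: "dir_res \<mu> \<sigma> (1/2) (Suc t) = \<mu> / (32 * \<sigma>) * (3/4 * q)"
    using dir_half(1)[OF pos(4-6), where t = "Suc t", unfolded qS] .
  have x: "x \<in> carrier_vec d" "vnorm (x - xstar) \<le> \<mu> / (4 * \<sigma>) * q"
    and Hi: "\<And>i. i < n \<Longrightarrow> Hi i \<in> sym_mats d"
      "\<And>i. i < n \<Longrightarrow> op_bounded d (Hi i - hs i x) (\<mu>\<^sup>2 / (16 * \<gamma>) * q)"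
    and H: "H \<in> sym_mats d" "op_bounded d (H - mhs x) (\<mu>\<^sup>2 / (8 * \<gamma>) * q)"
    and vi: "\<And>i. i < n \<Longrightarrow> vi i \<in> carrier_vec d"
      "\<And>i. i < n \<Longrightarrow> vnorm (vi i - newton_dir H (gr i x)) \<le> \<mu> / (32 * \<sigma>) * q"
    and v: "v \<in> carrier_vec d" "vnorm (v - newton_dir H (mgr x)) \<le> \<mu> / (16 * \<sigma>) * q"
    using T unfolding tracks_def by auto
  define dx where "dx = vnorm (x' - x)"
  have x'c: "x' \<in> carrier_vec d" using x v by (simp add: x')
  have x'e: "vnorm (x' - xstar) \<le> \<mu> / (4 * \<sigma>) * (3/4 * q)"
    unfolding x' by (rule newton_step[OF x H v q01(2,3)])
  have "dx \<le> \<mu> / (4 * \<sigma>) * (3/4 * q) + \<mu> / (4 * \<sigma>) * q"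
    using vnorm_triangle[OF x'c xstar x(1)] vnorm_minus_commute[OF xstar x(1)] x'e x(2)
    unfolding dx_def by linarith
  then have dx: "\<sigma> * dx \<le> 7/16 * (\<mu> * q)"
    using pos by (simp add: field_simps)
  have acc: "\<mu>\<^sup>2 / (8 * \<gamma>) * q \<le> 1/8 * (\<mu> * q)" "\<mu>\<^sup>2 / (16 * \<gamma>) * q \<le> 1/16 * (\<mu> * q)"
    using mult_right_mono[OF sq_div_le q01(2)] by simp_all

  have mp: "7/16 * (\<mu> * q) + 1/16 * (\<mu> * q) \<le> 5/8 * \<mu> * q"
    "7/16 * (\<mu> * q) + 1/8 * (\<mu> * q) \<le> 5/8 * \<mu> * q"
    using pos q01 by simp_all
  \<comment> \<open>references for the Hessian messages: slack remains, as 7/16 + 1/8 < 5/8\<close>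
  have up: "op_bounded d (hs i x' - Hi i) (5/8 * \<mu> * q)" if i: "i < n" for i
  proof (rule op_bounded_mono)
    show "op_bounded d (hs i x' - Hi i) (\<sigma> * dx + \<mu>\<^sup>2 / (16 * \<gamma>) * q)"
      unfolding dx_def
      by (rule op_bounded_triangle[OF hs_carrier[OF i x'c] hs_carrier[OF i x(1)]
            sym_mats_carrier[OF Hi(1)[OF i]] hs_lipschitz[OF i x'c x(1)]
            op_bounded_commute[OF sym_mats_carrier[OF Hi(1)[OF i]] hs_carrier[OF i x(1)] Hi(2)[OF i]]])
    show "\<sigma> * dx + \<mu>\<^sup>2 / (16 * \<gamma>) * q \<le> 5/8 * \<mu> * q"
      using add_mono[OF dx acc(2)] mp by linarith
  qed
  have down: "op_bounded d (mhs x' - H) (5/8 * \<mu> * q)"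
  proof (rule op_bounded_mono)
    show "op_bounded d (mhs x' - H) (\<sigma> * dx + \<mu>\<^sup>2 / (8 * \<gamma>) * q)"
      unfolding dx_def
      by (rule op_bounded_triangle[OF mean_mat_carrier mean_mat_carrier sym_mats_carrier[OF H(1)]
            mhs_lipschitz[OF x'c x(1)]
            op_bounded_commute[OF sym_mats_carrier[OF H(1)] mean_mat_carrier H(2)]])
    show "\<sigma> * dx + \<mu>\<^sup>2 / (8 * \<gamma>) * q \<le> 5/8 * \<mu> * q"
      using add_mono[OF dx acc(1)] mp by linarith
  qed
  have r: "0 \<le> 5/8 * \<mu> * q" using pos q01 by simp
  have yu: "0 < hess_up_rad d \<gamma> \<mu> (1/2) (Suc t)" using pos q01 by (simp add: hp)
  have yd: "0 < hess_down_rad d \<gamma> \<mu> (1/2) (Suc t)"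
    using pos q01 by (simp add: hp add_pos_pos)
  have ru: "sqrt (real d) * (5/8 * \<mu> * q) \<le> hess_up_rad d \<gamma> \<mu> (1/2) (Suc t)" by (simp add: hp)
  have rd: "sqrt (real d) * (sqrt 2 * hess_res \<gamma> \<mu> (1/2) (Suc t) + 5/8 * \<mu> * q)
      \<le> hess_down_rad d \<gamma> \<mu> (1/2) (Suc t)"
    unfolding hr(2) hp by simp
  have A: "Hi' i \<in> sym_mats d" "op_bounded d (Hi' i - hs i x') (sqrt 2 * hess_res \<gamma> \<mu> (1/2) (Suc t))"
    if "i < n" for i
    by (rule quantized_hessians(1,2)[OF x'c hr(1) yu r ru Hi(1) up Hi' that]; assumption)+
  have S: "mean_mat d n Hi' \<in> sym_mats d"
    "op_bounded d (mean_mat d n Hi' - mhs x') (sqrt 2 * hess_res \<gamma> \<mu> (1/2) (Suc t))"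
    by (rule quantized_hessians(3,4)[OF x'c hr(1) yu r ru Hi(1) up Hi']; assumption)+
  note B = quantized_mean_hessian[OF x'c hr(1) yd r rd S H(1) down H', unfolded hr(2)]
  have H'e: "op_bounded d (H' - mhs x') (\<mu>\<^sup>2 / (8 * \<gamma>) * (3/4 * q))"
    using B(2) by (simp add: mult_ac)

  have m: "0 < 7 * \<mu> / 8" using pos by simp
  note Hc = sym_mats_carrier[OF H(1)] and H'c = sym_mats_carrier[OF B(1)]
  note co = estimate_coercive[OF x(1) H q01(2,3)]
    and co' = estimate_coercive[OF x'c B(1) H'e qS1]
  \<comment> \<open>total change of the decoded Hessian: 1/8 + 7/16 + 3/32 = 21/32\<close>
  have HH: "op_bounded d (H - H') (21/32 * (\<mu> * q))"
  proof (rule op_bounded_mono)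
    have "op_bounded d (H - mhs x') (\<mu>\<^sup>2 / (8 * \<gamma>) * q + \<sigma> * dx)"
      unfolding dx_def
      by (rule op_bounded_triangle[OF Hc mean_mat_carrier mean_mat_carrier H(2)
            op_bounded_commute[OF mean_mat_carrier mean_mat_carrier mhs_lipschitz[OF x'c x(1)]]])
    then show "op_bounded d (H - H') (\<mu>\<^sup>2 / (8 * \<gamma>) * q + \<sigma> * dx + \<mu>\<^sup>2 / (8 * \<gamma>) * (3/4 * q))"
      by (rule op_bounded_triangle[OF Hc mean_mat_carrier H'c _
            op_bounded_commute[OF H'c mean_mat_carrier H'e]])
    show "\<mu>\<^sup>2 / (8 * \<gamma>) * q + \<sigma> * dx + \<mu>\<^sup>2 / (8 * \<gamma>) * (3/4 * q) \<le> 21/32 * (\<mu> * q)"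
    proof -
      have "\<mu>\<^sup>2 / (8 * \<gamma>) * (3/4 * q) = 3/4 * (\<mu>\<^sup>2 / (8 * \<gamma>) * q)" by (rule mult.left_commute)
      also have "\<dots> \<le> 3/4 * (1/8 * (\<mu> * q))" by (rule mult_left_mono[OF acc(1)]) simp
      finally have "\<mu>\<^sup>2 / (8 * \<gamma>) * q + \<sigma> * dx + \<mu>\<^sup>2 / (8 * \<gamma>) * (3/4 * q) \<le>
          1/8 * (\<mu> * q) + 7/16 * (\<mu> * q) + 3/4 * (1/8 * (\<mu> * q))"
        by (intro add_mono acc(1) dx)
      also have "\<dots> = 21/32 * (\<mu> * q)" by simp
      finally show ?thesis .
    qed
  qed
  define w where "w = \<gamma> / \<sigma> * q"
  have w: "0 \<le> w" "\<mu> / \<sigma> * q \<le> w"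
    using pos q01 mu_le_gamma unfolding w_def by (auto intro!: mult_right_mono divide_right_mono)
  \<comment> \<open>common to the local gradients and their mean: 7/16 + 21/32 * 6/7 = 1, divided by 7/8\<close>
  have change: "vnorm (newton_dir H' g' - newton_dir H g) \<le> 8/7 * w"
    if g: "g \<in> carrier_vec d" "vnorm g \<le> \<gamma> * (\<mu> / (2 * \<sigma>) + \<mu> / (4 * \<sigma>))"
      and g': "g' \<in> carrier_vec d" "vnorm (g' - g) \<le> \<gamma> * dx" for g g'
  proof -
    have "7 * \<mu> / 8 * vnorm (newton_dir H' g' - newton_dir H g) \<le>
        vnorm (g' - g) + 21/32 * (\<mu> * q) * (vnorm g / (7 * \<mu> / 8))"
      using pos q01 by (intro newton_dir_change[OF Hc co H'c co' m g(1) g'(1) HH]) simp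
    also have "\<dots> \<le> \<mu> * (7/16 * w) + 21/32 * (\<mu> * q) * (6/7 * (\<gamma> / \<sigma>))"
    proof (intro add_mono mult_left_mono)
      have "\<gamma> * dx \<le> \<gamma> / \<sigma> * (7/16 * (\<mu> * q))"
        using mult_left_mono[OF dx, of "\<gamma> / \<sigma>"] pos by simp
      also have "\<dots> = \<mu> * (7/16 * w)" by (simp add: w_def mult_ac)
      finally show "vnorm (g' - g) \<le> \<mu> * (7/16 * w)" using g'(2) by simp
      show "vnorm g / (7 * \<mu> / 8) \<le> 6/7 * (\<gamma> / \<sigma>)"
        using g(2) pos by (simp add: field_simps)
    qed (use pos q01 in simp)
    also have "\<dots> = 7 * \<mu> / 8 * (8/7 * w)" using pos by (simp add: w_def field_simps)
    finally show ?thesis using m by (simp only: mult_le_cancel_left_pos)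
  qed
  have xx0: "vnorm (x - x0) \<le> \<mu> / (2 * \<sigma>)"
  proof -
    have "vnorm (x - x0) \<le> \<mu> / (4 * \<sigma>) * q + \<mu> / (4 * \<sigma>)"
      using vnorm_triangle[OF x(1) xstar x0] vnorm_minus_commute[OF xstar x0] x(2)
        close_mean[OF pos(3)] by linarith
    also have "\<dots> \<le> \<mu> / (4 * \<sigma>) * 1 + \<mu> / (4 * \<sigma>)"
      using pos q01 by (intro add_mono mult_left_mono) auto
    finally show ?thesis by simp
  qed
  have c: "newton_dir H (gr i x) \<in> carrier_vec d" "newton_dir H' (gr i x') \<in> carrier_vec d"
    if "i < n" for i
    using newton_dir_solves(1)[OF Hc co m] newton_dir_solves(1)[OF H'c co' m] that x x'c by auto
  have cm: "newton_dir H (mgr x) \<in> carrier_vec d" "newton_dir H' (mgr x') \<in> carrier_vec d"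
    using newton_dir_solves(1)[OF Hc co m] newton_dir_solves(1)[OF H'c co' m] by auto
  \<comment> \<open>references for the direction messages: 33/4 = 11 * 3/4, against a distance of 8/7 + 1/32\<close>
  have dup: "vnorm (newton_dir H' (gr i x') - vi i) \<le> dir_up_rad \<gamma> \<mu> \<sigma> (1/2) (Suc t)" if i: "i < n" for i
  proof -
    have "vnorm (newton_dir H' (gr i x') - newton_dir H (gr i x)) \<le> 8/7 * w"
      using regular_function.gr_lipschitz[OF node[OF i] x'c x(1)] gr_le[OF i x(1) xx0] i x x'c
      by (intro change) (auto simp: dx_def)
    then have "vnorm (newton_dir H' (gr i x') - vi i) \<le> 8/7 * w + \<mu> / (32 * \<sigma>) * q"
      using vnorm_triangle[OF c(2)[OF i] c(1)[OF i] vi(1)[OF i]]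
        vnorm_minus_commute[OF c(1)[OF i] vi(1)[OF i]] vi(2)[OF i] by linarith
    also have "\<mu> / (32 * \<sigma>) * q \<le> w / 32" using w(2) by simp
    also have "8/7 * w + w / 32 \<le> 33/4 * w" using w(1) by simp
    also have "33/4 * w = dir_up_rad \<gamma> \<mu> \<sigma> (1/2) (Suc t)" by (simp add: dh w_def)
    finally show ?thesis by simp
  qed
  have ddown: "vnorm (newton_dir H' (mgr x') - v) \<le> 33/4 * w"
  proof -
    have "vnorm (newton_dir H' (mgr x') - newton_dir H (mgr x)) \<le> 8/7 * w"
      using mgr_lipschitz[OF x'c x(1)] mgr_le[OF x(1) xx0]
      by (intro change) (auto simp: dx_def)
    then have "vnorm (newton_dir H' (mgr x') - v) \<le> 8/7 * w + \<mu> / (16 * \<sigma>) * q"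
      using vnorm_triangle[OF cm(2,1) v(1)] vnorm_minus_commute[OF cm(1) v(1)] v(2) by linarith
    also have "\<mu> / (16 * \<sigma>) * q \<le> w / 16" using w(2) by simp
    also have "8/7 * w + w / 16 \<le> 33/4 * w" using w(1) by simp
    finally show ?thesis by simp
  qed
  have res: "0 < dir_res \<mu> \<sigma> (1/2) (Suc t)" using pos q01 by (simp add: dr)
  have yu2: "0 < dir_up_rad \<gamma> \<mu> \<sigma> (1/2) (Suc t)" using pos q01 by (simp add: dh)
  have yd2: "0 < dir_down_rad \<gamma> \<mu> \<sigma> (1/2) (Suc t)" using pos q01 by (simp add: dh add_pos_pos)
  have r2: "dir_res \<mu> \<sigma> (1/2) (Suc t) + 33/4 * w \<le> dir_down_rad \<gamma> \<mu> \<sigma> (1/2) (Suc t)"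
    by (simp add: dr dh w_def)
  have U: "vi' i \<in> carrier_vec d" "vnorm (vi' i - newton_dir H' (gr i x')) \<le> dir_res \<mu> \<sigma> (1/2) (Suc t)"
    if "i < n" for i
    by (rule quantized_directions(1,2)[OF H'c co' m x'c res yu2 vi(1) dup vi' that]; assumption)+
  have U3: "vnorm (mean_vec d n vi' - newton_dir H' (mgr x')) \<le> dir_res \<mu> \<sigma> (1/2) (Suc t)"
    by (rule quantized_directions(3)[OF H'c co' m x'c res yu2 vi(1) dup vi'])
  note D = quantized_mean_direction[OF H'c co' m x'c res yd2 r2 mean_vec_carrier U3 v(1) ddown v']
  show ?thesis
    unfolding tracks_def qS using x'c x'e A(1,2) B(1) H'e U(1,2) D
    by (simp add: hr(2) dr)
qed

lemma run_tracks:
  assumes run: "quantized_newton Q d n i0 gr hs \<gamma> \<mu> \<sigma> (1/2) x0 x Hi H vi v"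
  shows "tracks (x t) (Hi t) (H t) (vi t) (v t) ((3/4) ^ t)"
proof (induction t)
  case 0
  note R = run[unfolded quantized_newton_def]
  from R have x: "x 0 = x0" by (rule conjunct1)
  note R0 = R[THEN conjunct2, unfolded x]
  show ?case
    unfolding x power_0 by (rule tracks_initial(1); use R0 pos(3) in blast)
next
  case (Suc t)
  note R = run[unfolded quantized_newton_def, THEN conjunct2, THEN conjunct2, THEN conjunct2,
      THEN conjunct2, THEN conjunct2, THEN spec, of t]
  show ?case
    by (rule tracks_step[OF Suc refl]; use R in blast)
qed

text \<open>The estimates of the first round show that the nodes agree on \<open>H 0\<close> and \<open>v 0\<close>; the rest is
  primitive recursion on the state.\<close>

lemma run_exists:
  "\<exists>x Hi H vi v. quantized_newton Q d n i0 gr hs \<gamma> \<mu> \<sigma> (1/2) x0 x Hi H vi v"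
proof -
  define Hi0 where "Hi0 = (\<lambda>i. quantize_mat Q d (hs i x0) (hs i0 x0)
      (hess_up_rad d \<gamma> \<mu> (1/2) 0) (hess_res \<gamma> \<mu> (1/2) 0))"
  define H0 where "H0 = quantize_mat Q d (mean_mat d n Hi0) (hs i0 x0)
      (hess_down_rad d \<gamma> \<mu> (1/2) 0) (hess_res \<gamma> \<mu> (1/2) 0)"
  define vi0 where "vi0 = (\<lambda>i. Q d (newton_dir H0 (gr i x0)) (newton_dir H0 (gr i0 x0))
      (dir_up_rad \<gamma> \<mu> \<sigma> (1/2) 0) (dir_res \<mu> \<sigma> (1/2) 0))"
  define v0 where "v0 = Q d (mean_vec d n vi0) (newton_dir H0 (gr i0 x0))
      (dir_down_rad \<gamma> \<mu> \<sigma> (1/2) 0) (dir_res \<mu> \<sigma> (1/2) 0)"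
  have Hi0': "Hi0 i = quantize_mat Q d (hs i x0) (hs i0 x0)
      (hess_up_rad d \<gamma> \<mu> (1/2) 0) (hess_res \<gamma> \<mu> (1/2) 0)" for i by (simp add: Hi0_def)
  have vi0': "vi0 i = Q d (newton_dir H0 (gr i x0)) (newton_dir H0 (gr i0 x0))
      (dir_up_rad \<gamma> \<mu> \<sigma> (1/2) 0) (dir_res \<mu> \<sigma> (1/2) 0)" for i by (simp add: vi0_def)
  note M = initial_mean_hessian[OF Hi0' pos(3) H0_def]
  note co = tracks_initial(2)[OF Hi0' H0_def vi0' v0_def]
  note D = initial_directions(5)[OF M(1) co vi0' pos(3) v0_def]
  define step where "step = (\<lambda>t (x, Hi, H, vi, v).
    let x' = x - v;
        Hi' = (\<lambda>i. quantize_mat Q d (hs i x') (Hi i)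
          (hess_up_rad d \<gamma> \<mu> (1/2) (Suc t)) (hess_res \<gamma> \<mu> (1/2) (Suc t)));
        H' = quantize_mat Q d (mean_mat d n Hi') H
          (hess_down_rad d \<gamma> \<mu> (1/2) (Suc t)) (hess_res \<gamma> \<mu> (1/2) (Suc t));
        vi' = (\<lambda>i. Q d (newton_dir H' (gr i x')) (vi i)
          (dir_up_rad \<gamma> \<mu> \<sigma> (1/2) (Suc t)) (dir_res \<mu> \<sigma> (1/2) (Suc t)));
        v' = Q d (mean_vec d n vi') v
          (dir_down_rad \<gamma> \<mu> \<sigma> (1/2) (Suc t)) (dir_res \<mu> \<sigma> (1/2) (Suc t))
    in (x', Hi', H', vi', v'))"
  define S where "S = rec_nat (x0, Hi0, H0, vi0, v0) step"
  have S0: "S 0 = (x0, Hi0, H0, vi0, v0)" and SS: "S (Suc t) = step t (S t)" for t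
    by (simp_all add: S_def)
  define x where "x t = fst (S t)" for t
  define Hi where "Hi t = fst (snd (S t))" for t
  define H where "H t = fst (snd (snd (S t)))" for t
  define vi where "vi t = fst (snd (snd (snd (S t))))" for t
  define v where "v t = snd (snd (snd (snd (S t))))" for t
  note defs = x_def Hi_def H_def vi_def v_def
  have St: "S t = (x t, Hi t, H t, vi t, v t)" for t by (simp add: defs)
  have next_round: "x (Suc t) = x t - v t"
    "Hi (Suc t) i = quantize_mat Q d (hs i (x (Suc t))) (Hi t i)
      (hess_up_rad d \<gamma> \<mu> (1/2) (Suc t)) (hess_res \<gamma> \<mu> (1/2) (Suc t))"
    "H (Suc t) = quantize_mat Q d (mean_mat d n (Hi (Suc t))) (H t)
      (hess_down_rad d \<gamma> \<mu> (1/2) (Suc t)) (hess_res \<gamma> \<mu> (1/2) (Suc t))"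
    "vi (Suc t) i = Q d (newton_dir (H (Suc t)) (gr i (x (Suc t)))) (vi t i)
      (dir_up_rad \<gamma> \<mu> \<sigma> (1/2) (Suc t)) (dir_res \<mu> \<sigma> (1/2) (Suc t))"
    "v (Suc t) = Q d (mean_vec d n (vi (Suc t))) (v t)
      (dir_down_rad \<gamma> \<mu> \<sigma> (1/2) (Suc t)) (dir_res \<mu> \<sigma> (1/2) (Suc t))" for t i
    using SS[of t] unfolding St step_def by (auto simp: Let_def)
  have start: "x 0 = x0" "Hi 0 = Hi0" "H 0 = H0" "vi 0 = vi0" "v 0 = v0"
    by (simp_all add: defs S0)
  have "quantized_newton Q d n i0 gr hs \<gamma> \<mu> \<sigma> (1/2) x0 x Hi H vi v"
    unfolding quantized_newton_def start
    using Hi0' M(3) vi0' D next_round by blast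
  then show ?thesis by blast
qed

end

section \<open>Communication cost\<close>

text \<open>With \<open>s = \<surd>d\<close> and \<open>k = \<kappa>\<close>, the quotients of Hessian messages have the form \<open>\<surd>2 s Y\<close>, where \<open>Y\<close> is one
  of \<open>32 k\<^sup>2\<close>, \<open>1 + 32 k\<^sup>2\<close>, \<open>40/3 k\<close> and \<open>1 + 40/3 k\<close>.\<close>

lemma hess_ratio_bounds:
  fixes k s Y :: real
  assumes "1 \<le> k" "1 \<le> s" "2 \<le> Y" "Y \<le> 33 * k\<^sup>2"
  shows "2 \<le> sqrt 2 * (s * Y)" "sqrt 2 * (s * Y) \<le> 353 * (s * k)\<^sup>2"
proof -
  have "1 * (1 * 2) \<le> sqrt 2 * (s * Y)"
    using assms by (intro mult_mono) auto
  then show "2 \<le> sqrt 2 * (s * Y)" by simp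
  have "sqrt 2 \<le> 2" by (rule real_le_lsqrt) auto
  then have "sqrt 2 * (s * Y) \<le> 2 * (s\<^sup>2 * (33 * k\<^sup>2))"
    using assms by (intro mult_mono) (auto simp: power2_eq_square)
  also have "\<dots> \<le> 353 * (s * k)\<^sup>2"
    by (simp add: power_mult_distrib)
  finally show "sqrt 2 * (s * Y) \<le> 353 * (s * k)\<^sup>2" .
qed

lemma dir_ratio_bounds:
  fixes k s X :: real
  assumes "1 \<le> k" "1 \<le> s" "2 \<le> X" "X \<le> 353 * k"
  shows "2 \<le> X" "X \<le> 353 * (s * k)\<^sup>2"
proof -
  have "k * 1 \<le> (s * k) * (s * k)"
    using assms mult_mono[of 1 s k k] mult_mono[of 1 s 1 k]
    by (intro mult_mono) auto
  then show "X \<le> 353 * (s * k)\<^sup>2"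
    using assms(4) unfolding power2_eq_square by linarith
qed fact

text \<open>The constant \<open>353\<close> comes from \<open>1 + 352 \<kappa>\<close>, the quotient of the directions sent by the master.\<close>

lemma message_ratios:
  assumes d: "0 < d" and p: "0 < \<gamma>" "0 < \<mu>" "0 < \<sigma>" and le: "\<mu> \<le> \<gamma>"
  defines "M \<equiv> 353 * (sqrt (real d) * (\<gamma> / \<mu>))\<^sup>2"
  shows "hess_up_rad d \<gamma> \<mu> (1/2) t / hess_res \<gamma> \<mu> (1/2) t \<in> {2..M}"
    and "hess_down_rad d \<gamma> \<mu> (1/2) t / hess_res \<gamma> \<mu> (1/2) t \<in> {2..M}"
    and "dir_up_rad \<gamma> \<mu> \<sigma> (1/2) t / dir_res \<mu> \<sigma> (1/2) t \<in> {2..M}"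
    and "dir_down_rad \<gamma> \<mu> \<sigma> (1/2) t / dir_res \<mu> \<sigma> (1/2) t \<in> {2..M}"
proof -
  define k where "k = \<gamma> / \<mu>"
  define s where "s = sqrt (real d)"
  have k: "1 \<le> k" using p le by (simp add: k_def)
  have s: "1 \<le> s" using d by (simp add: s_def)
  have kk: "k \<le> k\<^sup>2" using k by (simp add: power2_eq_square)
  have \<gamma>: "\<gamma> = k * \<mu>" using p by (simp add: k_def)
  have kp: "0 < k" using k by linarith
  have M: "M = 353 * (s * k)\<^sup>2" by (simp add: M_def s_def k_def)
  have H: "y / hess_res \<gamma> \<mu> (1/2) u = sqrt 2 * (y / (\<mu>\<^sup>2 / (16 * \<gamma>) * (3/4) ^ u))" for y u
    by (simp only: hess_res_half(2)[OF p(1,2), symmetric]) simp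
  show "hess_up_rad d \<gamma> \<mu> (1/2) t / hess_res \<gamma> \<mu> (1/2) t \<in> {2..M}"
  proof (cases t)
    case 0
    have E: "s * (2 * \<gamma>) / (\<mu>\<^sup>2 / (16 * \<gamma>) * (3/4) ^ 0) = s * (32 * k\<^sup>2)"
      using p kp by (simp add: \<gamma> power2_eq_square field_simps)
    have "2 \<le> 32 * k\<^sup>2" "32 * k\<^sup>2 \<le> 33 * k\<^sup>2"
      using k kk by simp_all
    from hess_ratio_bounds[OF k s this] show ?thesis
      unfolding 0 H hess_rad_half[OF p(1,2)] s_def[symmetric] M E atLeastAtMost_iff by (rule conjI)
  next
    case (Suc u)
    have E: "s * (5/8 * \<mu> * (3/4) ^ u) / (\<mu>\<^sup>2 / (16 * \<gamma>) * (3/4) ^ Suc u) = s * (40/3 * k)"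
      using p kp by (simp add: \<gamma> power2_eq_square field_simps)
    have "2 \<le> 40/3 * k" "40/3 * k \<le> 33 * k\<^sup>2"
      using k kk by simp_all
    from hess_ratio_bounds[OF k s this] show ?thesis
      unfolding Suc H hess_rad_half[OF p(1,2)] s_def[symmetric] M E atLeastAtMost_iff by (rule conjI)
  qed
  show "hess_down_rad d \<gamma> \<mu> (1/2) t / hess_res \<gamma> \<mu> (1/2) t \<in> {2..M}"
  proof (cases t)
    case 0
    have E: "s * (\<mu>\<^sup>2 / (16 * \<gamma>) + 2 * \<gamma>) / (\<mu>\<^sup>2 / (16 * \<gamma>) * (3/4) ^ 0) = s * (1 + 32 * k\<^sup>2)"
      using p kp by (simp add: \<gamma> power2_eq_square field_simps)
    have "2 \<le> 1 + 32 * k\<^sup>2" "1 + 32 * k\<^sup>2 \<le> 33 * k\<^sup>2"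
      using k kk by simp_all
    from hess_ratio_bounds[OF k s this] show ?thesis
      unfolding 0 H hess_rad_half[OF p(1,2)] s_def[symmetric] M E atLeastAtMost_iff by (rule conjI)
  next
    case (Suc u)
    have E: "s * (\<mu>\<^sup>2 / (16 * \<gamma>) * (3/4) ^ Suc u + 5/8 * \<mu> * (3/4) ^ u) /
        (\<mu>\<^sup>2 / (16 * \<gamma>) * (3/4) ^ Suc u) = s * (1 + 40/3 * k)"
      using p kp by (simp add: \<gamma> power2_eq_square field_simps)
    have "2 \<le> 1 + 40/3 * k" "1 + 40/3 * k \<le> 33 * k\<^sup>2"
      using k kk by simp_all
    from hess_ratio_bounds[OF k s this] show ?thesis
      unfolding Suc H hess_rad_half[OF p(1,2)] s_def[symmetric] M E atLeastAtMost_iff by (rule conjI)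
  qed
  show "dir_up_rad \<gamma> \<mu> \<sigma> (1/2) t / dir_res \<mu> \<sigma> (1/2) t \<in> {2..M}"
  proof (cases t)
    case 0
    have E: "4 * \<gamma> / \<sigma> / (\<mu> / (32 * \<sigma>) * (3/4) ^ 0) = 128 * k"
      using p by (simp add: \<gamma> field_simps)
    have "2 \<le> 128 * k" "128 * k \<le> 353 * k"
      using k by simp_all
    from dir_ratio_bounds[OF k s this] show ?thesis
      unfolding 0 dir_half[OF p] M E atLeastAtMost_iff by (rule conjI)
  next
    case (Suc u)
    have E: "11 * \<gamma> / \<sigma> * (3/4) ^ Suc u / (\<mu> / (32 * \<sigma>) * (3/4) ^ Suc u) = 352 * k"
      using p by (simp add: \<gamma> field_simps)
    have "2 \<le> 352 * k" "352 * k \<le> 353 * k"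
      using k by simp_all
    from dir_ratio_bounds[OF k s this] show ?thesis
      unfolding Suc dir_half[OF p] M E atLeastAtMost_iff by (rule conjI)
  qed
  show "dir_down_rad \<gamma> \<mu> \<sigma> (1/2) t / dir_res \<mu> \<sigma> (1/2) t \<in> {2..M}"
  proof (cases t)
    case 0
    have E: "(\<mu> / (32 * \<sigma>) + 4 * \<gamma> / \<sigma>) / (\<mu> / (32 * \<sigma>) * (3/4) ^ 0) = 1 + 128 * k"
      using p by (simp add: \<gamma> field_simps)
    have "2 \<le> 1 + 128 * k" "1 + 128 * k \<le> 353 * k"
      using k by simp_all
    from dir_ratio_bounds[OF k s this] show ?thesis
      unfolding 0 dir_half[OF p] M E atLeastAtMost_iff by (rule conjI)
  next
    case (Suc u)
    have E: "(\<mu> / (32 * \<sigma>) * (3/4) ^ Suc u + 11 * \<gamma> / \<sigma> * (3/4) ^ Suc u) /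
        (\<mu> / (32 * \<sigma>) * (3/4) ^ Suc u) = 1 + 352 * k"
      using p by (simp add: \<gamma> field_simps)
    have "2 \<le> 1 + 352 * k" "1 + 352 * k \<le> 353 * k"
      using k by simp_all
    from dir_ratio_bounds[OF k s this] show ?thesis
      unfolding Suc dir_half[OF p] M E atLeastAtMost_iff by (rule conjI)
  qed
qed

lemma resolutions_pos:
  assumes "0 < \<gamma>" "0 < \<mu>" "0 < \<sigma>"
  shows "0 < hess_res \<gamma> \<mu> (1/2) t" "0 < dir_res \<mu> \<sigma> (1/2) t"
  using assms by (simp_all add: hess_res_half(1) dir_half(1))

text \<open>The lower bound \<open>2\<close> of the quotients is what makes the bit bound applicable. Vectorized Hessians have
  dimension \<open>d (d + 1) / 2 \<le> d\<^sup>2\<close>; the same bound serves for the directions, of dimension \<open>d\<close>.\<close>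

lemma round_bits_le:
  assumes d: "0 < d" and p: "0 < \<gamma>" "0 < \<mu>" "0 < \<sigma>" and le: "\<mu> \<le> \<gamma>" and c: "0 \<le> c"
    and b: "\<And>N y \<epsilon>. 0 < N \<Longrightarrow> 0 < y \<Longrightarrow> 0 < \<epsilon> \<Longrightarrow> 2 \<le> y / \<epsilon> \<Longrightarrow>
      real (b N y \<epsilon>) \<le> c * (real N * log 2 (y / \<epsilon>))"
  shows "real (round_bits b d n \<gamma> \<mu> \<sigma> (1/2) t) \<le>
    real n * (4 * c * (real d)\<^sup>2 * log 2 (353 * (sqrt (real d) * (\<gamma> / \<mu>))\<^sup>2))"
proof -
  define M where "M = 353 * (sqrt (real d) * (\<gamma> / \<mu>))\<^sup>2"
  have one: "real (b N y \<epsilon>) \<le> c * (real d)\<^sup>2 * log 2 M"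
    if N: "0 < N" "real N \<le> (real d)\<^sup>2" and \<epsilon>: "0 < \<epsilon>" and r: "y / \<epsilon> \<in> {2..M}" for N y \<epsilon>
  proof -
    have y: "0 < y" using r \<epsilon> by (auto simp: pos_le_divide_eq)
    have "real (b N y \<epsilon>) \<le> c * (real N * log 2 (y / \<epsilon>))"
      using r by (intro b N(1) y \<epsilon>) auto
    also have "\<dots> \<le> c * ((real d)\<^sup>2 * log 2 M)"
      using r N(2) c by (intro mult_left_mono mult_mono) auto
    finally show ?thesis by (simp add: mult.assoc)
  qed
  have "2 * sym_dim d \<le> d * (d + 1)" by (simp add: sym_dim_def)
  also have "\<dots> \<le> 2 * (d * d)" using d by simp
  finally have "sym_dim d \<le> d * d" by simp
  then have Ns: "real (sym_dim d) \<le> (real d)\<^sup>2"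
    by (metis of_nat_le_iff of_nat_mult power2_eq_square)
  have Nd: "real d \<le> (real d)\<^sup>2" using d by (simp add: power2_eq_square)
  note R = message_ratios[OF d p le, where t = t, folded M_def] resolutions_pos[OF p, where t = t]
  note S = sym_dim_pos[OF d]
  have "real (round_bits b d n \<gamma> \<mu> \<sigma> (1/2) t) \<le> (\<Sum>i<n. 4 * (c * (real d)\<^sup>2 * log 2 M))"
    unfolding round_bits_def of_nat_sum of_nat_add
  proof (rule sum_mono)
    fix i
    show "real (b (sym_dim d) (hess_up_rad d \<gamma> \<mu> (1/2) t) (hess_res \<gamma> \<mu> (1/2) t)) +
        real (b (sym_dim d) (hess_down_rad d \<gamma> \<mu> (1/2) t) (hess_res \<gamma> \<mu> (1/2) t)) +
        real (b d (dir_up_rad \<gamma> \<mu> \<sigma> (1/2) t) (dir_res \<mu> \<sigma> (1/2) t)) +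
        real (b d (dir_down_rad \<gamma> \<mu> \<sigma> (1/2) t) (dir_res \<mu> \<sigma> (1/2) t)) \<le>
        4 * (c * (real d)\<^sup>2 * log 2 M)"
      using one[OF S Ns R(5) R(1)] one[OF S Ns R(5) R(2)] one[OF d Nd R(6) R(3)]
        one[OF d Nd R(6) R(4)] by linarith
  qed
  then show ?thesis by (simp add: M_def mult.assoc)
qed

text \<open>The bit bound also holds with the absolute value of its constant, and replacing the logarithm by a larger
  one needs a nonnegative constant.\<close>

lemma quantization_bits:
  assumes "quantization Q enc dec b"
  obtains c where "0 \<le> c" "\<And>N y \<epsilon>. 0 < N \<Longrightarrow> 0 < y \<Longrightarrow> 0 < \<epsilon> \<Longrightarrow> 2 \<le> y / \<epsilon> \<Longrightarrow>
      real (b N y \<epsilon>) \<le> c * (real N * log 2 (y / \<epsilon>))"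
proof -
  obtain c where c: "\<forall>N>0. \<forall>y>0. \<forall>\<epsilon>>0. 2 \<le> y / \<epsilon> \<longrightarrow>
      real (b N y \<epsilon>) \<le> c * (real N * log 2 (y / \<epsilon>))"
    using assms[unfolded quantization_def, THEN conjunct2] by (rule exE)
  show thesis
  proof (rule that[of "\<bar>c\<bar>"])
    fix N :: nat and y \<epsilon> :: real
    assume *: "0 < N" "0 < y" "0 < \<epsilon>" "2 \<le> y / \<epsilon>"
    have "real (b N y \<epsilon>) \<le> c * (real N * log 2 (y / \<epsilon>))"
      using c * by blast
    also have "\<dots> \<le> \<bar>c\<bar> * (real N * log 2 (y / \<epsilon>))"
    proof (rule mult_right_mono)
      have "0 \<le> log 2 (y / \<epsilon>)"
        using *(4) by (subst zero_le_log_cancel_iff) linarith+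
      then show "0 \<le> real N * log 2 (y / \<epsilon>)" by simp
    qed simp
    finally show "real (b N y \<epsilon>) \<le> \<bar>c\<bar> * (real N * log 2 (y / \<epsilon>))" .
  qed simp
qed

text \<open>Additive constants are absorbed into logarithms of quantities that stay above \<open>\<rho> > 1\<close>. Without such a
  \<open>\<rho>\<close> the logarithms could be arbitrarily small and no constant would do.\<close>

lemma ln_over_const:
  fixes \<rho> s a :: real
  assumes "1 < \<rho>" "\<rho> \<le> s" "0 \<le> a"
  shows "a \<le> a / ln \<rho> * ln s"
proof -
  have "ln \<rho> \<le> ln s" "0 < ln \<rho>" using assms by auto
  then have "a / ln \<rho> * ln \<rho> \<le> a / ln \<rho> * ln s"
    using assms by (intro mult_left_mono) auto
  then show ?thesis using \<open>0 < ln \<rho>\<close> by simp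
qed

lemma log_353_sq_le:
  fixes \<rho> s :: real
  assumes "1 < \<rho>" "\<rho> \<le> s"
  shows "log 2 (353 * s\<^sup>2) \<le> (ln 353 / ln \<rho> + 2) / ln 2 * ln s"
proof -
  have "ln (353 * s\<^sup>2) = ln 353 + 2 * ln s"
    using assms by (simp add: ln_mult ln_realpow)
  also have "\<dots> \<le> (ln 353 / ln \<rho> + 2) * ln s"
    using ln_over_const[OF assms, of "ln 353"] by (simp add: distrib_right)
  finally show ?thesis
    by (simp add: log_def divide_right_mono)
qed

lemma (in newton_problem) run_gap:
  assumes run: "quantized_newton Q d n i0 gr hs \<gamma> \<mu> \<sigma> (1/2) x0 x Hi H vi v"
  shows "vnorm (x t - xstar) \<le> \<mu> / (4 * \<sigma>) * (3/4) ^ t"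
    and "mean_fun n f (x t) - mean_fun n f xstar \<le> \<gamma> * \<mu>\<^sup>2 / \<sigma>\<^sup>2 * (9/16) ^ t"
proof -
  have T: "x t \<in> carrier_vec d" "vnorm (x t - xstar) \<le> \<mu> / (4 * \<sigma>) * (3/4) ^ t"
    using run_tracks[OF run, of t] unfolding tracks_def by auto
  show "vnorm (x t - xstar) \<le> \<mu> / (4 * \<sigma>) * (3/4) ^ t" by (rule T(2))
  have "mean_fun n f (x t) - mean_fun n f xstar \<le> \<gamma> * (vnorm (x t - xstar))\<^sup>2"
    by (rule function_gap[OF T(1)])
  also have "\<dots> \<le> \<gamma> * (\<mu> / (4 * \<sigma>) * (3/4) ^ t)\<^sup>2"
    using T(2) pos by (intro mult_left_mono power_mono) auto
  also have "\<dots> = \<gamma> * \<mu>\<^sup>2 / \<sigma>\<^sup>2 * (9/16) ^ t / 16"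
  proof -
    have sq: "((3/4 :: real) ^ t)\<^sup>2 = (9/16) ^ t"
      unfolding power2_eq_square power_mult_distrib[symmetric] by simp
    show ?thesis
      unfolding power_mult_distrib[of _ "(3/4) ^ t"] sq by (simp add: power_mult_distrib power_divide)
  qed
  also have "\<dots> \<le> \<gamma> * \<mu>\<^sup>2 / \<sigma>\<^sup>2 * (9/16) ^ t"
  proof -
    have le: "y / 16 \<le> y" if "0 \<le> y" for y :: real using that by simp
    show ?thesis by (rule le) (use pos in simp)
  qed
  finally show "mean_fun n f (x t) - mean_fun n f xstar \<le> \<gamma> * \<mu>\<^sup>2 / \<sigma>\<^sup>2 * (9/16) ^ t" .
qed

text \<open>The number of rounds after which \<open>(16/9) ^ t \<ge> R\<close>.\<close>

lemma (in newton_problem) accuracy_reached: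
  assumes run: "quantized_newton Q d n i0 gr hs \<gamma> \<mu> \<sigma> (1/2) x0 x Hi H vi v" and \<epsilon>: "0 < \<epsilon>"
  defines "R \<equiv> \<gamma> * \<mu>\<^sup>2 / (\<sigma>\<^sup>2 * \<epsilon>)"
  shows "mean_fun n f (x (nat \<lceil>ln R / ln (16/9)\<rceil>)) - mean_fun n f xstar \<le> \<epsilon>"
proof -
  let ?t = "nat \<lceil>ln R / ln (16/9)\<rceil>"
  have R: "0 < R" using pos \<epsilon> by (simp add: R_def)
  have "ln R / ln (16/9) \<le> real ?t" by (rule real_nat_ceiling_ge)
  then have "ln R \<le> real ?t * ln (16/9)" by (simp add: pos_divide_le_eq)
  then have "ln R \<le> ln ((16/9) ^ ?t)" by (simp add: ln_realpow)
  then have "R \<le> (16/9) ^ ?t" using R by (subst (asm) ln_le_cancel_iff) auto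
  then have "R * (9/16) ^ ?t \<le> (16/9) ^ ?t * (9/16) ^ ?t" by (rule mult_right_mono) simp
  also have "\<dots> = 1" by (simp add: power_mult_distrib[symmetric])
  finally have "R * (9/16) ^ ?t * \<epsilon> \<le> \<epsilon>" using \<epsilon> by simp
  then have "\<gamma> * \<mu>\<^sup>2 / \<sigma>\<^sup>2 * (9/16) ^ ?t \<le> \<epsilon>" using \<epsilon> by (simp add: R_def)
  then show ?thesis using run_gap(2)[OF run, of ?t] by linarith
qed

text \<open>Rounds \<open>0, \<dots>, T\<close> are paid, so \<open>Suc T\<close> times the cost of a round, where
  \<open>T \<le> ln R / ln (16/9) + 1\<close>. The constant is explicit and depends on \<open>\<rho>\<close> and \<open>c\<close> only.\<close>

lemma (in newton_problem) total_bits_le: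
  assumes run: "quantized_newton Q d n i0 gr hs \<gamma> \<mu> \<sigma> (1/2) x0 x Hi H vi v" and \<epsilon>: "0 < \<epsilon>"
    and c: "0 \<le> c" "\<And>N y \<epsilon>. 0 < N \<Longrightarrow> 0 < y \<Longrightarrow> 0 < \<epsilon> \<Longrightarrow> 2 \<le> y / \<epsilon> \<Longrightarrow>
      real (b N y \<epsilon>) \<le> c * (real N * log 2 (y / \<epsilon>))"
    and \<rho>: "1 < \<rho>"
  defines "S \<equiv> sqrt (real d) * (\<gamma> / \<mu>)" and "R \<equiv> \<gamma> * \<mu>\<^sup>2 / (\<sigma>\<^sup>2 * \<epsilon>)"
    and "A \<equiv> (ln 353 / ln \<rho> + 2) / ln 2" and "B \<equiv> 1 / ln (16/9) + 2 / ln \<rho>"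
  assumes S: "\<rho> \<le> S" and R: "\<rho> \<le> R"
  shows "real (total_bits b d n \<gamma> \<mu> \<sigma> (1/2)
      (LEAST t. mean_fun n f (x t) - mean_fun n f xstar \<le> \<epsilon>))
    \<le> 4 * c * A * B * (real n * (real d)\<^sup>2 * ln S * ln R)"
proof -
  define T where "T = (LEAST t. mean_fun n f (x t) - mean_fun n f xstar \<le> \<epsilon>)"
  have AB: "0 \<le> A" "0 \<le> B" using \<rho> by (auto simp: A_def B_def)
  have lnS: "0 < ln S" and lnR: "0 < ln R" using S R \<rho> by auto
  have "T \<le> nat \<lceil>ln R / ln (16/9)\<rceil>"
    unfolding T_def R_def by (rule Least_le) (rule accuracy_reached[OF run \<epsilon>])
  then have "real T \<le> real (nat \<lceil>ln R / ln (16/9)\<rceil>)" by simp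
  also have "\<dots> \<le> ln R / ln (16/9) + 1"
  proof -
    have "0 \<le> ln R / ln (16/9)" using lnR by simp
    then have "0 \<le> \<lceil>ln R / ln (16/9)\<rceil>" by linarith
    then show ?thesis
      using ceiling_correct[of "ln R / ln (16/9)"] of_nat_nat[of "\<lceil>ln R / ln (16/9)\<rceil>"] by linarith
  qed
  finally have "real (Suc T) \<le> ln R / ln (16/9) + 2" by simp
  also have "\<dots> \<le> B * ln R"
    using ln_over_const[OF \<rho> R, of 2] by (simp add: B_def distrib_right)
  finally have T: "real (Suc T) \<le> B * ln R" .
  define L where "L = 4 * c * (real d)\<^sup>2 * log 2 (353 * S\<^sup>2)"
  have L: "L \<le> 4 * c * (real d)\<^sup>2 * (A * ln S)"
    unfolding L_def A_def using c(1) by (intro mult_left_mono log_353_sq_le[OF \<rho> S]) auto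
  have "real (total_bits b d n \<gamma> \<mu> \<sigma> (1/2) T) \<le> (\<Sum>t\<le>T. real n * L)"
    unfolding total_bits_def of_nat_sum L_def S_def
    by (intro sum_mono round_bits_le[OF pos(1,4,5,6) mu_le_gamma c])
  also have "\<dots> = real (Suc T) * (real n * L)" by simp
  also have "\<dots> \<le> real (Suc T) * (real n * (4 * c * (real d)\<^sup>2 * (A * ln S)))"
    using L by (intro mult_left_mono) auto
  also have "\<dots> \<le> B * ln R * (real n * (4 * c * (real d)\<^sup>2 * (A * ln S)))"
    using T c(1) AB lnS by (intro mult_right_mono) auto
  also have "\<dots> = 4 * c * A * B * (real n * (real d)\<^sup>2 * ln S * ln R)"
    by (simp add: mult_ac)
  finally show ?thesis unfolding T_def .
qed

theorem theorem8:
  fixes Q :: "nat \<Rightarrow> real vec \<Rightarrow> real vec \<Rightarrow> real \<Rightarrow> real \<Rightarrow> real vec"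
    and enc :: "nat \<Rightarrow> real \<Rightarrow> real \<Rightarrow> real vec \<Rightarrow> bool list"
    and dec :: "nat \<Rightarrow> real \<Rightarrow> real \<Rightarrow> bool list \<Rightarrow> real vec \<Rightarrow> real vec"
    and b :: "nat \<Rightarrow> real \<Rightarrow> real \<Rightarrow> nat"
  assumes "quantization Q enc dec b"
  shows "\<forall>\<rho>>1::real. \<exists>C>0::real.
    \<forall>(d::nat) (n::nat) (i0::nat) (f :: nat \<Rightarrow> real vec \<Rightarrow> real) gr hs \<gamma> \<mu> \<sigma> xstar xistar x0.
      newton_setting d n i0 f gr hs \<gamma> \<mu> \<sigma> \<longrightarrow>
      is_arg_min (mean_fun n f) (\<lambda>y. y \<in> carrier_vec d) xstar \<longrightarrow>
      (\<forall>i<n. is_arg_min (f i) (\<lambda>y. y \<in> carrier_vec d) (xistar i)) \<longrightarrow>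
      x0 \<in> carrier_vec d \<longrightarrow>
      (\<forall>i<n. vnorm (x0 - xstar) \<le> \<mu> / (4 * \<sigma>) \<and> vnorm (x0 - xistar i) \<le> \<mu> / (4 * \<sigma>)) \<longrightarrow>
      (\<exists>x Hi H vi v. quantized_newton Q d n i0 gr hs \<gamma> \<mu> \<sigma> (1/2) x0 x Hi H vi v) \<and>
      (\<forall>x Hi H vi v. quantized_newton Q d n i0 gr hs \<gamma> \<mu> \<sigma> (1/2) x0 x Hi H vi v \<longrightarrow>
        (\<forall>t. vnorm (x t - xstar) \<le> \<mu> / (4 * \<sigma>) * (3/4) ^ t) \<and>
        (\<forall>\<epsilon>>0.
          (\<exists>t. mean_fun n f (x t) - mean_fun n f xstar \<le> \<epsilon>) \<and>
          (\<rho> \<le> sqrt (real d) * (\<gamma> / \<mu>) \<longrightarrow> \<rho> \<le> \<gamma> * \<mu>\<^sup>2 / (\<sigma>\<^sup>2 * \<epsilon>) \<longrightarrow>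
            real (total_bits b d n \<gamma> \<mu> \<sigma> (1/2)
                (LEAST t. mean_fun n f (x t) - mean_fun n f xstar \<le> \<epsilon>))
              \<le> C * (real n * (real d)\<^sup>2 * ln (sqrt (real d) * (\<gamma> / \<mu>))
                    * ln (\<gamma> * \<mu>\<^sup>2 / (\<sigma>\<^sup>2 * \<epsilon>))))))"
proof -
  obtain c where c: "0 \<le> c" "\<And>N y \<epsilon>. 0 < N \<Longrightarrow> 0 < y \<Longrightarrow> 0 < \<epsilon> \<Longrightarrow> 2 \<le> y / \<epsilon> \<Longrightarrow>
      real (b N y \<epsilon>) \<le> c * (real N * log 2 (y / \<epsilon>))"
    using quantization_bits[OF assms] by blast
  show ?thesis
  proof (intro allI impI, goal_cases)
    case (1 \<rho>)
    define K where "K = 4 * c * ((ln 353 / ln \<rho> + 2) / ln 2) * (1 / ln (16/9) + 2 / ln \<rho>)"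
    \<comment> \<open>the summand 1 keeps the constant positive when c = 0\<close>
    have C: "0 < K + 1" using 1 c(1) by (simp add: K_def add_nonneg_pos)
    have problem: "newton_problem Q enc dec b d n i0 f gr hs \<gamma> \<mu> \<sigma> xstar xistar x0"
      if "newton_setting d n i0 f gr hs \<gamma> \<mu> \<sigma>"
        "is_arg_min (mean_fun n f) (\<lambda>y. y \<in> carrier_vec d) xstar"
        "\<forall>i<n. is_arg_min (f i) (\<lambda>y. y \<in> carrier_vec d) (xistar i)"
        "x0 \<in> carrier_vec d"
        "\<forall>i<n. vnorm (x0 - xstar) \<le> \<mu> / (4 * \<sigma>) \<and> vnorm (x0 - xistar i) \<le> \<mu> / (4 * \<sigma>)"
      for d n i0 f gr hs \<gamma> \<mu> \<sigma> xstar xistar x0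
      using that assms by unfold_locales auto
    show ?case
    proof (intro exI[of _ "K + 1"] conjI C allI impI, goal_cases)
      case (1 d n i0 f gr hs \<gamma> \<mu> \<sigma> xstar xistar x0)
      show ?case by (rule newton_problem.run_exists[OF problem[OF 1]])
    next
      case (2 d n i0 f gr hs \<gamma> \<mu> \<sigma> xstar xistar x0)
      show ?case by (rule newton_problem.run_gap(1)[OF problem[OF 2(1-5)] 2(6)])
    next
      case (3 d n i0 f gr hs \<gamma> \<mu> \<sigma> xstar xistar x0)
      show ?case
        by (rule exI) (rule newton_problem.accuracy_reached[OF problem[OF 3(1-5)] 3(6,7)])
    next
      case (4 d n i0 f gr hs \<gamma> \<mu> \<sigma> xstar xistar x0 x Hi H vi v \<epsilon>)
      let ?X = "real n * (real d)\<^sup>2 * ln (sqrt (real d) * (\<gamma> / \<mu>)) * ln (\<gamma> * \<mu>\<^sup>2 / (\<sigma>\<^sup>2 * \<epsilon>))"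
      have "0 \<le> ?X" using 4(8,9) \<open>1 < \<rho>\<close> by simp
      moreover have "real (total_bits b d n \<gamma> \<mu> \<sigma> (1/2)
          (LEAST t. mean_fun n f (x t) - mean_fun n f xstar \<le> \<epsilon>)) \<le> K * ?X"
        unfolding K_def
        by (rule newton_problem.total_bits_le[OF problem[OF 4(1-5)] 4(6,7) c \<open>1 < \<rho>\<close> 4(8,9)])
      ultimately show ?case by (simp only: distrib_right mult_1)
    qed
  qed
qed

end
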